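(* Let $\Bbbk$ be a field, and let $n \geqslant 1$ and $d \geqslant 2$ be integers. Let $NC_A(n,d)$ be the unital associative $\Bbbk$-algebra with generators $T_1, \dots, T_n$ and relations \begin{align*} T_i T_{i+1} T_i &= T_{i+1} T_i T_{i+1} && \text{for all } 0 < i < n,\\ T_i T_j &= T_j T_i && \text{for all } |i-j| > 1,\\ T_1^2 = \cdots = T_{n-1}^2 &= T_n^d = 0. \end{align*} Then $NC_A(n,d)$ has a $\Bbbk$-basis consisting of the following $n!\,(1 + n(d-1))$ (pairwise distinct) words: $$\{ T_w : w \in S_n \} \ \sqcup\ \{ T_w T_n^k T_{n-1} T_{n-2} \cdots T_{m+1} T_m : \ w \in S_n,\ k \in [1,d-1],\ m \in [1,n] \}.$$ In particular, for all $0 < l < n$, the subalgebra $R_l$ of $NC_A(n,d)$ generated by $T_1, \dots, T_l$ is isomorphic to the usual type $A_l$ nil-Coxeter algebra $NC(M_{A_l}((2,\dots,2)))$.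
   Context: Notation. $[a,b]$ denotes the set of integers $k$ with $a \leqslant k \leqslant b$. $S_n$ is the symmetric group with its simple reflections $s_1, \dots, s_{n-1}$ (adjacent transpositions); for $w \in S_n$ with a reduced expression $w = s_{i_1} \cdots s_{i_r}$, $T_w := T_{i_1} \cdots T_{i_r}$, which is a word in $T_1, \dots, T_{n-1}$ whose value is independent of the choice of reduced expression by the braid relations; $T_1$ for $w = 1$ the identity is the empty word, i.e. the unit. In the word $T_w T_n^k T_{n-1} \cdots T_m$, the case $m = n$ means $T_w T_n^k$ (the product $T_{n-1} \cdots T_m$ is empty). $NC(M_{A_l}((2,\dots,2)))$ is the unital associative $\Bbbk$-algebra with generators $T_1, \dots, T_l$ and relations $T_i T_{i+1} T_i = T_{i+1} T_i T_{i+1}$ for $0 < i < l$, $T_i T_j = T_j T_i$ for $|i-j|>1$, and $T_i^2 = 0$ for all $1 \leqslant i \leqslant l$. *)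

theory Defs
  imports "HOL-Algebra.Algebra" "Jordan_Normal_Form.Missing_VectorSpace"
begin

text \<open>
  Unital associative algebras over a field \<open>K\<close> are carried by the record type of
  \<^theory>\<open>HOL-Algebra.Module\<close>, whose ring part need not be commutative.
\<close>

definition word_val :: "('a, 'b) monoid_scheme \<Rightarrow> ('x \<Rightarrow> 'a) \<Rightarrow> 'x list \<Rightarrow> 'a" where
  "word_val G g u = foldr (\<lambda>x y. g x \<otimes>\<^bsub>G\<^esub> y) u \<one>\<^bsub>G\<^esub>"


section \<open>Algebras given by generators and relations\<close>

text \<open>
  The free algebra \<open>K\<langle>V\<rangle>\<close>: an element is its coefficient function on words, and the product
  sums over all ways of cutting a word in two.
\<close>

definition free_algebra :: "('k, 'm) ring_scheme \<Rightarrow> 'x set \<Rightarrow> ('k, 'x list \<Rightarrow> 'k) module" where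
  "free_algebra K V =
    \<lparr> carrier = {f. (\<forall>u. f u \<in> carrier K) \<and> finite {u. f u \<noteq> \<zero>\<^bsub>K\<^esub>} \<and>
        (\<forall>u. f u \<noteq> \<zero>\<^bsub>K\<^esub> \<longrightarrow> set u \<subseteq> V)},
      monoid.mult = (\<lambda>f g u. \<Oplus>\<^bsub>K\<^esub> i\<in>{..length u}. f (take i u) \<otimes>\<^bsub>K\<^esub> g (drop i u)),
      monoid.one = (\<lambda>u. if u = [] then \<one>\<^bsub>K\<^esub> else \<zero>\<^bsub>K\<^esub>),
      ring.zero = (\<lambda>u. \<zero>\<^bsub>K\<^esub>),
      ring.add = (\<lambda>f g u. f u \<oplus>\<^bsub>K\<^esub> g u),
      smult = (\<lambda>c f u. c \<otimes>\<^bsub>K\<^esub> f u) \<rparr>"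

definition free_gen :: "('k, 'm) ring_scheme \<Rightarrow> 'x \<Rightarrow> 'x list \<Rightarrow> 'k" where
  "free_gen K x = (\<lambda>u. if u = [x] then \<one>\<^bsub>K\<^esub> else \<zero>\<^bsub>K\<^esub>)"

text \<open>
  The ring \<open>A Quot I\<close> with the induced scalar action; the latter is written on cosets in the
  same style as \<^const>\<open>rcoset_mult\<close>.
\<close>

definition quot_algebra :: "('k, 'a, 'm) module_scheme \<Rightarrow> 'a set \<Rightarrow> ('k, 'a set) module" where
  "quot_algebra A I =
    \<lparr> carrier = carrier (A Quot I),
      monoid.mult = monoid.mult (A Quot I),
      monoid.one = monoid.one (A Quot I),
      ring.zero = ring.zero (A Quot I),
      ring.add = ring.add (A Quot I),
      smult = (\<lambda>c U. \<Union>x\<in>U. I +>\<^bsub>A\<^esub> (c \<odot>\<^bsub>A\<^esub> x)) \<rparr>"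

text \<open>Relations \<open>p = q\<close> are given by their relators \<open>p - q\<close>, the set of which is \<open>R\<close>.\<close>

definition presented_algebra ::
    "('k, 'm) ring_scheme \<Rightarrow> 'x set \<Rightarrow> ('x list \<Rightarrow> 'k) set \<Rightarrow> ('k, ('x list \<Rightarrow> 'k) set) module" where
  "presented_algebra K V R = quot_algebra (free_algebra K V) (Idl\<^bsub>free_algebra K V\<^esub> R)"

definition presented_gen ::
    "('k, 'm) ring_scheme \<Rightarrow> 'x set \<Rightarrow> ('x list \<Rightarrow> 'k) set \<Rightarrow> 'x \<Rightarrow> ('x list \<Rightarrow> 'k) set" where
  "presented_gen K V R x =
    (Idl\<^bsub>free_algebra K V\<^esub> R) +>\<^bsub>free_algebra K V\<^esub> free_gen K x"


section \<open>Subalgebras and isomorphisms\<close>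

definition unital_subalgebra :: 
    "('k, 'm) ring_scheme \<Rightarrow> ('k, 'a, 'n) module_scheme \<Rightarrow> 'a set \<Rightarrow> bool" where
  "unital_subalgebra K A H \<longleftrightarrow>
    subring H A \<and> (\<forall>c\<in>carrier K. \<forall>x\<in>H. c \<odot>\<^bsub>A\<^esub> x \<in> H)"

definition generated_subalgebra ::
    "('k, 'm) ring_scheme \<Rightarrow> ('k, 'a, 'n) module_scheme \<Rightarrow> 'a set \<Rightarrow> ('k, 'a, 'n) module_scheme" where
  "generated_subalgebra K A S = A\<lparr>carrier := \<Inter>{H. unital_subalgebra K A H \<and> S \<subseteq> H}\<rparr>"

definition algebra_isos ::
    "('k, 'm) ring_scheme \<Rightarrow> ('k, 'a, 'n) module_scheme \<Rightarrow> ('k, 'b, 'p) module_scheme \<Rightarrow> ('a \<Rightarrow> 'b) set" where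
  "algebra_isos K A B = ring_iso A B \<inter> module_hom K A B"


section \<open>The algebras \<open>NC\<^sub>A(n,d)\<close> and the type A nil-Coxeter algebras\<close>

definition braid_relators :: "('k, 'm) ring_scheme \<Rightarrow> nat \<Rightarrow> (nat list \<Rightarrow> 'k) set" where
  "braid_relators K n = (let F = free_algebra K {1..n}; t = free_gen K in
    {(t i \<otimes>\<^bsub>F\<^esub> t (i+1) \<otimes>\<^bsub>F\<^esub> t i) \<ominus>\<^bsub>F\<^esub> (t (i+1) \<otimes>\<^bsub>F\<^esub> t i \<otimes>\<^bsub>F\<^esub> t (i+1)) | i. 0 < i \<and> i < n} \<union>
    {(t i \<otimes>\<^bsub>F\<^esub> t j) \<ominus>\<^bsub>F\<^esub> (t j \<otimes>\<^bsub>F\<^esub> t i) | i j.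
        i \<in> {1..n} \<and> j \<in> {1..n} \<and> \<bar>int i - int j\<bar> > 1})"

definition NC_A_relators :: "('k, 'm) ring_scheme \<Rightarrow> nat \<Rightarrow> nat \<Rightarrow> (nat list \<Rightarrow> 'k) set" where
  "NC_A_relators K n d = (let F = free_algebra K {1..n}; t = free_gen K in
    braid_relators K n \<union>
    {t i [^]\<^bsub>F\<^esub> (2::nat) | i. 1 \<le> i \<and> i < n} \<union> {t n [^]\<^bsub>F\<^esub> d})"

definition NC_A :: "('k, 'm) ring_scheme \<Rightarrow> nat \<Rightarrow> nat \<Rightarrow> ('k, (nat list \<Rightarrow> 'k) set) module" where
  "NC_A K n d = presented_algebra K {1..n} (NC_A_relators K n d)"

definition NC_A_gen :: "('k, 'm) ring_scheme \<Rightarrow> nat \<Rightarrow> nat \<Rightarrow> nat \<Rightarrow> (nat list \<Rightarrow> 'k) set" where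
  "NC_A_gen K n d i = presented_gen K {1..n} (NC_A_relators K n d) i"

text \<open>The algebra \<open>NC(M\<^bsub>A\<^sub>l\<^esub>((2,\<dots>,2)))\<close>.\<close>

definition nil_Coxeter_A :: "('k, 'm) ring_scheme \<Rightarrow> nat \<Rightarrow> ('k, (nat list \<Rightarrow> 'k) set) module" where
  "nil_Coxeter_A K l = presented_algebra K {1..l}
    (braid_relators K l \<union>
     {free_gen K i [^]\<^bsub>free_algebra K {1..l}\<^esub> (2::nat) | i. 1 \<le> i \<and> i \<le> l})"


section \<open>Reduced expressions\<close>

definition simple_reflection :: "nat \<Rightarrow> nat \<Rightarrow> nat" where
  "simple_reflection i = Transposition.transpose i (i + 1)"

definition reduced_expression :: "nat \<Rightarrow> (nat \<Rightarrow> nat) \<Rightarrow> nat list \<Rightarrow> bool" where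
  "reduced_expression n w u \<longleftrightarrow>
    set u \<subseteq> {1..<n} \<and> word_val (sym_group n) simple_reflection u = w \<and>
    (\<forall>v. set v \<subseteq> {1..<n} \<and> word_val (sym_group n) simple_reflection v = w \<longrightarrow> length u \<le> length v)"

text \<open>
  The element \<open>T\<^sub>w\<close>, read off from an arbitrarily chosen reduced expression of \<open>w\<close>. It is
  independent of that choice as soon as the \<open>g i\<close> satisfy the braid relations.
\<close>

definition T_perm :: "('a, 'b) monoid_scheme \<Rightarrow> (nat \<Rightarrow> 'a) \<Rightarrow> nat \<Rightarrow> (nat \<Rightarrow> nat) \<Rightarrow> 'a" where
  "T_perm G g n w = word_val G g (SOME u. reduced_expression n w u)"

end

(*
  Let the words in T_1, ..., T_n act on a finite set of states together with a zero state, each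
  state standing for one element of the claimed basis. A state is a pair (q, k): q is a permutation
  of {1..n+1} and k < d is the exponent of T_n. The element T_w corresponds to (w^-1, 0), and
  T_w T_n^k T_{n-1} ... T_m to (s_m ... s_n w^-1, k), so that k = 0 exactly if q fixes n+1, and
  m = q(n+1). For i < n the letter T_i sends q to q s_i or to zero; T_n acts in the same way as long
  as k <= 1 and the length goes up, and raises k if q(n) = n+1.

  This action satisfies all relations, and conversely the relations reduce every word to the normal
  form of the state that it reaches from (id, 0), or to zero. Hence "reaching the same state" is a
  congruence on words, the defining ideal consists of the elements whose coefficients sum to zero
  over each nonzero class, and the quotient has the nonzero classes as a basis. On words in
  T_1, ..., T_l with l < n the congruence is the one of NC_A(l, 2), which gives the subalgebras R_l.
*)
theory Submission
  imports Defs
begin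

section \<open>Normal forms of words\<close>

text \<open>The obstacle is that \<open>T_n\<close> may have nonzero powers while its neighbour
  \<open>T_{n-1}\<close> squares to zero. For \<open>a < n\<close> the braid relations give
  \<open>T_n ... T_a T_n^2 = T_{n-1}^2 T_n ... T_a = 0\<close>. Hence a power \<open>T_n^k\<close>
  with \<open>k >= 2\<close> tolerates a further \<open>T_n\<close> only if that letter commutes
  through everything in between, which is the condition \<open>q(n) = n+1\<close>; this is why an
  ascent at \<open>n\<close> is useful only while \<open>k <= 1\<close>. For \<open>k <= 1\<close>
  the exponent is determined by \<open>q\<close>, and the normal form is a reduced word of a
  permutation of \<open>{1..n+1}\<close>; in the case \<open>d = 2\<close> this accounts for
  \<open>(n+1)! = n! (1 + n)\<close> basis words. Inverses are used because left multiplication by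
  \<open>s_i\<close> then exchanges the entries of \<open>q\<close> at positions \<open>i\<close>
  and \<open>i+1\<close>, and comparing these two entries decides whether the length goes up. The
  action is a left action, so compatibility of the classes with right multiplication is not
  automatic. It holds because two words that reach the same state from the identity are equal by the
  braid relations alone, and therefore act equally on every state.\<close>

inductive braid_eq :: "nat \<Rightarrow> nat list \<Rightarrow> nat list \<Rightarrow> bool" for n where
  same [simp, intro]: "braid_eq n u u"
| flip: "braid_eq n u v \<Longrightarrow> braid_eq n v u"
| chain [trans]: "braid_eq n u v \<Longrightarrow> braid_eq n v w \<Longrightarrow> braid_eq n u w"
| braid: "0 < i \<Longrightarrow> i < n \<Longrightarrow> braid_eq n (x @ [i, Suc i, i] @ y) (x @ [Suc i, i, Suc i] @ y)"
| commute: "i \<in> {1..n} \<Longrightarrow> j \<in> {1..n} \<Longrightarrow> Suc i < j \<Longrightarrow> braid_eq n (x @ [i, j] @ y) (x @ [j, i] @ y)"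

text \<open>Vanishing is kept out of \<open>braid_eq\<close>, so that equivalent words have the same
  letters and the same length. The length is what links surviving words with reduced ones in
  \<open>not_reduced\<close>.\<close>

definition nil_word :: "nat \<Rightarrow> nat \<Rightarrow> nat list \<Rightarrow> bool" where
  "nil_word n d u \<longleftrightarrow> (\<exists>x z y. braid_eq n u (x @ z @ y) \<and>
     (z = replicate d n \<or> (\<exists>i\<in>{1..<n}. z = [i, i])))"

lemma braid_eq_context: "braid_eq n u v \<Longrightarrow> braid_eq n (x @ u @ y) (x @ v @ y)"
proof (induction rule: braid_eq.induct)
  case (braid i a b)
  then show ?case using braid_eq.braid[of i n "x @ a" "b @ y"] by simp
next
  case (commute i j a b)
  then show ?case using braid_eq.commute[of i n j "x @ a" "b @ y"] by simp
next
  case (flip u v)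
  then show ?case using braid_eq.flip by blast
next
  case (chain u v w)
  then show ?case using braid_eq.chain by blast
qed auto

lemma braid_eq_prepend: "braid_eq n u v \<Longrightarrow> braid_eq n (x @ u) (x @ v)"
  using braid_eq_context[of n u v x "[]"] by simp

lemma braid_eq_append: "braid_eq n u v \<Longrightarrow> braid_eq n (u @ y) (v @ y)"
  using braid_eq_context[of n u v "[]" y] by simp

lemma braid_eq_Cons: "braid_eq n u v \<Longrightarrow> braid_eq n (i # u) (i # v)"
  using braid_eq_prepend[of n u v "[i]"] by simp

lemma braid_eq_set: "braid_eq n u v \<Longrightarrow> set u = set v"
  by (induction rule: braid_eq.induct) auto

lemma braid_eq_length: "braid_eq n u v \<Longrightarrow> length u = length v"
  by (induction rule: braid_eq.induct) auto

lemma nil_word_context: "nil_word n d u \<Longrightarrow> nil_word n d (x @ u @ y)"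
  unfolding nil_word_def
proof (elim exE conjE)
  fix a z b
  assume "braid_eq n u (a @ z @ b)" and z: "z = replicate d n \<or> (\<exists>i\<in>{1..<n}. z = [i, i])"
  then have "braid_eq n (x @ u @ y) ((x @ a) @ z @ (b @ y))"
    using braid_eq_context[of n u "a @ z @ b" x y] by simp
  then show "\<exists>a z b. braid_eq n (x @ u @ y) (a @ z @ b) \<and>
      (z = replicate d n \<or> (\<exists>i\<in>{1..<n}. z = [i, i]))" using z by blast
qed

lemma nil_word_prepend: "nil_word n d u \<Longrightarrow> nil_word n d (x @ u)"
  using nil_word_context[of n d u x "[]"] by simp

lemma nil_word_append: "nil_word n d u \<Longrightarrow> nil_word n d (u @ y)"
  using nil_word_context[of n d u "[]" y] by simp

lemma nil_word_Cons: "nil_word n d u \<Longrightarrow> nil_word n d (i # u)"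
  using nil_word_prepend[of n d u "[i]"] by simp

lemma nil_word_braid_eq: "braid_eq n u v \<Longrightarrow> nil_word n d v \<Longrightarrow> nil_word n d u"
  unfolding nil_word_def using braid_eq.chain[of n u v] by blast

lemma nil_word_square: "0 < i \<Longrightarrow> i < n \<Longrightarrow> nil_word n d (x @ [i, i] @ y)"
  unfolding nil_word_def
  by (intro exI[of _ x] exI[of _ "[i, i]"] exI[of _ y]) (auto intro: braid_eq.same)

lemma nil_word_power: "nil_word n d (x @ replicate d n @ y)"
  unfolding nil_word_def using braid_eq.same by blast

lemma braid_eq_commute:
  assumes "c \<in> {1..n}" "\<And>x. x \<in> set u \<Longrightarrow> x \<in> {1..n} \<and> (Suc x < c \<or> Suc c < x)"
  shows "braid_eq n (c # u) (u @ [c])"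
  using assms(2)
proof (induction u)
  case (Cons x u)
  have "braid_eq n ([] @ [c, x] @ u) ([] @ [x, c] @ u)"
    using Cons.prems[of x] assms(1) braid_eq.commute[of c n x "[]" u]
      braid_eq.flip[OF braid_eq.commute[of x n c "[]" u]] by auto
  moreover have "braid_eq n (x # c # u) (x # u @ [c])"
    using Cons by (intro braid_eq_Cons) auto
  ultimately show ?case by (auto intro: braid_eq.chain)
qed auto

text \<open>The letter \<open>c\<close> moves left past all letters below \<open>c - 1\<close>,
  forms \<open>c, c - 1, c\<close> with the middle of the run, and after the braid relation the
  first \<open>c - 1\<close> moves left past all letters above \<open>c\<close>.\<close>

lemma braid_eq_shift1:
  assumes "0 < a" "a < c" "c < b" "b \<le> Suc n"
  shows "braid_eq n (rev [a..<b] @ [c]) ((c - 1) # rev [a..<b])"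
proof -
  obtain e where e: "c = Suc e" using assms by (cases c) auto
  have split: "rev [a..<b] = rev [Suc c..<b] @ [c, e] @ rev [a..<e]"
  proof -
    have "[a..<b] = [a..<e] @ [e..<b]" using assms e upt_add_eq_append[of a e "b - e"] by simp
    also have "[e..<b] = e # c # [Suc c..<b]"
      using assms e by (simp add: upt_conv_Cons)
    finally show ?thesis by simp
  qed
  have "braid_eq n (rev [a..<b] @ [c]) (rev [Suc c..<b] @ [c, e] @ (c # rev [a..<e]))"
    unfolding split using braid_eq_commute[of c n "rev [a..<e]"] assms e
    by (auto intro!: braid_eq_prepend braid_eq.flip[OF braid_eq_commute] braid_eq_Cons)
  also have "braid_eq n \<dots> (rev [Suc c..<b] @ [e, c, e] @ rev [a..<e])"
    using braid_eq.braid[of e n "rev [Suc c..<b]" "rev [a..<e]"] assms e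
    by (auto intro: braid_eq.flip)
  also have "braid_eq n \<dots> ((e # rev [Suc c..<b]) @ [c, e] @ rev [a..<e])"
    using braid_eq_append[OF braid_eq.flip[OF braid_eq_commute[of e n "rev [Suc c..<b]"]],
        of "[c, e] @ rev [a..<e]"] assms e by auto
  finally show ?thesis using split e by simp
qed

lemma braid_eq_shift_list:
  assumes "0 < a" "b \<le> Suc n" "\<And>c. c \<in> set w \<Longrightarrow> a < c \<and> c < b"
  shows "braid_eq n (rev [a..<b] @ w) (map (\<lambda>c. c - 1) w @ rev [a..<b])"
  using assms(3)
proof (induction w)
  case (Cons c w)
  have "braid_eq n (rev [a..<b] @ c # w) ((c - 1) # rev [a..<b] @ w)"
    using braid_eq_append[OF braid_eq_shift1[of a c b n], of w] Cons.prems assms by simp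
  also have "braid_eq n \<dots> ((c - 1) # map (\<lambda>c. c - 1) w @ rev [a..<b])"
    using Cons by (intro braid_eq_Cons) auto
  finally show ?case by simp
qed auto

lemma map_pred_upt: "0 < j \<Longrightarrow> map (\<lambda>c. c - 1) [j..<b] = [j - 1..<b - 1]"
  by (rule nth_equalityI) auto

lemma braid_eq_shift:
  assumes "0 < a" "b \<le> Suc n" "a < j"
  shows "braid_eq n (rev [a..<b] @ rev [j..<b]) (rev [j - 1..<b - 1] @ rev [a..<b])"
  using braid_eq_shift_list[of a b n "rev [j..<b]"] assms
  by (simp add: map_pred_upt flip: rev_map del: One_nat_def)

text \<open>The part of the second run above \<open>a\<close> can be shifted in front of the first
  run, as \<open>a\<close> lies strictly below it. The first run, which ends in \<open>a\<close>, is
  then followed by the \<open>a\<close> of the second one. The bound \<open>a < n\<close> makes this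
  square vanish.\<close>

lemma nil_word_shift:
  assumes "0 < a" "b \<le> Suc n" "j \<le> a" "a < b" "a < n"
  shows "nil_word n d (rev [a..<b] @ rev [j..<b])"
proof -
  have s: "rev [j..<b] = rev [Suc a..<b] @ [a] @ rev [j..<a]"
    using assms upt_add_eq_append[of j a "b - a"] by (simp add: upt_conv_Cons)
  have t: "rev [a..<b] = rev [Suc a..<b] @ [a]"
    using assms by (simp add: upt_conv_Cons)
  have "braid_eq n (rev [a..<b] @ rev [j..<b]) ((rev [a..<b - 1] @ rev [a..<b]) @ [a] @ rev [j..<a])"
    using braid_eq_append[OF braid_eq_shift[of a b n "Suc a"], of "[a] @ rev [j..<a]"] assms
    unfolding s by (simp del: upt_Suc)
  moreover have "nil_word n d \<dots>"
    unfolding t using nil_word_square[of a n d "rev [a..<b - 1] @ rev [Suc a..<b]"] assms by simp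
  ultimately show ?thesis by (rule nil_word_braid_eq)
qed

section \<open>Permutations as lists of values, and words built from descending runs\<close>

definition swap :: "nat \<Rightarrow> (nat \<Rightarrow> 'a) \<Rightarrow> nat \<Rightarrow> 'a" where
  "swap i q = q(i := q (Suc i), Suc i := q i)"

lemma swap_eq: "swap i q = q \<circ> transpose i (Suc i)"
  by (auto simp: swap_def fun_eq_iff transpose_def)

lemma swap_permutes:
  "q permutes {1..m} \<Longrightarrow> 0 < i \<Longrightarrow> i < m \<Longrightarrow> swap i q permutes {1..m}"
  unfolding swap_eq by (intro permutes_compose permutes_swap_id) auto

text \<open>If \<open>q\<close> permutes \<open>{1..m + 1}\<close> and \<open>j = q (m + 1)\<close>, then \<open>flat m q\<close> is
  \<open>s\<^sub>m \<dots> s\<^sub>j q\<close>, a permutation of \<open>{1..m}\<close>. Iterating this, \<open>perm_word m q\<close> is a reduced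
  word of the inverse of \<open>q\<close>.\<close>

definition flat :: "nat \<Rightarrow> (nat \<Rightarrow> nat) \<Rightarrow> nat \<Rightarrow> nat" where
  "flat m q x = (if x \<in> {1..m} then if q (Suc m) < q x then q x - 1 else q x else x)"

fun perm_word :: "nat \<Rightarrow> (nat \<Rightarrow> nat) \<Rightarrow> nat list" where
  "perm_word 0 q = []"
| "perm_word (Suc m) q = perm_word m (flat m q) @ rev [q (Suc m)..<Suc m]"

lemma permutes_interval_neq: "q permutes {1..m} \<Longrightarrow> x \<noteq> y \<Longrightarrow> q x \<noteq> q y"
  using permutes_inj[THEN injD] by metis

lemma permutes_interval_bounds:
  fixes q :: "nat \<Rightarrow> nat"
  shows "q permutes {1..m} \<Longrightarrow> x \<in> {1..m} \<Longrightarrow> 0 < q x \<and> q x \<le> m"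
  using permutes_in_image[of q "{1..m}" x] by auto

lemma flat_permutes:
  assumes "q permutes {1..Suc m}"
  shows "flat m q permutes {1..m}"
proof -
  have neq: "q x \<noteq> q y" if "x \<noteq> y" for x y
    using permutes_interval_neq[OF assms] that by blast
  have bd: "0 < q x \<and> q x \<le> Suc m" if "x \<in> {1..Suc m}" for x
    using permutes_interval_bounds[OF assms that] by simp
  have inj: "inj_on (flat m q) {1..m}"
  proof (rule inj_onI)
    fix x y assume xy: "x \<in> {1..m}" "y \<in> {1..m}" "flat m q x = flat m q y"
    then have "x \<noteq> Suc m" "y \<noteq> Suc m" by auto
    then have "q x = q y" using xy neq[of x "Suc m"] neq[of y "Suc m"]
      by (auto simp: flat_def split: if_splits)
    then show "x = y" using neq by blast
  qed
  have "flat m q ` {1..m} \<subseteq> {1..m}"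
  proof (clarify)
    fix x assume x: "x \<in> {1..m}"
    then have "x \<noteq> Suc m" by auto
    then show "flat m q x \<in> {1..m}"
      using neq[of x "Suc m"] bd[of x] bd[of "Suc m"] x by (auto simp: flat_def)
  qed
  then have "bij_betw (flat m q) {1..m} {1..m}"
    using inj by (simp add: bij_betw_def card_image card_subset_eq)
  then show ?thesis by (rule bij_imp_permutes) (auto simp: flat_def)
qed

lemma perm_word_set: "q permutes {1..m} \<Longrightarrow> set (perm_word m q) \<subseteq> {1..<m}"
proof (induction m arbitrary: q)
  case (Suc m)
  have "0 < q (Suc m)" using permutes_interval_bounds[OF Suc.prems, of "Suc m"] by simp
  then show ?case using Suc.IH[OF flat_permutes[OF Suc.prems]] by (auto simp: less_Suc_eq)
qed simp

lemma flat_swap: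
  assumes "0 < i" "i < m"
  shows "flat m (swap i q) = swap i (flat m q)"
  using assms by (auto simp: flat_def swap_def fun_eq_iff)

lemma flat_less_iff:
  assumes "q permutes {1..Suc m}" "x \<in> {1..m}" "y \<in> {1..m}"
  shows "flat m q x < flat m q y \<longleftrightarrow> q x < q y"
proof -
  have "q x \<noteq> q (Suc m)" "q y \<noteq> q (Suc m)"
    using permutes_interval_neq[OF assms(1)] assms(2,3) by auto
  then show ?thesis using assms(2,3) by (auto simp: flat_def)
qed

text \<open>All letters of the inner word are below \<open>m\<close>, so \<open>Suc m\<close>
  commutes past them and prolongs the last run at its upper end.\<close>

lemma perm_word_commute:
  assumes "p permutes {1..Suc m}" "Suc m \<le> n"
  shows "braid_eq n (Suc m # perm_word (Suc m) p)
    (perm_word m (flat m p) @ rev [p (Suc m)..<Suc (Suc m)])"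
proof -
  have "0 < p (Suc m)" "p (Suc m) \<le> Suc m"
    using permutes_interval_bounds[OF assms(1), of "Suc m"] by auto
  then have "rev [p (Suc m)..<Suc (Suc m)] = Suc m # rev [p (Suc m)..<Suc m]" by simp
  moreover have "set (perm_word m (flat m p)) \<subseteq> {1..<m}"
    by (rule perm_word_set[OF flat_permutes[OF assms(1)]])
  then have "braid_eq n (Suc m # perm_word m (flat m p)) (perm_word m (flat m p) @ [Suc m])"
    using assms(2) by (intro braid_eq_commute) fastforce+
  then have "braid_eq n ((Suc m # perm_word m (flat m p)) @ rev [p (Suc m)..<Suc m])
     ((perm_word m (flat m p) @ [Suc m]) @ rev [p (Suc m)..<Suc m])"
    by (rule braid_eq_append)
  ultimately show ?thesis by simp
qed

text \<open>Flattening twice removes the two last values in either order, so the inner words of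
  \<open>q\<close> and of the swapped permutation agree. The two runs differ exactly by
  \<open>braid_eq_shift\<close>; the larger value drops by one because the smaller value is now
  removed first.\<close>

lemma perm_word_swap_last:
  assumes q: "q permutes {1..Suc (Suc m)}" and less: "q (Suc m) < q (Suc (Suc m))" and "m < n"
  shows "braid_eq n (perm_word m (flat m (flat (Suc m) q)) @
      rev [flat (Suc m) q (Suc m)..<Suc (Suc m)] @ rev [q (Suc (Suc m))..<Suc (Suc m)])
    (perm_word (Suc (Suc m)) (swap (Suc m) q))"
proof -
  let ?r = "swap (Suc m) q"
  have b: "0 < q (Suc m)" "q (Suc (Suc m)) \<le> Suc (Suc m)"
    using permutes_interval_bounds[OF q] by auto
  have "flat m (flat (Suc m) q) = flat m (flat (Suc m) ?r)"
  proof
    fix x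
    consider "x \<in> {1..m}" | "x \<notin> {1..m}" by blast
    then show "flat m (flat (Suc m) q) x = flat m (flat (Suc m) ?r) x"
    proof cases
      case 1
      then have "q x \<noteq> q (Suc m)" "q x \<noteq> q (Suc (Suc m))"
        using permutes_interval_neq[OF q] by auto
      then show ?thesis using 1 less by (auto simp: flat_def swap_def)
    qed (auto simp: flat_def)
  qed
  moreover have "flat (Suc m) q (Suc m) = q (Suc m)" using less by (simp add: flat_def)
  moreover have "?r (Suc (Suc m)) = q (Suc m)" by (simp add: swap_def)
  moreover have "flat (Suc m) ?r (Suc m) = q (Suc (Suc m)) - 1"
    using less by (simp add: flat_def swap_def)
  moreover have "braid_eq n (rev [q (Suc m)..<Suc (Suc m)] @ rev [q (Suc (Suc m))..<Suc (Suc m)])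
      (rev [q (Suc (Suc m)) - 1..<Suc m] @ rev [q (Suc m)..<Suc (Suc m)])"
    using braid_eq_shift[of "q (Suc m)" "Suc (Suc m)" n "q (Suc (Suc m))"] b less \<open>m < n\<close> by simp
  ultimately show ?thesis
    using braid_eq_prepend[of n "rev [q (Suc m)..<Suc (Suc m)] @ rev [q (Suc (Suc m))..<Suc (Suc m)]"
        "rev [q (Suc (Suc m)) - 1..<Suc m] @ rev [q (Suc m)..<Suc (Suc m)]"]
    by (simp del: upt_Suc)
qed

text \<open>As \<open>perm_word m q\<close> represents the inverse of \<open>q\<close>, the letter
  \<open>i\<close> in front replaces \<open>q\<close> by \<open>swap i q\<close>, and an ascent at
  \<open>i\<close> means that the length grows. A letter below the last position leaves the last run
  alone and passes to \<open>flat\<close>, which preserves the order of the remaining values. At the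
  last position the letter commutes up to the last two runs, which are then exchanged or produce a
  square. The extra condition in the second claim excludes \<open>i = n\<close> with
  \<open>q n = Suc n\<close>, where the repeated letter would be \<open>n\<close> itself.\<close>

lemma perm_word_step:
  assumes "q permutes {1..m}" "m \<le> Suc n" "0 < i" "i < m"
  shows "q i < q (Suc i) \<Longrightarrow> braid_eq n (i # perm_word m q) (perm_word m (swap i q))"
    and "\<not> q i < q (Suc i) \<Longrightarrow> i < n \<or> q i < Suc n \<Longrightarrow> nil_word n d (i # perm_word m q)"
proof -
  have "(q i < q (Suc i) \<longrightarrow> braid_eq n (i # perm_word m q) (perm_word m (swap i q))) \<and>
    (\<not> q i < q (Suc i) \<longrightarrow> i < n \<or> q i < Suc n \<longrightarrow> nil_word n d (i # perm_word m q))"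
    using assms
  proof (induction m arbitrary: q)
    case (Suc m)
    note fp = flat_permutes[OF Suc.prems(1)]
    show ?case
    proof (cases "i < m")
      case True
      have less: "flat m q i < flat m q (Suc i) \<longleftrightarrow> q i < q (Suc i)"
        using flat_less_iff[OF Suc.prems(1)] True Suc.prems(3) by simp
      have e: "swap i q (Suc m) = q (Suc m)" using True by (simp add: swap_def)
      let ?y = "rev [q (Suc m)..<Suc m]"
      have c: "i # perm_word (Suc m) q = (i # perm_word m (flat m q)) @ ?y" by simp
      have c': "perm_word (Suc m) (swap i q) = perm_word m (swap i (flat m q)) @ ?y"
        using True Suc.prems by (simp add: e flat_swap del: upt_Suc)
      have IH: "(q i < q (Suc i) \<longrightarrow>
            braid_eq n (i # perm_word m (flat m q)) (perm_word m (swap i (flat m q)))) \<and>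
          (\<not> q i < q (Suc i) \<longrightarrow> nil_word n d (i # perm_word m (flat m q)))"
        using Suc.IH[OF fp] Suc.prems True unfolding less by simp
      show ?thesis
        unfolding c c' using IH braid_eq_append nil_word_append by blast
    next
      case False
      then have "i = m" using Suc.prems by simp
      then obtain r where r: "m = Suc r" and i: "i = Suc r"
        using Suc.prems by (cases m) auto
      have start: "braid_eq n (i # perm_word (Suc m) q) (perm_word r (flat r (flat (Suc r) q)) @
          rev [flat (Suc r) q (Suc r)..<Suc (Suc r)] @ rev [q (Suc (Suc r))..<Suc (Suc r)])"
        using braid_eq_append[OF perm_word_commute[of "flat (Suc r) q" r n],
            of "rev [q (Suc (Suc r))..<Suc (Suc r)]"] Suc.prems fp
        unfolding r i perm_word.simps(2)[of "Suc r"] by simp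
      have up: "q i < q (Suc i) \<Longrightarrow> braid_eq n (i # perm_word (Suc m) q) (perm_word (Suc m) (swap i q))"
        using braid_eq.chain[OF start perm_word_swap_last] Suc.prems unfolding r i
        by (meson Suc_le_lessD Suc_le_mono)
      have down: "nil_word n d (i # perm_word (Suc m) q)"
        if "\<not> q i < q (Suc i)" "i < n \<or> q i < Suc n"
      proof -
        have "q i \<noteq> q (Suc i)" using permutes_interval_neq[OF Suc.prems(1)] by simp
        then have less: "q (Suc i) < q i" using that by simp
        then have "q (Suc i) \<le> flat (Suc r) q (Suc r)" by (simp add: flat_def i)
        moreover have b: "0 < flat (Suc r) q (Suc r)" "flat (Suc r) q (Suc r) \<le> Suc r"
          using permutes_interval_bounds[OF fp, of "Suc r"] by (auto simp: r)
        \<comment> \<open>The repeated letter has to lie below \<open>n\<close>. Since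
          \<open>q\<close> has a descent here, flattening lowers \<open>q i\<close> by one, so
          \<open>q i < Suc n\<close> suffices.\<close>
        moreover have "flat (Suc r) q (Suc r) < n"
          using that(2) b(2) less Suc.prems(2) by (auto simp: i r flat_def)
        ultimately have "nil_word n d (rev [flat (Suc r) q (Suc r)..<Suc (Suc r)] @
            rev [q (Suc (Suc r))..<Suc (Suc r)])"
          using Suc.prems r i by (intro nil_word_shift) auto
        then show ?thesis using nil_word_braid_eq[OF start nil_word_prepend] by simp
      qed
      show ?thesis using up down by blast
    qed
  qed simp
  then show "q i < q (Suc i) \<Longrightarrow> braid_eq n (i # perm_word m q) (perm_word m (swap i q))"
    and "\<not> q i < q (Suc i) \<Longrightarrow> i < n \<or> q i < Suc n \<Longrightarrow> nil_word n d (i # perm_word m q)"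
    by auto
qed

section \<open>The action of words on states\<close>

fun step :: "nat \<Rightarrow> nat \<Rightarrow> nat \<Rightarrow> (nat \<Rightarrow> nat) \<times> nat \<Rightarrow> ((nat \<Rightarrow> nat) \<times> nat) option" where
  "step n d i (q, k) =
    (if i < n then if q i < q (Suc i) then Some (swap i q, k) else None
     else if k = 0 \<or> k = 1 \<and> q n < q (Suc n) then Some (swap n q, 1)
     else if q n = Suc n \<and> Suc k < d then Some (q, Suc k) else None)"

fun run :: "nat \<Rightarrow> nat \<Rightarrow> nat list \<Rightarrow> (nat \<Rightarrow> nat) \<times> nat \<Rightarrow> ((nat \<Rightarrow> nat) \<times> nat) option" where
  "run n d [] s = Some s"
| "run n d (i # u) s = Option.bind (run n d u s) (step n d i)"

definition states :: "nat \<Rightarrow> nat \<Rightarrow> ((nat \<Rightarrow> nat) \<times> nat) set" where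
  "states n d = {(q, k). q permutes {1..Suc n} \<and> k < d \<and> (k = 0 \<longleftrightarrow> q (Suc n) = Suc n)}"

lemma run_append: "run n d (u @ v) s = Option.bind (run n d v s) (run n d u)"
  by (induction u) (auto simp: bind_eq_None_conv split: bind_split)

lemma swap_neq: "x \<noteq> i \<Longrightarrow> x \<noteq> Suc i \<Longrightarrow> swap i q x = q x"
  by (simp add: swap_def)

lemma step_states:
  assumes "d \<ge> 2" "s \<in> states n d" "i \<in> {1..n}" "step n d i s = Some t"
  shows "t \<in> states n d"
proof -
  obtain q k where s: "s = (q, k)" by fastforce
  have q: "q permutes {1..Suc n}" and k: "k < d" "k = 0 \<longleftrightarrow> q (Suc n) = Suc n"
    using assms(2) by (auto simp: s states_def)
  have neq: "q n \<noteq> q (Suc n)" using permutes_interval_neq[OF q] by simp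
  have bd: "q (Suc n) \<le> Suc n" using permutes_interval_bounds[OF q, of "Suc n"] by simp
  have sw: "swap i q permutes {1..Suc n}" using swap_permutes[OF q] assms(3) by simp
  show ?thesis
  proof (cases "i < n")
    case True
    then show ?thesis using assms(3,4) sw k by (auto simp: s states_def swap_def split: if_splits)
  next
    case False
    then have "i = n" using assms(3) by simp
    then show ?thesis using assms(1,4) sw q k neq bd
      by (auto simp: s states_def swap_def split: if_splits)
  qed
qed

lemma run_states:
  "d \<ge> 2 \<Longrightarrow> s \<in> states n d \<Longrightarrow> set u \<subseteq> {1..n} \<Longrightarrow> run n d u s = Some t \<Longrightarrow> t \<in> states n d"
proof (induction u arbitrary: t)
  case (Cons i u)
  then show ?case using step_states[of d _ n i t] by (auto simp: bind_eq_Some_conv)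
qed simp

text \<open>Only \<open>n = Suc i\<close> involves the exponent. If it is at least 2, on arrival or
  after the first \<open>T_n\<close> has raised it, both sides give zero: the swap by
  \<open>T_i\<close> brings a value other than \<open>n + 1\<close> to position \<open>n\<close>.
  Otherwise both sides reverse three ascending values or give zero.\<close>

lemma run_braid:
  assumes "s \<in> states n d" "0 < i" "i < n"
  shows "run n d [i, Suc i, i] s = run n d [Suc i, i, Suc i] s"
proof -
  obtain q k where s: "s = (q, k)" by fastforce
  have q: "q permutes {1..Suc n}" and k: "k < d" "k = 0 \<longleftrightarrow> q (Suc n) = Suc n"
    using assms(1) by (auto simp: s states_def)
  show ?thesis
  proof (cases "Suc i < n")
    case True
    then show ?thesis by (auto simp: s swap_def fun_eq_iff)
  next
    case False
    then have n: "n = Suc i" using assms(3) by simp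
    have neq: "q i \<noteq> q (Suc i)" "q i \<noteq> q (Suc (Suc i))" "q (Suc i) \<noteq> q (Suc (Suc i))"
      using permutes_interval_neq[OF q] by simp_all
    have bd: "q i \<le> Suc (Suc i)" "q (Suc i) \<le> Suc (Suc i)" "q (Suc (Suc i)) \<le> Suc (Suc i)"
      using permutes_interval_bounds[OF q] assms n by auto
    show ?thesis using neq bd k by (auto simp: s n swap_def fun_eq_iff)
  qed
qed

lemma swap_apply: "swap i q x = (if x = i then q (Suc i) else if x = Suc i then q i else q x)"
  unfolding swap_def fun_upd_apply by (cases "x = i") (simp_all del: One_nat_def)

lemma swap_commute:
  assumes "Suc i < j"
  shows "swap i (swap j q) = swap j (swap i q)"
proof
  fix x
  consider "x = i" | "x = Suc i" | "x = j" | "x = Suc j"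
    | "x \<noteq> i" "x \<noteq> Suc i" "x \<noteq> j" "x \<noteq> Suc j" by blast
  then show "swap i (swap j q) x = swap j (swap i q) x"
    using assms by cases (simp_all add: swap_apply)
qed

lemma run_comm:
  assumes "Suc i < j" "j \<le> n"
  shows "run n d [i, j] s = run n d [j, i] s"
proof -
  obtain q k where s: "s = (q, k)" by fastforce
  have v: "swap j q i = q i" "swap j q (Suc i) = q (Suc i)" "swap i q j = q j"
    "swap i q (Suc j) = q (Suc j)"
    using assms(1) by (simp_all add: swap_neq)
  have c: "swap i (swap j q) = swap j (swap i q)" using assms(1) by (rule swap_commute)
  have i: "i < n" using assms by simp
  show ?thesis
  proof (cases "j < n")
    case True
    then show ?thesis using i v c by (simp add: s)
  next
    case False
    then have "j = n" using assms(2) by simp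
    then show ?thesis using i v[unfolded \<open>j = n\<close>] c[unfolded \<open>j = n\<close>]
      by (auto simp: s \<open>j = n\<close>)
  qed
qed

lemma run_square: "i < n \<Longrightarrow> run n d [i, i] s = None"
  by (cases s) (auto simp: swap_def)

lemma run_replicate:
  "q n = Suc n \<Longrightarrow> q (Suc n) \<le> n \<Longrightarrow> 0 < k \<Longrightarrow> k < d \<Longrightarrow>
    run n d (replicate e n) (q, k) = (if k + e < d then Some (q, k + e) else None)"
  by (induction e) auto

text \<open>The first \<open>T_n\<close> may still swap; once \<open>n + 1\<close> stands at
  position \<open>n\<close>, each letter raises the exponent by one until \<open>d\<close> is hit.
  If \<open>n + 1\<close> stands neither at position \<open>n\<close> nor at \<open>n + 1\<close>,
  two letters already give zero.\<close>

lemma run_power: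
  assumes "n \<ge> 1" "d \<ge> 2" "s \<in> states n d"
  shows "run n d (replicate d n) s = None"
proof -
  obtain q k where s: "s = (q, k)" by fastforce
  have q: "q permutes {1..Suc n}" and k: "k < d" "k = 0 \<longleftrightarrow> q (Suc n) = Suc n"
    using assms(3) by (auto simp: s states_def)
  have bd: "q n \<le> Suc n" "q (Suc n) \<le> Suc n"
    using permutes_interval_bounds[OF q, of n] permutes_interval_bounds[OF q, of "Suc n"] assms(1) by auto
  have neq: "q n \<noteq> q (Suc n)" using permutes_interval_neq[OF q] by simp
  consider "k = 0" | "0 < k" "q n = Suc n" | "0 < k" "q n \<noteq> Suc n" by auto
  then show ?thesis
  proof cases
    case 1
    have "replicate d n = replicate (d - 1) n @ [n]"
      using replicate_add[of "d - 1" 1 n] assms(2) by simp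
    moreover have "step n d n s = Some (swap n q, 1)" using 1 by (simp add: s)
    moreover have "q (Suc n) = Suc n" using 1 k by simp
    then have "swap n q n = Suc n" "swap n q (Suc n) \<le> n"
      using neq bd by (simp_all add: swap_apply)
    then have "run n d (replicate (d - 1) n) (swap n q, 1) = None"
      using run_replicate[of "swap n q" n 1 d "d - 1"] assms(2) by simp
    ultimately show ?thesis by (simp only: run_append run.simps bind.bind_lunit)
  next
    case 2
    then have "q (Suc n) \<le> n" using neq bd by linarith
    then show ?thesis using run_replicate[of q n k d d] 2 k s by simp
  next
    case 3
    have "replicate d n = replicate (d - 2) n @ replicate 2 n"
      using replicate_add[of "d - 2" 2 n] unfolding le_add_diff_inverse2[OF assms(2)] .
    then have r: "replicate d n = replicate (d - 2) n @ [n, n]" by (simp add: numeral_2_eq_2)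
    have "q (Suc n) \<noteq> Suc n" using 3 k by simp
    have "run n d [n, n] s = None"
    proof (cases "k = 1 \<and> q n < q (Suc n)")
      case True
      then have "step n d n s = Some (swap n q, 1)" by (simp add: s)
      moreover have "step n d n (swap n q, 1) = None"
        using True \<open>q (Suc n) \<noteq> Suc n\<close> by (simp add: swap_apply)
      ultimately show ?thesis by simp
    next
      case False
      then show ?thesis using 3 by (simp add: s)
    qed
    then show ?thesis unfolding r run_append by simp
  qed
qed

lemma run_append3: "run n d (x @ z @ y) s = Option.bind (run n d y s) (\<lambda>t. Option.bind (run n d z t) (run n d x))"
  by (simp add: run_append)

lemma run_context:
  "(\<And>t. run n d y s = Some t \<Longrightarrow> run n d z t = run n d z' t) \<Longrightarrow>
    run n d (x @ z @ y) s = run n d (x @ z' @ y) s"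
  unfolding run_append3 by (cases "run n d y s") simp_all

lemma run_braid_eq:
  assumes "d \<ge> 2" "s \<in> states n d"
  shows "braid_eq n u v \<Longrightarrow> set u \<subseteq> {1..n} \<Longrightarrow> run n d u s = run n d v s"
proof (induction rule: braid_eq.induct)
  case (flip u v)
  then show ?case using braid_eq_set[OF flip.hyps] by metis
next
  case (chain u v w)
  then show ?case using braid_eq_set[OF chain.hyps(1)] by metis
next
  case (braid i x y)
  have "set y \<subseteq> {1..n}" using braid.prems by simp
  then show ?case
    by (intro run_context run_braid[OF _ braid.hyps]) (rule run_states[OF assms])
next
  case (commute i j x y)
  have "j \<le> n" using commute.hyps by simp
  then show ?case by (intro run_context run_comm[OF commute.hyps(3)])
qed (rule HOL.refl)

lemma run_nil_word:
  assumes "n \<ge> 1" "d \<ge> 2" "s \<in> states n d" "nil_word n d u" "set u \<subseteq> {1..n}"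
  shows "run n d u s = None"
proof -
  obtain x z y where xzy: "braid_eq n u (x @ z @ y)"
    and z: "z = replicate d n \<or> (\<exists>i\<in>{1..<n}. z = [i, i])"
    using assms(4) by (auto simp: nil_word_def)
  have "set y \<subseteq> {1..n}" using braid_eq_set[OF xzy] assms(5) by auto
  then have "run n d z t = None" if "run n d y s = Some t" for t
    using z run_power[OF assms(1,2) run_states[OF assms(2,3) _ that]] run_square[of _ n d t] by auto
  then have "run n d (x @ z @ y) s = None" unfolding run_append3 by (auto simp: bind_eq_None_conv)
  then show ?thesis using run_braid_eq[OF assms(2,3) xzy assms(5)] by simp
qed

section \<open>Normal forms of states, and how letters act on them\<close>

fun nf :: "nat \<Rightarrow> (nat \<Rightarrow> nat) \<times> nat \<Rightarrow> nat list" where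
  "nf n (q, k) = perm_word n (flat n q) @ replicate k n @ rev [q (Suc n)..<n]"

text \<open>For \<open>k = 1\<close> the letter \<open>n\<close> completes the run below it to the
  last run of a word for a permutation of \<open>{1..n+1}\<close>. This makes
  \<open>perm_word_step\<close> available for \<open>T_n\<close> as well.\<close>

lemma nf_perm_word:
  assumes "(q, k) \<in> states n d" "k \<le> 1"
  shows "nf n (q, k) = perm_word (Suc n) q"
proof -
  have q: "q permutes {1..Suc n}" and k: "k = 0 \<longleftrightarrow> q (Suc n) = Suc n"
    using assms by (auto simp: states_def)
  have le: "q (Suc n) \<le> Suc n" using permutes_interval_bounds[OF q, of "Suc n"] by simp
  show ?thesis
  proof (cases "k = 0")
    case True
    then have "q (Suc n) = Suc n" using k by simp
    then show ?thesis using True by simp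
  next
    case False
    then have "k = 1" "q (Suc n) \<le> n" using k le assms(2) by auto
    then show ?thesis by simp
  qed
qed

declare nf.simps [simp del]

lemma nf_step_less:
  assumes "(q, k) \<in> states n d" "0 < i" "i < n"
  shows "q i < q (Suc i) \<Longrightarrow> braid_eq n (i # nf n (q, k)) (nf n (swap i q, k))"
    and "\<not> q i < q (Suc i) \<Longrightarrow> nil_word n d (i # nf n (q, k))"
proof -
  have q: "q permutes {1..Suc n}" using assms(1) by (simp add: states_def)
  note fp = flat_permutes[OF q]
  let ?y = "replicate k n @ rev [q (Suc n)..<n]"
  have less: "flat n q i < flat n q (Suc i) \<longleftrightarrow> q i < q (Suc i)"
    using flat_less_iff[OF q] assms(2,3) by simp
  have c: "i # nf n (q, k) = (i # perm_word n (flat n q)) @ ?y" by (simp add: nf.simps)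
  have "swap i q (Suc n) = q (Suc n)" using assms(3) by (simp add: swap_neq)
  then have c': "nf n (swap i q, k) = perm_word n (swap i (flat n q)) @ ?y"
    using flat_swap[OF assms(2,3), of q] by (simp add: nf.simps)
  show "q i < q (Suc i) \<Longrightarrow> braid_eq n (i # nf n (q, k)) (nf n (swap i q, k))"
    unfolding c c' using perm_word_step(1)[OF fp, of n i] assms(2,3) unfolding less
    by (intro braid_eq_append) simp
  show "\<not> q i < q (Suc i) \<Longrightarrow> nil_word n d (i # nf n (q, k))"
    unfolding c using perm_word_step(2)[OF fp, of n i] assms(2,3) unfolding less
    by (intro nil_word_append) simp
qed

text \<open>The common beginning of the two cases below in which the exponent matters:
  \<open>T_n\<close> passes the innermost part of the normal form and becomes the top of a
  descending run standing directly before the power of \<open>T_n\<close>.\<close>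

lemma nf_start:
  assumes "q permutes {1..Suc (Suc m)}"
  shows "braid_eq (Suc m) (Suc m # nf (Suc m) (q, k))
    (perm_word m (flat m (flat (Suc m) q)) @ rev [flat (Suc m) q (Suc m)..<Suc (Suc m)] @
      replicate k (Suc m) @ rev [q (Suc (Suc m))..<Suc m])"
proof -
  have "braid_eq (Suc m) ((Suc m # perm_word (Suc m) (flat (Suc m) q)) @
      (replicate k (Suc m) @ rev [q (Suc (Suc m))..<Suc m]))
    ((perm_word m (flat m (flat (Suc m) q)) @ rev [flat (Suc m) q (Suc m)..<Suc (Suc m)]) @
      (replicate k (Suc m) @ rev [q (Suc (Suc m))..<Suc m]))"
    using perm_word_commute[OF flat_permutes[OF assms] order_refl] by (rule braid_eq_append)
  then show ?thesis unfolding nf.simps append_assoc append_Cons .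
qed

lemma nf_step_up:
  assumes "(q, k) \<in> states n d" "0 < n" "q n < q (Suc n)" "k \<le> 1" "(swap n q, 1) \<in> states n d"
  shows "braid_eq n (n # nf n (q, k)) (nf n (swap n q, 1))"
  using perm_word_step(1)[of q "Suc n" n n] assms nf_perm_word[OF assms(5)] nf_perm_word[OF assms(1)]
  by (simp add: states_def del: perm_word.simps)

lemma nf_step_down:
  assumes "(q, 1) \<in> states n d" "0 < n" "q (Suc n) < q n" "q n < Suc n"
  shows "nil_word n d (n # nf n (q, 1))"
  using perm_word_step(2)[of q "Suc n" n n] assms nf_perm_word[OF assms(1)]
  by (simp add: states_def del: perm_word.simps)

text \<open>If \<open>q n = Suc n\<close>, the flattened permutation fixes \<open>n\<close>, so the
  run produced by \<open>nf_start\<close> is the single letter \<open>n\<close> and joins the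
  power.\<close>

lemma nf_step_power:
  assumes "q permutes {1..Suc n}" "0 < n" "q n = Suc n"
  shows "braid_eq n (n # nf n (q, k)) (nf n (q, Suc k))"
proof -
  obtain m where m: "n = Suc m" using assms(2) by (cases n) auto
  have "q (Suc n) \<le> Suc n" using permutes_interval_bounds[OF assms(1), of "Suc n"] by simp
  moreover have "q (Suc n) \<noteq> q n" using permutes_interval_neq[OF assms(1)] by simp
  ultimately have "q (Suc n) < Suc n" using assms(3) by linarith
  then have f: "flat (Suc m) q (Suc m) = Suc m" using assms(2,3) m by (simp add: flat_def)
  have "replicate (Suc k) (Suc m) = [Suc m] @ replicate k (Suc m)" by simp
  then have "nf n (q, Suc k) = perm_word m (flat m (flat (Suc m) q)) @
      rev [flat (Suc m) q (Suc m)..<Suc (Suc m)] @ replicate k (Suc m) @ rev [q (Suc (Suc m))..<Suc m]"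
    unfolding m nf.simps perm_word.simps f by simp
  then show ?thesis using nf_start[OF assms(1)[unfolded m], of k] unfolding m by simp
qed

text \<open>Here the run produced by \<open>nf_start\<close> descends from \<open>n\<close> to some
  \<open>a < n\<close>. Moving two letters \<open>n\<close> of the power to its left turns them into
  \<open>n - 1, n - 1\<close>.\<close>

lemma nf_step_nil:
  assumes q: "q permutes {1..Suc n}" and "0 < n" "1 < k" "q n < Suc n" "q (Suc n) < Suc n"
  shows "nil_word n d (n # nf n (q, k))"
proof -
  obtain m where m: "n = Suc m" using assms(2) by (cases n) auto
  define a where "a = flat n q n"
  have "q n \<noteq> q (Suc n)" using permutes_interval_neq[OF q] by simp
  moreover have "a = (if q (Suc n) < q n then q n - 1 else q n)"
    using assms(2) unfolding a_def flat_def by (intro if_P) simp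
  ultimately have "a < n" using assms(2,4,5) by presburger
  moreover have "0 < a" using permutes_interval_bounds[OF flat_permutes[OF q], of n] assms(2)
    by (simp add: a_def)
  ultimately have a: "0 < a" "a < n" by auto
  define l where "l = k - 2"
  then have l: "k = Suc (Suc l)" using assms(3) by arith
  have "braid_eq n (rev [a..<Suc n] @ [n, n]) ([n - 1, n - 1] @ rev [a..<Suc n])"
    using braid_eq_shift_list[of a "Suc n" n "[n, n]"] a by simp
  moreover have "nil_word n d ([n - 1, n - 1] @ rev [a..<Suc n])"
    using a nil_word_square[of "n - 1" n d "[]" "rev [a..<Suc n]"] by simp
  ultimately have "nil_word n d (rev [a..<Suc n] @ [n, n])"
    by (rule nil_word_braid_eq)
  from nil_word_context[OF this]
  have "nil_word n d (perm_word m (flat m (flat n q)) @ (rev [a..<Suc n] @ [n, n]) @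
      replicate l n @ rev [q (Suc n)..<n])" .
  then have "nil_word n d (perm_word m (flat m (flat n q)) @ rev [flat n q n..<Suc n] @
      replicate k n @ rev [q (Suc n)..<n])"
    unfolding l a_def by simp
  then show ?thesis
    unfolding m by (rule nil_word_braid_eq[OF nf_start[OF q[unfolded m]]])
qed

lemma nf_step:
  assumes "d \<ge> 2" "s \<in> states n d" "i \<in> {1..n}"
  shows "step n d i s = Some t \<Longrightarrow> braid_eq n (i # nf n s) (nf n t)"
    and "step n d i s = None \<Longrightarrow> nil_word n d (i # nf n s)"
proof -
  obtain q k where s: "s = (q, k)" by fastforce
  note st = assms(2)[unfolded s]
  have q: "q permutes {1..Suc n}" and k: "k < d" "k = 0 \<longleftrightarrow> q (Suc n) = Suc n"
    using assms(2) by (simp_all add: s states_def)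
  have neq: "q n \<noteq> q (Suc n)" using permutes_interval_neq[OF q] by simp
  have bd: "q n \<le> Suc n" "q (Suc n) \<le> Suc n"
    using permutes_interval_bounds[OF q, of n] permutes_interval_bounds[OF q, of "Suc n"] assms(3) by auto
  have n: "0 < n" using assms(3) by simp
  consider "i < n" "q i < q (Suc i)" | "i < n" "\<not> q i < q (Suc i)"
    | "i = n" "k = 0 \<or> k = 1 \<and> q n < q (Suc n)"
    | "i = n" "k = 1" "q (Suc n) < q n" "q n < Suc n"
    | "i = n" "k > 0" "q n = Suc n" | "i = n" "k > 1" "q n < Suc n"
    using bd neq assms(3) by fastforce
  then have "case step n d i s of None \<Rightarrow> nil_word n d (i # nf n s)
    | Some t \<Rightarrow> braid_eq n (i # nf n s) (nf n t)"
  proof cases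
    case 1
    then show ?thesis using nf_step_less(1)[OF st] assms(3) by (simp add: s)
  next
    case 2
    then show ?thesis using nf_step_less(2)[OF st] assms(3) by (simp add: s)
  next
    case 3
    then have e: "step n d i s = Some (swap n q, 1)" by (auto simp: s)
    have "q n < q (Suc n)" using 3 k bd neq by linarith
    then have "braid_eq n (n # nf n (q, k)) (nf n (swap n q, 1))"
      using nf_step_up[OF st n] step_states[OF assms e] 3 by linarith
    then show ?thesis unfolding e using 3 by (simp add: s)
  next
    case 4
    then have e: "step n d i s = None" by (simp add: s)
    then show ?thesis using nf_step_down[of q n d] st n 4 by (simp add: s)
  next
    case 5
    then have "\<not> q n < q (Suc n)" using bd by simp
    then have e: "step n d i s = (if Suc k < d then Some (q, Suc k) else None)"
      using 5 by (simp add: s)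
    note p = nf_step_power[OF q n 5(3), of k]
    show ?thesis
    proof (cases "Suc k < d")
      case True
      then show ?thesis using p 5 unfolding e by (simp add: s)
    next
      case False
      \<comment> \<open>The exponent has become \<open>d\<close>, so the normal form of the would-be
        state contains the vanishing power.\<close>
      then have "Suc k = d" using k by simp
      then have "nil_word n d (nf n (q, Suc k))" using nil_word_power by (simp add: nf.simps)
      then show ?thesis using nil_word_braid_eq[OF p] False 5 unfolding e by (simp add: s)
    qed
  next
    case 6
    have "q (Suc n) < Suc n" using 6 k bd by linarith
    then have "nil_word n d (n # nf n (q, k))" using nf_step_nil[OF q n] 6 by simp
    then show ?thesis using 6 by (simp add: s)
  qed
  then show "step n d i s = Some t \<Longrightarrow> braid_eq n (i # nf n s) (nf n t)"
    and "step n d i s = None \<Longrightarrow> nil_word n d (i # nf n s)" by simp_all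
qed

definition start :: "(nat \<Rightarrow> nat) \<times> nat" where
  "start = (id, 0)"

lemma start_state: "d \<ge> 2 \<Longrightarrow> start \<in> states n d"
  by (auto simp: start_def states_def permutes_id)

lemma nf_start_state: "nf n start = []"
proof -
  have "flat m id = id" for m by (auto simp: flat_def fun_eq_iff)
  then have "perm_word m id = []" for m by (induction m) simp_all
  then show ?thesis using \<open>flat n id = id\<close> by (simp add: start_def nf.simps)
qed

lemma run_nf_cases:
  assumes "d \<ge> 2" "set u \<subseteq> {1..n}"
  shows "case run n d u start of None \<Rightarrow> nil_word n d u | Some t \<Rightarrow> braid_eq n u (nf n t)"
  using assms(2)
proof (induction u)
  case (Cons i u)
  show ?case
  proof (cases "run n d u start")
    case None
    then show ?thesis using Cons nil_word_Cons by simp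
  next
    case (Some t)
    then have e: "braid_eq n (i # u) (i # nf n t)" using Cons by (simp add: braid_eq_Cons)
    have t: "t \<in> states n d" using run_states[OF assms(1) start_state[OF assms(1)] _ Some] Cons.prems by simp
    have i: "i \<in> {1..n}" using Cons.prems by simp
    show ?thesis
    proof (cases "step n d i t")
      case None
      show ?thesis using nil_word_braid_eq[OF e nf_step(2)[OF assms(1) t i None]] Some None by simp
    next
      case (Some t')
      show ?thesis using braid_eq.chain[OF e nf_step(1)[OF assms(1) t i Some]] Some \<open>run n d u start = Some t\<close>
        by simp
    qed
  qed
qed (simp add: nf_start_state)

section \<open>Every state is reached from the identity\<close>

definition weight :: "nat \<Rightarrow> (nat \<Rightarrow> nat) \<Rightarrow> nat" where
  "weight n q = (\<Sum>x\<in>{1..n}. (n - x) * q x)"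

text \<open>The coefficients \<open>n - x\<close> drop by one from each position to the next, so
  moving the larger of two values one place to the right lowers the sum by their difference.\<close>

lemma weight_swap:
  assumes "0 < i" "i < n" "q (Suc i) < q i"
  shows "weight n (swap i q) < weight n q"
proof -
  define R where "R = {1..n} - {i, Suc i}"
  have "{1..n} = insert i (insert (Suc i) R)" using assms by (auto simp: R_def)
  moreover have R: "finite R" "i \<notin> R" "Suc i \<notin> R" by (simp_all add: R_def)
  ultimately have split: "weight n f = (n - i) * f i + ((n - Suc i) * f (Suc i) + (\<Sum>x\<in>R. (n - x) * f x))"
    for f unfolding weight_def by simp
  have R: "(\<Sum>x\<in>R. (n - x) * swap i q x) = (\<Sum>x\<in>R. (n - x) * q x)"
    using R by (intro sum.cong) (auto intro!: swap_neq)
  have "n - i = Suc (n - Suc i)" using assms by simp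
  then show ?thesis unfolding split[of "swap i q"] split[of q] R using assms(3)
    by (simp add: swap_apply)
qed

lemma ascending_gap:
  fixes q :: "nat \<Rightarrow> nat"
  assumes "\<And>i. 0 < i \<Longrightarrow> i < n \<Longrightarrow> q i < q (Suc i)" "0 < x"
  shows "x + e \<le> n \<Longrightarrow> q x + e \<le> q (x + e)"
proof (induction e)
  case (Suc e)
  then show ?case using assms(1)[of "x + e"] assms(2) by simp
qed simp

text \<open>A predecessor is found for every state except \<open>start\<close>: a descent among the
  first \<open>n\<close> positions was made by a letter below \<open>n\<close>. If there is none and
  \<open>k > 0\<close>, then the value \<open>n + 1\<close> stands at position \<open>n\<close>, and
  the last letter was \<open>T_n\<close>, which made the swap if \<open>k = 1\<close> and raised the
  exponent if \<open>k > 1\<close>.\<close>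

lemma state_reachable:
  assumes "d \<ge> 2" "s \<in> states n d" "n \<ge> 1"
  shows "\<exists>u. set u \<subseteq> {1..n} \<and> run n d u start = Some s"
proof -
  define R where "R s \<longleftrightarrow> (\<exists>u. set u \<subseteq> {1..n} \<and> run n d u start = Some s)" for s
  have R_start: "R start" unfolding R_def by (rule exI[of _ "[]"]) simp
  have R_step: "R t" if "R s" "step n d i s = Some t" "i \<in> {1..n}" for s t i
  proof -
    obtain u where "set u \<subseteq> {1..n}" "run n d u start = Some s" using \<open>R s\<close> R_def by blast
    then have "set (i # u) \<subseteq> {1..n} \<and> run n d (i # u) start = Some t" using that by simp
    then show ?thesis unfolding R_def by blast
  qed
  have "R (q, k)" if "(q, k) \<in> states n d" for q k
    using that
  \<comment> \<open>The exponent comes first in the order, because undoing the swap by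
    \<open>T_n\<close> may increase the weight.\<close>
  proof (induction "(k, weight n q)" arbitrary: q k rule: wf_induct_rule[OF wf_lex_prod[OF wf_less_than wf_less_than]])
    case (1 q k)
    have q: "q permutes {1..Suc n}" and k: "k < d" "k = 0 \<longleftrightarrow> q (Suc n) = Suc n"
      using 1(2) by (simp_all add: states_def)
    show ?case
    proof (cases "\<exists>i. 0 < i \<and> i < n \<and> \<not> q i < q (Suc i)")
      case True
      then obtain i where i: "0 < i" "i < n" "\<not> q i < q (Suc i)" by blast
      have "q i \<noteq> q (Suc i)" using permutes_interval_neq[OF q] by simp
      then have less: "q (Suc i) < q i" using i by simp
      have st: "(swap i q, k) \<in> states n d"
        using swap_permutes[OF q i(1)] i k by (simp add: states_def swap_neq)
      have "R (swap i q, k)" using 1(1)[OF _ st] weight_swap[OF i(1,2) less] by simp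
      moreover have "swap i (swap i q) = q" by (rule ext) (auto simp: swap_apply)
      then have "step n d i (swap i q, k) = Some (q, k)" using less i(2) by (simp add: swap_apply)
      ultimately show ?thesis by (rule R_step) (use i in simp)
    next
      case False
      then have asc: "q i < q (Suc i)" if "0 < i" "i < n" for i using that by blast
      have pos: "0 < q x \<and> q x \<le> Suc n" if "x \<in> {1..Suc n}" for x
        using permutes_interval_bounds[OF q that] .
      have upper: "q x + (n - x) \<le> q n" if "x \<in> {1..n}" for x
        using ascending_gap[of n q x "n - x", OF asc] that by simp
      show ?thesis
      proof (cases "k = 0")
        case True
        then have last: "q (Suc n) = Suc n" using k by simp
        have "q n \<noteq> q (Suc n)" using permutes_interval_neq[OF q] by simp
        then have "q n \<le> n" using pos[of n] last assms(3) by simp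
        \<comment> \<open>Values ascending by at least one per position satisfy
          \<open>q x \<ge> x\<close> since \<open>q 1 > 0\<close>, and \<open>q x \<le> x\<close>
          since \<open>q n \<le> n\<close>.\<close>
        have "q x = x" for x
        proof (cases "x \<in> {1..n}")
          case True
          have "0 < q 1" using pos[of 1] by simp
          moreover have "q 1 + (x - 1) \<le> q x" using ascending_gap[of n q 1 "x - 1", OF asc] True by simp
          ultimately have "x \<le> q x" using True by linarith
          then show ?thesis using upper[OF True] \<open>q n \<le> n\<close> True by simp
        next
          case False
          then show ?thesis using last permutes_not_in[OF q, of x] by (cases "x = Suc n") auto
        qed
        then have "q = id" by auto
        then have "(q, k) = start" using True by (simp add: start_def)
        then show ?thesis using R_start by (simp only:)
      next
        case False
        \<comment> \<open>As \<open>k\<close> is not 0, the value \<open>n + 1\<close> occurs among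
          the first \<open>n\<close> positions, and since these ascend it occurs at the last of
          them.\<close>
        have "Suc n \<in> q ` {1..Suc n}" unfolding permutes_image[OF q] by simp
        then obtain x where x: "Suc n = q x" "x \<in> {1..Suc n}" by (rule imageE)
        have "x \<noteq> Suc n" using x False k by auto
        then have "x \<in> {1..n}" using x by simp
        then have "q x \<le> q n" using upper[of x] by linarith
        moreover have "q n \<le> Suc n" using pos[of n] assms(3) by simp
        ultimately have qn: "q n = Suc n" using x(1) by linarith
        have "q (Suc n) \<le> Suc n" using pos[of "Suc n"] by simp
        then have qs: "q (Suc n) < Suc n" using False k by simp
        show ?thesis
        proof (cases "k = 1")
          case True
          have st: "(swap n q, 0) \<in> states n d"
            using swap_permutes[OF q, of n] assms(1,3) qn by (simp add: states_def swap_apply)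
          have "R (swap n q, 0)" using 1(1)[OF _ st] True by simp
          moreover have "swap n (swap n q) = q" by (rule ext) (auto simp: swap_apply)
          then have "step n d n (swap n q, 0) = Some (q, k)" using True by simp
          ultimately show ?thesis by (rule R_step) (use assms(3) in simp)
        next
          case k1: False
          have st: "(q, k - 1) \<in> states n d" using q qs k False k1 by (simp add: states_def)
          have "R (q, k - 1)" using 1(1)[OF _ st] False by simp
          moreover have "step n d n (q, k - 1) = Some (q, k)" using qn qs k False k1 by simp
          ultimately show ?thesis by (rule R_step) (use assms(3) in simp)
        qed
      qed
    qed
  qed
  then show ?thesis using assms(2) unfolding R_def by (cases s) blast
qed

text \<open>This avoids running the normal form letter by letter: some word reaches
  \<open>s\<close>, it is equivalent to \<open>nf n s\<close>, and equivalent words act equally.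
  Consequently normal forms of different states are not equivalent.\<close>

lemma run_nf:
  assumes "d \<ge> 2" "s \<in> states n d" "n \<ge> 1"
  shows "run n d (nf n s) start = Some s"
proof -
  obtain u where u: "set u \<subseteq> {1..n}" "run n d u start = Some s"
    using state_reachable[OF assms] by blast
  then have "braid_eq n u (nf n s)" using run_nf_cases[OF assms(1) u(1)] by simp
  then show ?thesis using run_braid_eq[OF assms(1) start_state[OF assms(1)] _ u(1)] u(2) by simp
qed

section \<open>Surviving words in the letters below n and reduced expressions\<close>

definition word_perm :: "nat list \<Rightarrow> nat \<Rightarrow> nat" where
  "word_perm u = foldr (\<lambda>i p. transpose i (i + 1) \<circ> p) u id"

lemma word_perm_simps [simp]:
  "word_perm [] = id" "word_perm (i # u) = transpose i (i + 1) \<circ> word_perm u"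
  by (simp_all add: word_perm_def)

text \<open>A surviving letter \<open>i\<close> below \<open>n\<close> multiplies \<open>q\<close>
  by \<open>s_i\<close> on the right and the permutation of the word by \<open>s_i\<close> on the
  left, so the product stays the same.\<close>

lemma run_word_perm:
  assumes "set u \<subseteq> {1..<n}" "run n d u start = Some (q, k)"
  shows "k = 0 \<and> q \<circ> word_perm u = id"
  using assms
proof (induction u arbitrary: q k)
  case (Cons i u)
  then obtain r l where r: "run n d u start = Some (r, l)" "step n d i (r, l) = Some (q, k)"
    by (auto simp: bind_eq_Some_conv simp del: step.simps)
  have "l = 0 \<and> r \<circ> word_perm u = id" using Cons.IH[OF _ r(1)] Cons.prems(1) by fastforce
  then have "l = 0" and id: "r \<circ> word_perm u = id" by auto
  have "q = swap i r" "k = l" using r(2) Cons.prems(1) by (auto split: if_splits)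
  then have "q \<circ> word_perm (i # u) = r \<circ> word_perm u"
    by (intro ext) (simp add: swap_eq)
  then have "q \<circ> word_perm (i # u) = id" using id by (simp only:)
  then show ?case using \<open>k = l\<close> \<open>l = 0\<close> by blast
qed (simp add: start_def)

lemma flat_fixed:
  assumes "q permutes {1..n}"
  shows "flat n q = q"
proof
  fix x
  have "q (Suc n) = Suc n" using permutes_not_in[OF assms] by simp
  then show "flat n q x = q x"
    using permutes_interval_bounds[OF assms, of x] permutes_not_in[OF assms, of x] by (auto simp: flat_def)
qed

lemma state_zero_iff:
  assumes "d \<ge> 2"
  shows "(q, 0) \<in> states n d \<longleftrightarrow> q permutes {1..n}"
proof
  assume "(q, 0) \<in> states n d"
  then have q: "q permutes {1..Suc n}" "q (Suc n) = Suc n" by (auto simp: states_def)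
  have "{1..n} = {1..Suc n} - {Suc n}" by auto
  then show "q permutes {1..n}"
    using permutes_superset[OF q(1), of "{1..n}"] q(2) by (metis Diff_iff Diff_Diff_Int IntE singletonD)
next
  assume q: "q permutes {1..n}"
  then have "q permutes {1..Suc n}" by (rule permutes_subset) auto
  then show "(q, 0) \<in> states n d" using assms permutes_not_in[OF q, of "Suc n"] by (simp add: states_def)
qed

lemma nf_zero:
  assumes "q permutes {1..n}"
  shows "nf n (q, 0) = perm_word n q"
  using flat_fixed[OF assms] permutes_not_in[OF assms, of "Suc n"] by (simp add: nf.simps)

text \<open>A form of the exchange property. The word dies at a letter \<open>i\<close> where the
  state of the remaining word has a descent, so that remaining word is equivalent to some word
  beginning with \<open>i\<close>, and the two letters \<open>i\<close> cancel in the symmetric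
  group.\<close>

lemma not_reduced:
  assumes "d \<ge> 2" "n \<ge> 1" "set u \<subseteq> {1..<n}" "run n d u start = None"
  shows "\<exists>v. set v \<subseteq> {1..<n} \<and> word_perm v = word_perm u \<and> length v < length u"
  using assms(3,4)
proof (induction u)
  case (Cons i u)
  show ?case
  proof (cases "run n d u start")
    case None
    then obtain v where "set v \<subseteq> {1..<n}" "word_perm v = word_perm u" "length v < length u"
      using Cons by auto
    then show ?thesis using Cons.prems by (intro exI[of _ "i # v"]) simp
  next
    case (Some t)
    have u: "set u \<subseteq> {1..<n}" and i: "0 < i" "i < n" using Cons.prems by auto
    have u': "set u \<subseteq> {1..n}" using u by fastforce
    obtain q where t: "t = (q, 0)" and qu: "q \<circ> word_perm u = id"
      using run_word_perm[OF u] Some by (cases t) blast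
    have qs: "(q, 0) \<in> states n d"
      using run_states[OF assms(1) start_state[OF assms(1)] u' Some] t by simp
    then have q: "q permutes {1..n}" using state_zero_iff[OF assms(1)] by simp
    have "q i \<noteq> q (Suc i)" using permutes_interval_neq[OF q] by simp
    moreover have "\<not> q i < q (Suc i)" using Cons.prems(2) Some t i by (auto split: if_splits)
    ultimately have less: "q (Suc i) < q i" by simp
    \<comment> \<open>Undoing the descent gives a word \<open>v\<close> for the permutation of
      \<open>i # u\<close>. Both \<open>i # v\<close> and \<open>u\<close> reach
      \<open>(q, 0)\<close>, hence have the same length, so \<open>v\<close> has two letters less
      than \<open>i # u\<close>.\<close>
    define v where "v = nf n (swap i q, 0)"
    have q': "swap i q permutes {1..n}" using swap_permutes[OF q i] .
    have vs: "set v \<subseteq> {1..<n}" unfolding v_def nf_zero[OF q'] using perm_word_set[OF q'] .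
    have sws: "(swap i q, 0) \<in> states n d" using q' state_zero_iff[OF assms(1)] by simp
    have "swap i (swap i q) = q" by (rule ext) (auto simp: swap_apply)
    then have "step n d i (swap i q, 0) = Some (q, 0)" using less i by (simp add: swap_apply)
    then have iv: "run n d (i # v) start = Some (q, 0)"
      using run_nf[OF assms(1) sws assms(2)] by (simp add: v_def)
    have ivs: "set (i # v) \<subseteq> {1..<n}" using vs i by simp
    have ivs': "set (i # v) \<subseteq> {1..n}" using ivs by fastforce
    have "q \<circ> word_perm (i # v) = q \<circ> word_perm u"
      using run_word_perm[OF ivs iv] qu by simp
    then have "word_perm (i # v) = word_perm u"
      using permutes_inj[OF q] by (simp add: fun.inj_map_strong fun_eq_iff inj_eq)
    then have "word_perm (i # u) = (transpose i (Suc i) \<circ> transpose i (Suc i)) \<circ> word_perm v"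
      by (metis comp_assoc word_perm_simps(2) Suc_eq_plus1)
    then have "word_perm v = word_perm (i # u)" by simp
    moreover have "braid_eq n u (nf n (q, 0))" using run_nf_cases[OF assms(1) u'] Some t by simp
    moreover have "braid_eq n (i # v) (nf n (q, 0))" using run_nf_cases[OF assms(1) ivs'] iv by simp
    ultimately show ?thesis using vs braid_eq_length[of n u] braid_eq_length[of n "i # v"]
      by (intro exI[of _ v]) fastforce
  qed
qed (simp add: start_def)

text \<open>This is \<open>s_m ... s_n p\<close>, the inverse of \<open>flat\<close>: the values
  from \<open>m\<close> upwards make room for \<open>m\<close> at position
  \<open>n + 1\<close>.\<close>

definition unflat :: "nat \<Rightarrow> nat \<Rightarrow> (nat \<Rightarrow> nat) \<Rightarrow> nat \<Rightarrow> nat" where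
  "unflat n m p x = (if x \<in> {1..n} then if p x < m then p x else Suc (p x)
     else if x = Suc n then m else x)"

lemma unflat_permutes:
  assumes p: "p permutes {1..n}" and m: "m \<in> {1..n}"
  shows "unflat n m p permutes {1..Suc n}"
proof -
  have inj: "inj_on (unflat n m p) {1..Suc n}"
  proof (rule inj_onI)
    fix x y assume xy: "x \<in> {1..Suc n}" "y \<in> {1..Suc n}" "unflat n m p x = unflat n m p y"
    have "p x = p y \<Longrightarrow> x = y" using permutes_inj[OF p] by (simp add: inj_eq)
    then show "x = y" using xy by (auto simp: unflat_def split: if_splits)
  qed
  have "unflat n m p ` {1..Suc n} \<subseteq> {1..Suc n}"
    using permutes_interval_bounds[OF p] m by (fastforce simp: unflat_def)
  then have "bij_betw (unflat n m p) {1..Suc n} {1..Suc n}"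
    using inj by (simp add: bij_betw_def card_image card_subset_eq)
  then show ?thesis by (rule bij_imp_permutes) (auto simp: unflat_def)
qed

lemma unflat_states:
  assumes "p permutes {1..n}" "m \<in> {1..n}" "0 < k" "k < d"
  shows "(unflat n m p, k) \<in> states n d"
  using unflat_permutes[OF assms(1,2)] assms by (simp add: states_def unflat_def)

lemma flat_unflat:
  assumes p: "p permutes {1..n}" and m: "m \<in> {1..n}"
  shows "flat n (unflat n m p) = p"
proof
  fix x
  show "flat n (unflat n m p) x = p x"
    using permutes_not_in[OF p, of x] by (auto simp: flat_def unflat_def)
qed

lemma nf_unflat:
  assumes "p permutes {1..n}" "m \<in> {1..n}"
  shows "nf n (unflat n m p, k) = perm_word n p @ replicate k n @ rev [m..<n]"
  using flat_unflat[OF assms] by (simp add: nf.simps unflat_def)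

text \<open>Running the word directly would read the power and the run before \<open>u\<close>.
  Instead \<open>u\<close> is replaced by its normal form, after which the whole word is literally
  the normal form of the claimed state.\<close>

lemma run_nf_product:
  assumes "d \<ge> 2" "n \<ge> 1" "set u \<subseteq> {1..n}" "run n d u start = Some (p, 0)"
    "m \<in> {1..n}" "0 < k" "k < d"
  shows "run n d (u @ replicate k n @ rev [m..<n]) start = Some (unflat n m p, k)"
proof -
  have "(p, 0) \<in> states n d" using run_states[OF assms(1) start_state[OF assms(1)] assms(3,4)] .
  then have p: "p permutes {1..n}" using state_zero_iff[OF assms(1)] by simp
  have "braid_eq n u (perm_word n p)"
    using run_nf_cases[OF assms(1,3)] assms(4) nf_zero[OF p] by simp
  then have "braid_eq n (u @ replicate k n @ rev [m..<n]) (nf n (unflat n m p, k))"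
    unfolding nf_unflat[OF p assms(5)] by (rule braid_eq_append)
  moreover have "set (u @ replicate k n @ rev [m..<n]) \<subseteq> {1..n}"
    using assms by auto
  ultimately show ?thesis
    using run_braid_eq[OF assms(1) start_state[OF assms(1)]]
      run_nf[OF assms(1) unflat_states[OF p assms(5,6,7)] assms(2)] by simp
qed

section \<open>Words in the first l letters\<close>

lemma step_restrict:
  assumes "(q, k) \<in> states l 2" "i \<in> {1..l}" "l < n"
  shows "step n d i (q, 0) = map_option (\<lambda>(q, k). (q, 0)) (step l 2 i (q, k))"
proof (cases "i < l")
  case False
  have q: "q permutes {1..Suc l}" and k: "k < 2" "k = 0 \<longleftrightarrow> q (Suc l) = Suc l"
    using assms(1) by (auto simp: states_def)
  have "q l \<le> Suc l" using permutes_interval_bounds[OF q, of l] assms(2) by simp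
  moreover have "q l \<noteq> q (Suc l)" using permutes_interval_neq[OF q] by simp
  \<comment> \<open>For \<open>d = 2\<close> the letter \<open>l\<close> never raises the exponent,
    and for \<open>k = 0\<close> the ascent is automatic. What remains is the bare ascent test, as
    for a letter below \<open>n\<close>.\<close>
  ultimately have "k = 0 \<Longrightarrow> q l < q (Suc l)" using k by simp
  moreover have "k = 0 \<or> k = 1" using k by auto
  ultimately show ?thesis using False assms(2,3) by auto
qed (use assms in auto)

lemma run_restrict:
  assumes "set u \<subseteq> {1..l}" "l < n"
  shows "run n d u start = map_option (\<lambda>(q, k). (q, 0)) (run l 2 u start)"
  using assms(1)
proof (induction u)
  case (Cons i u)
  show ?case
  proof (cases "run l 2 u start")
    case (Some s)
    obtain q k where s: "s = (q, k)" by fastforce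
    have "(q, k) \<in> states l 2" using run_states[OF _ start_state _ Some] Cons.prems s by simp
    then show ?thesis using Cons Some s step_restrict[of q k l i n d] assms(2) by (simp del: step.simps)
  qed (use Cons in simp)
qed (simp add: start_def)

text \<open>The exponent that \<open>run_restrict\<close> forgets can be recovered: on
  \<open>states l 2\<close> it is 0 or 1, and 0 exactly if the permutation fixes
  \<open>l + 1\<close>.\<close>

lemma run_restrict_eq_iff:
  assumes "set u \<subseteq> {1..l}" "set v \<subseteq> {1..l}" "l < n"
  shows "run n d u start = run n d v start \<longleftrightarrow> run l 2 u start = run l 2 v start"
    and "run n d u start = None \<longleftrightarrow> run l 2 u start = None"
proof -
  have st: "run l 2 w start = Some s \<Longrightarrow> s \<in> states l 2" if "set w \<subseteq> {1..l}" for w s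
    using run_states[OF _ start_state that] by simp
  have inj: "k = k'" if "(q, k) \<in> states l 2" "(q, k') \<in> states l 2" for q :: "nat \<Rightarrow> nat" and k k'
    using that unfolding states_def by auto
  show "run n d u start = run n d v start \<longleftrightarrow> run l 2 u start = run l 2 v start"
    using st[OF assms(1)] st[OF assms(2)] inj
    unfolding run_restrict[OF assms(1,3)] run_restrict[OF assms(2,3)]
    by (cases "run l 2 u start"; cases "run l 2 v start") auto
  show "run n d u start = None \<longleftrightarrow> run l 2 u start = None"
    unfolding run_restrict[OF assms(1,3)] by simp
qed

section \<open>The free algebra and its ideals of class functions\<close>

context cring
begin

definition conv :: "('x list \<Rightarrow> 'a) \<Rightarrow> ('x list \<Rightarrow> 'a) \<Rightarrow> 'x list \<Rightarrow> 'a" where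
  "conv f g u = (\<Oplus>i\<in>{..length u}. f (take i u) \<otimes> g (drop i u))"

definition mono :: "'x list \<Rightarrow> 'x list \<Rightarrow> 'a" where
  "mono u = (\<lambda>v. if v = u then \<one> else \<zero>)"

lemma free_algebra_simps [simp]:
  "f \<otimes>\<^bsub>free_algebra R V\<^esub> g = conv f g"
  "\<one>\<^bsub>free_algebra R V\<^esub> = mono []"
  "\<zero>\<^bsub>free_algebra R V\<^esub> = (\<lambda>u. \<zero>)"
  "f \<oplus>\<^bsub>free_algebra R V\<^esub> g = (\<lambda>u. f u \<oplus> g u)"
  "c \<odot>\<^bsub>free_algebra R V\<^esub> f = (\<lambda>u. c \<otimes> f u)"
  by (simp_all add: free_algebra_def conv_def mono_def fun_eq_iff)

lemma free_algebra_carrier: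
  "f \<in> carrier (free_algebra R V) \<longleftrightarrow> (\<forall>u. f u \<in> carrier R) \<and> finite {u. f u \<noteq> \<zero>} \<and>
    (\<forall>u. f u \<noteq> \<zero> \<longrightarrow> set u \<subseteq> V)"
  by (simp add: free_algebra_def)

lemma coeff_closed [simp]: "f \<in> carrier (free_algebra R V) \<Longrightarrow> f u \<in> carrier R"
  by (simp add: free_algebra_carrier)

lemma free_gen_eq_mono: "free_gen R x = mono [x]"
  by (simp add: free_gen_def mono_def)

lemma mono_closed [simp]: "mono u v \<in> carrier R"
  by (simp add: mono_def)

lemma conv_closed [simp]:
  "(\<And>u. f u \<in> carrier R) \<Longrightarrow> (\<And>u. g u \<in> carrier R) \<Longrightarrow> conv f g u \<in> carrier R"
  unfolding conv_def by (intro finsum_closed) auto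

lemma conv_Nil [simp]:
  "(\<And>u. f u \<in> carrier R) \<Longrightarrow> (\<And>u. g u \<in> carrier R) \<Longrightarrow> conv f g [] = f [] \<otimes> g []"
  by (simp add: conv_def finsum_singleton)

text \<open>The cut before the first letter gives the first term, and all other cuts belong to the
  shifted left factor. This recursion lets the ring laws below be proved by induction on the word
  with an arbitrary left factor, without rearranging double sums.\<close>

lemma conv_Cons [simp]:
  assumes "\<And>u. f u \<in> carrier R" "\<And>u. g u \<in> carrier R"
  shows "conv f g (x # u) = f [] \<otimes> g (x # u) \<oplus> conv (\<lambda>v. f (x # v)) g u"
proof -
  have "conv f g (x # u) = (\<Oplus>i\<in>{..length u}. f (x # take i u) \<otimes> g (drop i u)) \<oplus> f [] \<otimes> g (x # u)"
    unfolding conv_def list.size add_Suc_right add_0_right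
    by (subst finsum_Suc2) (use assms in auto)
  then show ?thesis using assms by (simp add: conv_def a_comm)
qed

lemma conv_add_left:
  assumes "\<And>u. f u \<in> carrier R" "\<And>u. g u \<in> carrier R" "\<And>u. h u \<in> carrier R"
  shows "conv (\<lambda>v. f v \<oplus> g v) h u = conv f h u \<oplus> conv g h u"
  using assms
proof (induction u arbitrary: f g)
  case (Cons x u)
  have "conv (\<lambda>v. f (x # v) \<oplus> g (x # v)) h u = conv (\<lambda>v. f (x # v)) h u \<oplus> conv (\<lambda>v. g (x # v)) h u"
    using Cons by simp
  then show ?case using Cons.prems by (simp add: l_distr a_ac)
qed (simp add: l_distr)

lemma conv_add_right:
  assumes "\<And>u. f u \<in> carrier R" "\<And>u. g u \<in> carrier R" "\<And>u. h u \<in> carrier R"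
  shows "conv h (\<lambda>v. f v \<oplus> g v) u = conv h f u \<oplus> conv h g u"
  using assms
proof (induction u arbitrary: h)
  case (Cons x u)
  have "conv (\<lambda>v. h (x # v)) (\<lambda>v. f v \<oplus> g v) u = conv (\<lambda>v. h (x # v)) f u \<oplus> conv (\<lambda>v. h (x # v)) g u"
    using Cons by simp
  then show ?case using Cons.prems by (simp add: r_distr a_ac)
qed (simp add: r_distr)

lemma conv_smult_left:
  assumes "\<And>u. f u \<in> carrier R" "\<And>u. g u \<in> carrier R" "c \<in> carrier R"
  shows "conv (\<lambda>v. c \<otimes> f v) g u = c \<otimes> conv f g u"
  using assms
proof (induction u arbitrary: f)
  case (Cons x u)
  have "conv (\<lambda>v. c \<otimes> f (x # v)) g u = c \<otimes> conv (\<lambda>v. f (x # v)) g u"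
    using Cons by simp
  then show ?case using Cons.prems by (simp add: r_distr m_ac)
qed (simp add: m_ac)

lemma conv_smult_right:
  assumes "\<And>u. f u \<in> carrier R" "\<And>u. g u \<in> carrier R" "c \<in> carrier R"
  shows "conv f (\<lambda>v. c \<otimes> g v) u = c \<otimes> conv f g u"
  using assms
proof (induction u arbitrary: f)
  case (Cons x u)
  have "conv (\<lambda>v. f (x # v)) (\<lambda>v. c \<otimes> g v) u = c \<otimes> conv (\<lambda>v. f (x # v)) g u"
    using Cons by simp
  then show ?case using Cons.prems by (simp add: r_distr m_ac)
qed (simp add: m_ac)

lemma conv_assoc:
  assumes "\<And>u. f u \<in> carrier R" "\<And>u. g u \<in> carrier R" "\<And>u. h u \<in> carrier R"
  shows "conv (conv f g) h u = conv f (conv g h) u"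
  using assms
proof (induction u arbitrary: f g)
  case (Cons x u)
  have "conv (\<lambda>v. conv f g (x # v)) h u =
      conv (\<lambda>v. f [] \<otimes> g (x # v) \<oplus> conv (\<lambda>w. f (x # w)) g v) h u"
    using Cons.prems by simp
  also have "\<dots> = f [] \<otimes> conv (\<lambda>v. g (x # v)) h u \<oplus> conv (conv (\<lambda>w. f (x # w)) g) h u"
    using Cons.prems by (simp add: conv_add_left conv_smult_left)
  also have "conv (conv (\<lambda>w. f (x # w)) g) h u = conv (\<lambda>w. f (x # w)) (conv g h) u"
    using Cons by simp
  finally show ?case using Cons.prems by (simp add: r_distr m_assoc a_assoc)
qed (simp add: m_assoc)

lemma conv_zero_left [simp]: "(\<And>u. g u \<in> carrier R) \<Longrightarrow> conv (\<lambda>v. \<zero>) g u = \<zero>"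
  by (induction u) simp_all

lemma conv_mono_left:
  assumes "\<And>u. g u \<in> carrier R"
  shows "conv (mono u) g (u @ w) = g w"
    and "(\<nexists>w. v = u @ w) \<Longrightarrow> conv (mono u) g v = \<zero>"
proof -
  have shift: "(\<lambda>v. mono (x # u) (y # v)) = (if x = y then mono u else (\<lambda>v. \<zero>))" for x y u
    by (auto simp: mono_def)
  have shift0: "(\<lambda>v. mono [] (y # v)) = (\<lambda>v. \<zero>)" for y
    by (auto simp: mono_def)
  have base: "conv (mono []) g w = g w" for w
    using assms by (cases w) (simp_all add: shift0, simp_all add: mono_def)
  have 0: "mono (x # u) [] = \<zero>" for x u by (simp add: mono_def)
  show "conv (mono u) g (u @ w) = g w"
    using assms by (induction u) (simp_all add: base shift 0)
  show "(\<nexists>w. v = u @ w) \<Longrightarrow> conv (mono u) g v = \<zero>"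
  proof (induction u arbitrary: v)
    case (Cons x u)
    then show ?case using assms by (cases v) (auto simp: shift 0)
  qed simp
qed

lemma conv_mono_mono: "conv (mono u) (mono v) = mono (u @ v)"
proof
  fix w
  show "conv (mono u) (mono v) w = mono (u @ v) w"
  proof (cases "\<exists>w'. w = u @ w'")
    case True
    then obtain w' where w: "w = u @ w'" by blast
    have "conv (mono u) (mono v) w = mono v w'"
      unfolding w by (rule conv_mono_left(1)) simp
    then show ?thesis by (simp add: mono_def w)
  next
    case False
    have "conv (mono u) (mono v) w = \<zero>"
      using False by (intro conv_mono_left(2)) simp_all
    moreover have "w \<noteq> u @ v" using False by blast
    ultimately show ?thesis by (simp add: mono_def)
  qed
qed

lemma conv_one_left: "(\<And>u. g u \<in> carrier R) \<Longrightarrow> conv (mono []) g u = g u"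
  using conv_mono_left(1)[of g "[]" u] by simp

lemma conv_one_right:
  assumes "\<And>u. f u \<in> carrier R"
  shows "conv f (mono []) u = f u"
  using assms
proof (induction u arbitrary: f)
  case (Cons x u)
  have "mono [] (x # u) = \<zero>" by (simp add: mono_def)
  then show ?case using Cons by simp
qed (simp add: mono_def)

text \<open>Bounds the support of a product by the concatenations of words from the two supports,
  which gives both its finiteness and the restriction to the alphabet.\<close>

lemma conv_nonzero:
  assumes "\<And>u. f u \<in> carrier R" "\<And>u. g u \<in> carrier R" "conv f g u \<noteq> \<zero>"
  obtains v w where "u = v @ w" "f v \<noteq> \<zero>" "g w \<noteq> \<zero>"
proof -
  have "\<exists>i. f (take i u) \<otimes> g (drop i u) \<noteq> \<zero>"
  proof (rule ccontr)
    assume "\<nexists>i. f (take i u) \<otimes> g (drop i u) \<noteq> \<zero>"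
    then have "conv f g u = \<zero>" unfolding conv_def by (intro add.finprod_one_eqI) simp
    then show False using assms(3) by simp
  qed
  then obtain i where i: "f (take i u) \<otimes> g (drop i u) \<noteq> \<zero>" by blast
  then have "f (take i u) \<noteq> \<zero>" "g (drop i u) \<noteq> \<zero>" using assms(1,2) by auto
  then show ?thesis using that[of "take i u" "drop i u"] by simp
qed

lemma conv_in_free_algebra:
  assumes "f \<in> carrier (free_algebra R V)" "g \<in> carrier (free_algebra R V)"
  shows "conv f g \<in> carrier (free_algebra R V)"
proof -
  have c: "\<And>u. f u \<in> carrier R" "\<And>u. g u \<in> carrier R"
    using assms by (auto simp: free_algebra_carrier)
  have sub: "{u. conv f g u \<noteq> \<zero>} \<subseteq> (\<lambda>(v, w). v @ w) ` ({u. f u \<noteq> \<zero>} \<times> {u. g u \<noteq> \<zero>})"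
  proof
    fix u assume "u \<in> {u. conv f g u \<noteq> \<zero>}"
    then have "conv f g u \<noteq> \<zero>" by simp
    from conv_nonzero[OF c this] obtain v w where "u = v @ w" "f v \<noteq> \<zero>" "g w \<noteq> \<zero>" .
    then show "u \<in> (\<lambda>(v, w). v @ w) ` ({u. f u \<noteq> \<zero>} \<times> {u. g u \<noteq> \<zero>})" by force
  qed
  have "finite {u. conv f g u \<noteq> \<zero>}"
    using assms by (intro finite_subset[OF sub]) (simp add: free_algebra_carrier)
  moreover have "set u \<subseteq> V" if "conv f g u \<noteq> \<zero>" for u
  proof -
    from conv_nonzero[OF c that] obtain v w where "u = v @ w" "f v \<noteq> \<zero>" "g w \<noteq> \<zero>" .
    then show ?thesis using assms by (simp add: free_algebra_carrier)
  qed
  ultimately show ?thesis using c by (simp add: free_algebra_carrier)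
qed

lemma mono_in_free_algebra: "set u \<subseteq> V \<Longrightarrow> mono u \<in> carrier (free_algebra R V)"
proof -
  have "{v. mono u v \<noteq> \<zero>} \<subseteq> {u}" by (auto simp: mono_def)
  then show "set u \<subseteq> V \<Longrightarrow> mono u \<in> carrier (free_algebra R V)"
    using finite_subset unfolding free_algebra_carrier by fastforce
qed

lemma zero_in_free_algebra: "(\<lambda>u. \<zero>) \<in> carrier (free_algebra R V)"
  by (simp add: free_algebra_carrier)

lemma add_in_free_algebra:
  assumes "f \<in> carrier (free_algebra R V)" "g \<in> carrier (free_algebra R V)"
  shows "(\<lambda>u. f u \<oplus> g u) \<in> carrier (free_algebra R V)"
proof -
  have "{u. f u \<oplus> g u \<noteq> \<zero>} \<subseteq> {u. f u \<noteq> \<zero>} \<union> {u. g u \<noteq> \<zero>}" by auto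
  then have "finite {u. f u \<oplus> g u \<noteq> \<zero>}"
    by (rule finite_subset) (use assms in \<open>simp add: free_algebra_carrier\<close>)
  moreover have "set u \<subseteq> V" if "f u \<oplus> g u \<noteq> \<zero>" for u
    using assms that by (cases "f u = \<zero>") (auto simp: free_algebra_carrier)
  ultimately show ?thesis using assms by (simp add: free_algebra_carrier)
qed

lemma smult_in_free_algebra:
  assumes "c \<in> carrier R" "f \<in> carrier (free_algebra R V)"
  shows "(\<lambda>u. c \<otimes> f u) \<in> carrier (free_algebra R V)"
proof -
  have "{u. c \<otimes> f u \<noteq> \<zero>} \<subseteq> {u. f u \<noteq> \<zero>}" using assms by auto
  then have "finite {u. c \<otimes> f u \<noteq> \<zero>}"
    by (rule finite_subset) (use assms in \<open>simp add: free_algebra_carrier\<close>)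
  moreover have "set u \<subseteq> V" if "c \<otimes> f u \<noteq> \<zero>" for u
    using assms that by (cases "f u = \<zero>") (auto simp: free_algebra_carrier)
  ultimately show ?thesis using assms by (simp add: free_algebra_carrier)
qed

lemma free_algebra_ring: "ring (free_algebra R V)"
proof (rule ringI)
  show "abelian_group (free_algebra R V)"
  proof (rule abelian_groupI)
    fix f assume f: "f \<in> carrier (free_algebra R V)"
    have "{u. \<ominus> f u \<noteq> \<zero>} = {u. f u \<noteq> \<zero>}"
      using f by (auto simp: free_algebra_carrier)
    then have "(\<lambda>u. \<ominus> f u) \<in> carrier (free_algebra R V)"
      using f by (auto simp: free_algebra_carrier)
    moreover have "(\<lambda>u. \<ominus> f u) \<oplus>\<^bsub>free_algebra R V\<^esub> f = \<zero>\<^bsub>free_algebra R V\<^esub>"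
      using f by (simp add: free_algebra_carrier l_neg)
    ultimately show "\<exists>g\<in>carrier (free_algebra R V). g \<oplus>\<^bsub>free_algebra R V\<^esub> f = \<zero>\<^bsub>free_algebra R V\<^esub>"
      by blast
  qed (auto simp: add_in_free_algebra zero_in_free_algebra fun_eq_iff a_ac)
  show "Group.monoid (free_algebra R V)"
    by (rule monoidI)
      (auto simp: conv_in_free_algebra mono_in_free_algebra fun_eq_iff
        conv_assoc conv_one_left conv_one_right)
qed (auto simp: fun_eq_iff conv_add_left conv_add_right)

lemma free_algebra_module: "module R (free_algebra R V)"
proof (rule moduleI)
  show "abelian_group (free_algebra R V)"
    using free_algebra_ring by (rule ring.is_abelian_group)
qed (auto simp: smult_in_free_algebra is_cring fun_eq_iff l_distr r_distr m_assoc)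

lemma free_algebra_minus:
  assumes "f \<in> carrier (free_algebra R V)" "g \<in> carrier (free_algebra R V)"
  shows "f \<ominus>\<^bsub>free_algebra R V\<^esub> g = (\<lambda>u. f u \<ominus> g u)"
proof -
  interpret F: ring "free_algebra R V" by (rule free_algebra_ring)
  have c: "f u \<in> carrier R" "g u \<in> carrier R" for u using assms by (auto simp: free_algebra_carrier)
  have "{u. \<ominus> g u \<noteq> \<zero>} = {u. g u \<noteq> \<zero>}" using c by auto
  then have "(\<lambda>u. \<ominus> g u) \<in> carrier (free_algebra R V)"
    using assms(2) by (auto simp: free_algebra_carrier)
  then have "\<ominus>\<^bsub>free_algebra R V\<^esub> g = (\<lambda>u. \<ominus> g u)"
    using assms(2) c by (intro F.minus_equality) (auto simp: l_neg)
  then show ?thesis using c by (simp add: F.minus_eq a_minus_def)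
qed

lemma free_algebra_induct [consumes 1, case_names zero add]:
  assumes f: "f \<in> carrier (free_algebra R V)"
    and zero: "P (\<lambda>u. \<zero>)"
    and add: "\<And>f c u. f \<in> carrier (free_algebra R V) \<Longrightarrow> c \<in> carrier R \<Longrightarrow> set u \<subseteq> V \<Longrightarrow> P f \<Longrightarrow>
      P (\<lambda>v. f v \<oplus> c \<otimes> mono u v)"
  shows "P f"
proof -
  have "P f" if "finite S" "f \<in> carrier (free_algebra R V)" "{u. f u \<noteq> \<zero>} \<subseteq> S" for S f
    using that
  proof (induction S arbitrary: f)
    case empty
    then have "f = (\<lambda>u. \<zero>)" by auto
    then show ?case using zero by simp
  next
    case (insert u S)
    show ?case
    proof (cases "f u = \<zero>")
      case True
      then have "{u. f u \<noteq> \<zero>} \<subseteq> S" using insert.prems(2) by auto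
      then show ?thesis using insert by blast
    next
      case False
      define g where "g = f(u := \<zero>)"
      have sub: "{v. g v \<noteq> \<zero>} \<subseteq> {v. f v \<noteq> \<zero>}" by (auto simp: g_def)
      then have g: "g \<in> carrier (free_algebra R V)"
        using insert.prems(1) finite_subset[OF sub] by (auto simp: free_algebra_carrier g_def)
      have "{v. g v \<noteq> \<zero>} \<subseteq> S" using insert.prems(2) by (auto simp: g_def)
      then have "P g" using insert.IH g by blast
      then have "P (\<lambda>v. g v \<oplus> f u \<otimes> mono u v)"
        using add g insert.prems(1) False by (simp add: free_algebra_carrier)
      moreover have "(\<lambda>v. g v \<oplus> f u \<otimes> mono u v) = f"
        using insert.prems(1) by (auto simp: g_def mono_def free_algebra_carrier)
      ultimately show ?thesis by simp
    qed
  qed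
  then show ?thesis using f by (auto simp: free_algebra_carrier)
qed

end

text \<open>The value \<open>None\<close> plays the role of zero: the words over \<open>V\<close> modulo \<open>N\<close> form a
  monoid with zero.\<close>

definition word_congruence :: "'x set \<Rightarrow> ('x list \<Rightarrow> 'c option) \<Rightarrow> bool" where
  "word_congruence V N \<longleftrightarrow>
    (\<forall>x u v. set x \<subseteq> V \<and> set u \<subseteq> V \<and> set v \<subseteq> V \<and> N u = N v \<longrightarrow>
      N (x @ u) = N (x @ v) \<and> N (u @ x) = N (v @ x)) \<and>
    (\<forall>x u. set x \<subseteq> V \<and> set u \<subseteq> V \<and> N u = None \<longrightarrow> N (x @ u) = None \<and> N (u @ x) = None)"

section \<open>Pairings with functions on words, and ideals as annihilators\<close>

context cring
begin

definition pairing :: "('x list \<Rightarrow> 'a) \<Rightarrow> ('x list \<Rightarrow> 'a) \<Rightarrow> 'a" where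
  "pairing h f = (\<Oplus>u\<in>{u. f u \<noteq> \<zero>}. f u \<otimes> h u)"

lemma pairing_closed [simp]:
  "f \<in> carrier (free_algebra R V) \<Longrightarrow> (\<And>u. h u \<in> carrier R) \<Longrightarrow> pairing h f \<in> carrier R"
  unfolding pairing_def by (intro finsum_closed) auto

lemma pairing_superset:
  assumes "f \<in> carrier (free_algebra R V)" "\<And>u. h u \<in> carrier R" "finite S" "{u. f u \<noteq> \<zero>} \<subseteq> S"
  shows "pairing h f = (\<Oplus>u\<in>S. f u \<otimes> h u)"
  unfolding pairing_def
  by (rule add.finprod_mono_neutral_cong_left[OF assms(3,4)]) (use assms in auto)

lemma pairing_zero [simp]: "pairing h (\<lambda>u. \<zero>) = \<zero>"
  by (simp add: pairing_def)

lemma pairing_add: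
  assumes f: "f \<in> carrier (free_algebra R V)" and g: "g \<in> carrier (free_algebra R V)"
    and h: "\<And>u. h u \<in> carrier R"
  shows "pairing h (\<lambda>u. f u \<oplus> g u) = pairing h f \<oplus> pairing h g"
proof -
  let ?S = "{u. f u \<noteq> \<zero>} \<union> {u. g u \<noteq> \<zero>}"
  have S: "finite ?S" using f g by (simp add: free_algebra_carrier)
  have sub: "{u. f u \<oplus> g u \<noteq> \<zero>} \<subseteq> ?S" by auto
  have "pairing h (\<lambda>u. f u \<oplus> g u) = (\<Oplus>u\<in>?S. (f u \<oplus> g u) \<otimes> h u)"
    by (rule pairing_superset[OF add_in_free_algebra[OF f g] h S sub])
  also have "\<dots> = (\<Oplus>u\<in>?S. f u \<otimes> h u \<oplus> g u \<otimes> h u)"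
    using coeff_closed[OF f] coeff_closed[OF g] h by (intro finsum_cong') (auto simp: l_distr)
  also have "\<dots> = (\<Oplus>u\<in>?S. f u \<otimes> h u) \<oplus> (\<Oplus>u\<in>?S. g u \<otimes> h u)"
    using coeff_closed[OF f] coeff_closed[OF g] h by (intro finsum_addf) auto
  also have "(\<Oplus>u\<in>?S. f u \<otimes> h u) = pairing h f"
    by (rule pairing_superset[OF f h S, symmetric]) simp
  also have "(\<Oplus>u\<in>?S. g u \<otimes> h u) = pairing h g"
    by (rule pairing_superset[OF g h S, symmetric]) simp
  finally show ?thesis .
qed

lemma pairing_smult:
  assumes f: "f \<in> carrier (free_algebra R V)" and c: "c \<in> carrier R"
    and h: "\<And>u. h u \<in> carrier R"
  shows "pairing h (\<lambda>u. c \<otimes> f u) = c \<otimes> pairing h f"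
proof -
  let ?S = "{u. f u \<noteq> \<zero>}"
  have S: "finite ?S" using f by (simp add: free_algebra_carrier)
  have sub: "{u. c \<otimes> f u \<noteq> \<zero>} \<subseteq> ?S" using c by auto
  have "pairing h (\<lambda>u. c \<otimes> f u) = (\<Oplus>u\<in>?S. (c \<otimes> f u) \<otimes> h u)"
    by (rule pairing_superset[OF smult_in_free_algebra[OF c f] h S sub])
  also have "\<dots> = (\<Oplus>u\<in>?S. c \<otimes> (f u \<otimes> h u))"
    using coeff_closed[OF f] h c by (intro finsum_cong') (auto simp: m_assoc)
  also have "\<dots> = c \<otimes> pairing h f"
    unfolding pairing_def using coeff_closed[OF f] h c S by (intro finsum_rdistr[symmetric]) auto
  finally show ?thesis .
qed

lemma pairing_mono:
  assumes "set u \<subseteq> V" and h: "\<And>u. h u \<in> carrier R"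
  shows "pairing h (mono u) = h u"
proof -
  have "pairing h (mono u) = (\<Oplus>v\<in>{u}. mono u v \<otimes> h v)"
    by (rule pairing_superset[OF mono_in_free_algebra[OF assms(1)] h]) (auto simp: mono_def)
  also have "\<dots> = mono u u \<otimes> h u" using h by (subst finsum_insert) auto
  finally show ?thesis using h by (simp add: mono_def)
qed

lemma pairing_add_mono:
  assumes f: "f \<in> carrier (free_algebra R V)" and c: "c \<in> carrier R" and u: "set u \<subseteq> V"
    and h: "\<And>u. h u \<in> carrier R"
  shows "pairing h (\<lambda>v. f v \<oplus> c \<otimes> mono u v) = pairing h f \<oplus> c \<otimes> h u"
  using pairing_add[OF f smult_in_free_algebra[OF c mono_in_free_algebra[OF u]] h]
    pairing_smult[OF mono_in_free_algebra[OF u] c h] pairing_mono[OF u h] by simp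

lemma conv_zero_right [simp]: "(\<And>u. f u \<in> carrier R) \<Longrightarrow> conv f (\<lambda>v. \<zero>) u = \<zero>"
  by (induction u arbitrary: f) simp_all

text \<open>Multiplication by a word is adjoint to a shift of the function paired with. This is how
  closure of an annihilator under products becomes a property of the functions.\<close>

lemma pairing_conv_mono_left:
  assumes f: "f \<in> carrier (free_algebra R V)" and x: "set x \<subseteq> V" and h: "\<And>u. h u \<in> carrier R"
  shows "pairing h (conv (mono x) f) = pairing (\<lambda>v. h (x @ v)) f"
  using f
proof (induction rule: free_algebra_induct)
  case zero
  have "conv (mono x) (\<lambda>u. \<zero>) = (\<lambda>u. \<zero>)" by (rule ext) simp
  then show ?case by simp
next
  case (add f c u)
  note mx = mono_in_free_algebra[OF x]
  have "conv (mono x) (\<lambda>v. f v \<oplus> c \<otimes> mono u v) = (\<lambda>w. conv (mono x) f w \<oplus> c \<otimes> mono (x @ u) w)"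
    using add by (simp add: fun_eq_iff conv_add_right conv_smult_right flip: conv_mono_mono)
  then have "pairing h (conv (mono x) (\<lambda>v. f v \<oplus> c \<otimes> mono u v)) =
      pairing h (conv (mono x) f) \<oplus> c \<otimes> h (x @ u)"
    using pairing_add_mono[OF conv_in_free_algebra[OF mx add(1)], of c "x @ u" h] add x h by simp
  also have "\<dots> = pairing (\<lambda>v. h (x @ v)) f \<oplus> c \<otimes> h (x @ u)" using add by simp
  also have "\<dots> = pairing (\<lambda>v. h (x @ v)) (\<lambda>v. f v \<oplus> c \<otimes> mono u v)"
    using pairing_add_mono[OF add(1-3), of "\<lambda>v. h (x @ v)"] h by simp
  finally show ?case .
qed

lemma pairing_conv_mono_right:
  assumes f: "f \<in> carrier (free_algebra R V)" and x: "set x \<subseteq> V" and h: "\<And>u. h u \<in> carrier R"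
  shows "pairing h (conv f (mono x)) = pairing (\<lambda>v. h (v @ x)) f"
  using f
proof (induction rule: free_algebra_induct)
  case zero
  have "conv (\<lambda>u. \<zero>) (mono x) = (\<lambda>u. \<zero>)" by (rule ext) simp
  then show ?case by simp
next
  case (add f c u)
  note mx = mono_in_free_algebra[OF x]
  have "conv (\<lambda>v. f v \<oplus> c \<otimes> mono u v) (mono x) = (\<lambda>w. conv f (mono x) w \<oplus> c \<otimes> mono (u @ x) w)"
    using add by (simp add: fun_eq_iff conv_add_left conv_smult_left flip: conv_mono_mono)
  then have "pairing h (conv (\<lambda>v. f v \<oplus> c \<otimes> mono u v) (mono x)) =
      pairing h (conv f (mono x)) \<oplus> c \<otimes> h (u @ x)"
    using pairing_add_mono[OF conv_in_free_algebra[OF add(1) mx], of c "u @ x" h] add x h by simp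
  also have "\<dots> = pairing (\<lambda>v. h (v @ x)) f \<oplus> c \<otimes> h (u @ x)" using add by simp
  also have "\<dots> = pairing (\<lambda>v. h (v @ x)) (\<lambda>v. f v \<oplus> c \<otimes> mono u v)"
    using pairing_add_mono[OF add(1-3), of "\<lambda>v. h (v @ x)"] h by simp
  finally show ?case .
qed

definition class_functions :: "'x set \<Rightarrow> ('x list \<Rightarrow> 'c option) \<Rightarrow> ('x list \<Rightarrow> 'a) set" where
  "class_functions V N = {h. (\<forall>u. h u \<in> carrier R) \<and>
    (\<forall>u v. set u \<subseteq> V \<and> set v \<subseteq> V \<and> N u = N v \<longrightarrow> h u = h v) \<and>
    (\<forall>u. set u \<subseteq> V \<and> N u = None \<longrightarrow> h u = \<zero>)}"

text \<open>Indicators of single nonzero classes are class functions, so membership says that the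
  coefficients over each such class sum to zero. Testing against all class functions makes the
  condition linear and stable under shifts, without reference to representatives.\<close>

definition class_ideal :: "'x set \<Rightarrow> ('x list \<Rightarrow> 'c option) \<Rightarrow> ('x list \<Rightarrow> 'a) set" where
  "class_ideal V N = {f \<in> carrier (free_algebra R V). \<forall>h\<in>class_functions V N. pairing h f = \<zero>}"

lemma class_functions_closed: "h \<in> class_functions V N \<Longrightarrow> h u \<in> carrier R"
  by (simp add: class_functions_def)

lemma class_functions_shift:
  assumes "word_congruence V N" "h \<in> class_functions V N" "set x \<subseteq> V"
  shows "(\<lambda>v. h (x @ v)) \<in> class_functions V N" "(\<lambda>v. h (v @ x)) \<in> class_functions V N"
proof -
  have cf: "N (x @ u) = N (x @ v) \<and> N (u @ x) = N (v @ x)"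
    if "set u \<subseteq> V" "set v \<subseteq> V" "N u = N v" for u v
    using assms(1,3) that unfolding word_congruence_def by blast
  have none: "N (x @ u) = None \<and> N (u @ x) = None" if "set u \<subseteq> V" "N u = None" for u
    using assms(1,3) that unfolding word_congruence_def by blast
  have h: "h u \<in> carrier R" for u using assms(2) by (rule class_functions_closed)
  have h1: "h u = h v" if "set u \<subseteq> V" "set v \<subseteq> V" "N u = N v" for u v
    using assms(2) that unfolding class_functions_def by blast
  have h2: "h u = \<zero>" if "set u \<subseteq> V" "N u = None" for u
    using assms(2) that unfolding class_functions_def by blast
  show "(\<lambda>v. h (x @ v)) \<in> class_functions V N"
    unfolding class_functions_def
  proof (intro CollectI conjI allI impI)
    show "h (x @ u) = h (x @ v)" if "set u \<subseteq> V \<and> set v \<subseteq> V \<and> N u = N v" for u v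
      using that assms(3) cf[of u v] by (intro h1) auto
    show "h (x @ u) = \<zero>" if "set u \<subseteq> V \<and> N u = None" for u
      using that assms(3) none[of u] by (intro h2) auto
  qed (rule h)
  show "(\<lambda>v. h (v @ x)) \<in> class_functions V N"
    unfolding class_functions_def
  proof (intro CollectI conjI allI impI)
    show "h (u @ x) = h (v @ x)" if "set u \<subseteq> V \<and> set v \<subseteq> V \<and> N u = N v" for u v
      using that assms(3) cf[of u v] by (intro h1) auto
    show "h (u @ x) = \<zero>" if "set u \<subseteq> V \<and> N u = None" for u
      using that assms(3) none[of u] by (intro h2) auto
  qed (rule h)
qed

text \<open>By linearity the outer factor of a product may be taken to be a word. Adjointness moves
  it to the class function, which remains one because the classes form a congruence.\<close>

lemma class_ideal_ideal:
  assumes "word_congruence V N"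
  shows "ideal (class_ideal V N) (free_algebra R V)"
proof -
  interpret Fr: ring "free_algebra R V" by (rule free_algebra_ring)
  interpret F: module R "free_algebra R V" by (rule free_algebra_module)
  have sub: "class_ideal V N \<subseteq> carrier (free_algebra R V)" by (auto simp: class_ideal_def)
  have sum: "(\<lambda>u. f u \<oplus> g u) \<in> class_ideal V N" if "f \<in> class_ideal V N" "g \<in> class_ideal V N" for f g
  proof -
    have F: "f \<in> carrier (free_algebra R V)" "g \<in> carrier (free_algebra R V)" using that sub by auto
    have "pairing h (\<lambda>u. f u \<oplus> g u) = \<zero>" if h: "h \<in> class_functions V N" for h
      using pairing_add[OF F class_functions_closed[OF h]]
        \<open>f \<in> class_ideal V N\<close> \<open>g \<in> class_ideal V N\<close> h
      by (simp add: class_ideal_def)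
    then show ?thesis using add_in_free_algebra[OF F] by (simp add: class_ideal_def)
  qed
  have smult: "(\<lambda>u. c \<otimes> f u) \<in> class_ideal V N" if "f \<in> class_ideal V N" "c \<in> carrier R" for f c
  proof -
    have F: "f \<in> carrier (free_algebra R V)" using that sub by auto
    have "pairing h (\<lambda>u. c \<otimes> f u) = \<zero>" if h: "h \<in> class_functions V N" for h
      using pairing_smult[OF F \<open>c \<in> carrier R\<close> class_functions_closed[OF h]] \<open>f \<in> class_ideal V N\<close> \<open>c \<in> carrier R\<close> h
      by (simp add: class_ideal_def)
    then show ?thesis using smult_in_free_algebra[OF \<open>c \<in> carrier R\<close> F] by (simp add: class_ideal_def)
  qed
  have inv: "\<ominus>\<^bsub>free_algebra R V\<^esub> f \<in> class_ideal V N" if "f \<in> class_ideal V N" for f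
    using F.smult_minus_1[of f] smult[OF that, of "\<ominus> \<one>"] sub that by auto
  have left: "conv g f \<in> class_ideal V N" if f: "f \<in> class_ideal V N" and "g \<in> carrier (free_algebra R V)" for f g
    using that(2)
  proof (induction rule: free_algebra_induct)
    case zero
    have "conv (\<lambda>u. \<zero>) f = (\<lambda>u. \<zero>)" using sub f by (intro ext conv_zero_left) auto
    then show ?case by (simp add: class_ideal_def zero_in_free_algebra)
  next
    case (add g c u)
    have fF: "f \<in> carrier (free_algebra R V)" using f sub by blast
    have mu: "conv (mono u) f \<in> class_ideal V N"
    proof -
      have "pairing h (conv (mono u) f) = \<zero>" if h: "h \<in> class_functions V N" for h
        using pairing_conv_mono_left[OF fF add(3) class_functions_closed[OF h]]
          class_functions_shift(1)[OF assms h add(3)] f by (simp add: class_ideal_def)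
      then show ?thesis using conv_in_free_algebra[OF mono_in_free_algebra[OF add(3)] fF]
        by (simp add: class_ideal_def)
    qed
    have "conv (\<lambda>v. g v \<oplus> c \<otimes> mono u v) f = (\<lambda>w. conv g f w \<oplus> c \<otimes> conv (mono u) f w)"
      using add coeff_closed[OF fF] by (simp add: fun_eq_iff conv_add_left conv_smult_left)
    then show ?case using sum[OF add(4) smult[OF mu add(2)]] by simp
  qed
  have right: "conv f g \<in> class_ideal V N" if f: "f \<in> class_ideal V N" and "g \<in> carrier (free_algebra R V)" for f g
    using that(2)
  proof (induction rule: free_algebra_induct)
    case zero
    have "conv f (\<lambda>u. \<zero>) = (\<lambda>u. \<zero>)" using sub f by (intro ext conv_zero_right) auto
    then show ?case by (simp add: class_ideal_def zero_in_free_algebra)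
  next
    case (add g c u)
    have fF: "f \<in> carrier (free_algebra R V)" using f sub by blast
    have mu: "conv f (mono u) \<in> class_ideal V N"
    proof -
      have "pairing h (conv f (mono u)) = \<zero>" if h: "h \<in> class_functions V N" for h
        using pairing_conv_mono_right[OF fF add(3) class_functions_closed[OF h]]
          class_functions_shift(2)[OF assms h add(3)] f by (simp add: class_ideal_def)
      then show ?thesis using conv_in_free_algebra[OF fF mono_in_free_algebra[OF add(3)]]
        by (simp add: class_ideal_def)
    qed
    have "conv f (\<lambda>v. g v \<oplus> c \<otimes> mono u v) = (\<lambda>w. conv f g w \<oplus> c \<otimes> conv f (mono u) w)"
      using add coeff_closed[OF fF] by (simp add: fun_eq_iff conv_add_right conv_smult_right)
    then show ?case using sum[OF add(4) smult[OF mu add(2)]] by simp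
  qed
  show ?thesis
  proof (rule idealI)
    show "subgroup (class_ideal V N) (add_monoid (free_algebra R V))"
      using sub sum inv by (intro Fr.add.subgroupI)
        (auto simp: class_ideal_def zero_in_free_algebra intro: exI[of _ "\<lambda>u. \<zero>"])
  qed (use left right Fr.ring_axioms in auto)
qed

text \<open>Modulo such an ideal, every element equals a combination of chosen representatives of the
  classes, and the coefficients are pairings with class functions.\<close>

lemma class_ideal_least:
  fixes V :: "'x set" and N :: "'x list \<Rightarrow> 'c option"
  assumes I: "ideal I (free_algebra R V)"
    and eq: "\<And>u v. set u \<subseteq> V \<Longrightarrow> set v \<subseteq> V \<Longrightarrow> N u = N v \<Longrightarrow> (\<lambda>w. mono u w \<ominus> mono v w) \<in> I"
    and none: "\<And>u. set u \<subseteq> V \<Longrightarrow> N u = None \<Longrightarrow> mono u \<in> I"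
  shows "class_ideal V N \<subseteq> I"
proof
  interpret I: ideal I "free_algebra R V" by (rule I)
  interpret F: module R "free_algebra R V" by (rule free_algebra_module)
  have zero: "(\<lambda>w. \<zero>) \<in> I"
    using additive_subgroup.zero_closed[OF ideal.axioms(1)[OF I]] unfolding free_algebra_simps .
  have sum: "(\<lambda>w. f w \<oplus> g w) \<in> I" if "f \<in> I" "g \<in> I" for f g
    using additive_subgroup.a_closed[OF ideal.axioms(1)[OF I] that] unfolding free_algebra_simps .
  define rep where "rep s = (SOME u. set u \<subseteq> V \<and> N u = s)" for s
  have rep: "set (rep (N u)) \<subseteq> V \<and> N (rep (N u)) = N u" if "set u \<subseteq> V" for u
    unfolding rep_def using someI_ex[of "\<lambda>v. set v \<subseteq> V \<and> N v = N u"] that by blast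
  define ind where "ind w u = (if N u \<noteq> None \<and> rep (N u) = w then \<one> else \<zero>)" for w u
  define rho where "rho f w = pairing (ind w) f" for f w
  have ind: "ind w u \<in> carrier R" for w u by (simp add: ind_def)
  \<comment> \<open>A ring ideal is closed under scalars because \<open>c\<close> times
    \<open>f\<close> is the product of \<open>c\<close> times the unit with
    \<open>f\<close>.\<close>
  have smult: "(\<lambda>u. c \<otimes> f u) \<in> I" if "c \<in> carrier R" "f \<in> I" for c f
  proof -
    have fF: "f \<in> carrier (free_algebra R V)" using that by simp
    have "(\<lambda>u. c \<otimes> mono [] u) \<in> carrier (free_algebra R V)"
      using that by (intro smult_in_free_algebra mono_in_free_algebra) auto
    from I.I_l_closed[OF that(2) this] have "conv (\<lambda>u. c \<otimes> mono [] u) f \<in> I" by simp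
    moreover have "conv (\<lambda>u. c \<otimes> mono [] u) f = (\<lambda>u. c \<otimes> f u)"
      using coeff_closed[OF fF] that by (simp add: fun_eq_iff conv_smult_left conv_one_left)
    ultimately show ?thesis by simp
  qed
  have rho_mono: "(\<lambda>w. ind w u) = (if N u = None then (\<lambda>w. \<zero>) else mono (rep (N u)))" for u
    by (auto simp: ind_def mono_def)
  have "rho f \<in> carrier (free_algebra R V) \<and> (\<lambda>w. f w \<ominus> rho f w) \<in> I"
    if "f \<in> carrier (free_algebra R V)" for f
    using that
  proof (induction rule: free_algebra_induct)
    case zero
    note zero = \<open>(\<lambda>w. \<zero>) \<in> I\<close>
    have "rho (\<lambda>u. \<zero>) = (\<lambda>w. \<zero>)" by (simp add: rho_def fun_eq_iff)
    then show ?case using zero by (simp add: zero_in_free_algebra a_minus_def)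
  next
    case (add f c u)
    have r: "rho (\<lambda>v. f v \<oplus> c \<otimes> mono u v) = (\<lambda>w. rho f w \<oplus> c \<otimes> ind w u)"
      unfolding rho_def using pairing_add_mono[OF add(1-3) ind] by simp
    have iF: "(\<lambda>w. ind w u) \<in> carrier (free_algebra R V)"
      using rep[OF add(3)] by (simp add: rho_mono zero_in_free_algebra mono_in_free_algebra)
    have iI: "(\<lambda>w. mono u w \<ominus> ind w u) \<in> I"
    proof (cases "N u = None")
      case True
      then have "(\<lambda>w. mono u w \<ominus> ind w u) = mono u" by (auto simp: ind_def a_minus_def)
      then show ?thesis using none[OF add(3) True] by simp
    next
      case False
      then have "ind w u = mono (rep (N u)) w" for w by (auto simp: ind_def mono_def)
      then show ?thesis using eq[OF add(3), of "rep (N u)"] rep[OF add(3)] by simp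
    qed
    have "(\<lambda>w. (f w \<ominus> rho f w) \<oplus> c \<otimes> (mono u w \<ominus> ind w u)) \<in> I"
      using sum[OF conjunct2[OF add(4)] smult[OF add(2) iI]] .
    moreover have "(f w \<ominus> rho f w) \<oplus> c \<otimes> (mono u w \<ominus> ind w u) =
        (f w \<oplus> c \<otimes> mono u w) \<ominus> (rho f w \<oplus> c \<otimes> ind w u)" for w
    proof -
      have "f w \<in> carrier R" "rho f w \<in> carrier R" "mono u w \<in> carrier R" "ind w u \<in> carrier R"
        using coeff_closed[OF add(1)] pairing_closed[OF add(1) ind] ind by (simp_all add: rho_def)
      then show ?thesis using add(2) by algebra
    qed
    ultimately show ?case unfolding r
      using add_in_free_algebra[OF conjunct1[OF add(4)] smult_in_free_algebra[OF add(2) iF]] by simp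
  qed note main = this
  fix f assume f: "f \<in> class_ideal V N"
  then have fF: "f \<in> carrier (free_algebra R V)" by (simp add: class_ideal_def)
  \<comment> \<open>The coefficient of the representative \<open>w\<close> in the reduced form of
    \<open>f\<close> is the pairing with the class function \<open>ind w\<close>. All of them vanish
    on the class ideal, so \<open>f\<close> is congruent to zero modulo \<open>I\<close>.\<close>
  have "ind w \<in> class_functions V N" for w
    unfolding class_functions_def using ind by (simp add: ind_def)
  then have "rho f w = \<zero>" for w using f by (simp add: rho_def class_ideal_def)
  then show "f \<in> I" using main[OF fF] coeff_closed[OF fF] by (simp add: a_minus_def)
qed

end

section \<open>Quotients by word congruences\<close>

locale word_algebra = field +
  fixes V :: "'x set" and N :: "'x list \<Rightarrow> 'c option"
  assumes congruence: "word_congruence V N"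
begin

abbreviation F where "F \<equiv> free_algebra R V"

abbreviation A where "A \<equiv> quot_algebra F (class_ideal V N)"

definition cls :: "('x list \<Rightarrow> 'a) \<Rightarrow> ('x list \<Rightarrow> 'a) set" where
  "cls f = class_ideal V N +>\<^bsub>F\<^esub> f"

lemma is_ideal: "ideal (class_ideal V N) F"
  using congruence by (rule class_ideal_ideal)

lemma cls_eq_iff_ideal:
  assumes "f \<in> carrier F" "g \<in> carrier F"
  shows "cls f = cls g \<longleftrightarrow> (\<lambda>u. f u \<ominus> g u) \<in> class_ideal V N"
  using ring.quotient_eq_iff_same_a_r_cos[OF free_algebra_ring is_ideal assms] free_algebra_minus[OF assms]
  by (simp add: cls_def)

lemma mem_cls_iff:
  assumes "f \<in> carrier F"
  shows "g \<in> cls f \<longleftrightarrow> g \<in> carrier F \<and> cls g = cls f"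
proof -
  interpret I: ideal "class_ideal V N" F by (rule is_ideal)
  have sub: "cls f \<subseteq> carrier F"
    unfolding cls_def using I.a_rcosets_carrier I.a_rcosetsI[OF I.a_subset assms] by blast
  show ?thesis
  proof
    assume g: "g \<in> cls f"
    then have "cls f = cls g" unfolding cls_def using I.a_repr_independence' assms by blast
    then show "g \<in> carrier F \<and> cls g = cls f" using g sub by auto
  next
    assume "g \<in> carrier F \<and> cls g = cls f"
    then show "g \<in> cls f" unfolding cls_def using I.a_rcos_self by blast
  qed
qed

lemma minus_in_free_algebra:
  assumes "f \<in> carrier F" "g \<in> carrier F"
  shows "(\<lambda>u. f u \<ominus> g u) \<in> carrier F"
proof -
  interpret Fr: ring F by (rule free_algebra_ring)
  show ?thesis using Fr.minus_closed[OF assms] free_algebra_minus[OF assms] by simp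
qed

lemma pairing_minus:
  assumes f: "f \<in> carrier F" and g: "g \<in> carrier F" and h: "\<And>u. h u \<in> carrier R"
  shows "pairing h (\<lambda>u. f u \<ominus> g u) = pairing h f \<ominus> pairing h g"
proof -
  have "(\<lambda>u. f u \<ominus> g u) = (\<lambda>u. f u \<oplus> (\<ominus> \<one>) \<otimes> g u)"
    using coeff_closed[OF f] coeff_closed[OF g] by (simp add: fun_eq_iff a_minus_def l_minus)
  then have "pairing h (\<lambda>u. f u \<ominus> g u) = pairing h f \<oplus> (\<ominus> \<one>) \<otimes> pairing h g"
    using pairing_add[OF f smult_in_free_algebra[OF _ g] h] pairing_smult[OF g _ h] by simp
  then show ?thesis using pairing_closed[OF f h] pairing_closed[OF g h]
    by (simp add: a_minus_def l_minus)
qed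

text \<open>Class functions thus separate the elements of the quotient, so identities there can be
  checked on pairings instead of cosets.\<close>

lemma cls_eq_iff:
  assumes "f \<in> carrier F" "g \<in> carrier F"
  shows "cls f = cls g \<longleftrightarrow> (\<forall>h\<in>class_functions V N. pairing h f = pairing h g)"
proof -
  have "pairing h (\<lambda>u. f u \<ominus> g u) = \<zero> \<longleftrightarrow> pairing h f = pairing h g"
    if h: "h \<in> class_functions V N" for h
    using pairing_minus[OF assms class_functions_closed[OF h]]
      pairing_closed[OF assms(1) class_functions_closed[OF h]]
      pairing_closed[OF assms(2) class_functions_closed[OF h]] by simp
  then show ?thesis unfolding cls_eq_iff_ideal[OF assms]
    using minus_in_free_algebra[OF assms] by (simp add: class_ideal_def)
qed

lemma A_carrier: "carrier A = cls ` carrier F"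
  unfolding quot_algebra_def FactRing_def cls_def by (auto simp: A_RCOSETS_def')

lemma A_one: "\<one>\<^bsub>A\<^esub> = cls (mono [])"
  by (simp add: quot_algebra_def FactRing_def cls_def)

lemma zero_in_class_ideal: "(\<lambda>u. \<zero>) \<in> class_ideal V N"
  unfolding class_ideal_def by (simp add: zero_in_free_algebra)

lemma A_zero: "\<zero>\<^bsub>A\<^esub> = cls (\<lambda>u. \<zero>)"
proof -
  have "abelian_subgroup (class_ideal V N) F"
    using is_ideal by (simp add: abelian_subgroupI3 ideal.axioms(1) free_algebra_ring ring.is_abelian_group)
  then have "cls (\<lambda>u. \<zero>) = class_ideal V N"
    unfolding cls_def using zero_in_class_ideal by (rule abelian_subgroup.a_rcos_const)
  moreover have "\<zero>\<^bsub>A\<^esub> = class_ideal V N" by (simp add: quot_algebra_def FactRing_def)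
  ultimately show ?thesis by (rule trans[OF _ HOL.sym, rotated])
qed

lemma A_add: "f \<in> carrier F \<Longrightarrow> g \<in> carrier F \<Longrightarrow> cls f \<oplus>\<^bsub>A\<^esub> cls g = cls (\<lambda>u. f u \<oplus> g u)"
  using ideal.a_rcos_sum[OF is_ideal, of f g]
  by (simp add: quot_algebra_def FactRing_def cls_def)

lemma A_mult: "f \<in> carrier F \<Longrightarrow> g \<in> carrier F \<Longrightarrow> cls f \<otimes>\<^bsub>A\<^esub> cls g = cls (conv f g)"
  using ideal.rcoset_mult_add[OF is_ideal, of f g]
  by (simp add: quot_algebra_def FactRing_def cls_def)

lemma A_smult:
  assumes "c \<in> carrier R" "f \<in> carrier F"
  shows "c \<odot>\<^bsub>A\<^esub> cls f = cls (\<lambda>u. c \<otimes> f u)"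
proof -
  \<comment> \<open>The scalar action is a union over all representatives of a coset, so every
    representative must give the same coset.\<close>
  have "cls (\<lambda>u. c \<otimes> g u) = cls (\<lambda>u. c \<otimes> f u)" if "g \<in> cls f" for g
  proof -
    have g: "g \<in> carrier F" "cls g = cls f" using that mem_cls_iff[OF assms(2)] by auto
    have "pairing h (\<lambda>u. c \<otimes> g u) = pairing h (\<lambda>u. c \<otimes> f u)" if h: "h \<in> class_functions V N" for h
      using pairing_smult[OF g(1) assms(1) class_functions_closed[OF h]]
        pairing_smult[OF assms(2,1) class_functions_closed[OF h]] g(2) h
      unfolding cls_eq_iff[OF g(1) assms(2)] by simp
    then show ?thesis
      using cls_eq_iff[OF smult_in_free_algebra[OF assms(1) g(1)] smult_in_free_algebra[OF assms]] by simp
  qed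
  moreover have "f \<in> cls f" using mem_cls_iff[OF assms(2)] assms(2) by simp
  ultimately have "(\<Union>g\<in>cls f. cls (\<lambda>u. c \<otimes> g u)) = cls (\<lambda>u. c \<otimes> f u)" by blast
  then show ?thesis by (simp add: quot_algebra_def cls_def)
qed

lemma A_closed:
  "f \<in> carrier F \<Longrightarrow> cls f \<in> carrier A"
  by (simp add: A_carrier)

lemma A_cases:
  assumes "x \<in> carrier A"
  obtains f where "f \<in> carrier F" "x = cls f"
  using assms by (auto simp: A_carrier)

lemma A_abelian_group: "abelian_group A"
proof -
  interpret Fr: ring F by (rule free_algebra_ring)
  note plus = Fr.add.m_closed Fr.a_assoc Fr.a_comm Fr.l_zero Fr.l_neg
  note plus = plus[unfolded free_algebra_simps]
  show ?thesis
  proof (rule abelian_groupI)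
    fix x y z assume "x \<in> carrier A" "y \<in> carrier A" "z \<in> carrier A"
    then obtain f g h where f: "f \<in> carrier F" "x = cls f" and g: "g \<in> carrier F" "y = cls g"
      and h: "h \<in> carrier F" "z = cls h" by (auto elim!: A_cases)
    note fg = add_in_free_algebra[OF f(1) g(1)] and gh = add_in_free_algebra[OF g(1) h(1)]
    show "x \<oplus>\<^bsub>A\<^esub> y \<in> carrier A" unfolding f(2) g(2) A_add[OF f(1) g(1)] using fg by (rule A_closed)
    show "x \<oplus>\<^bsub>A\<^esub> y \<oplus>\<^bsub>A\<^esub> z = x \<oplus>\<^bsub>A\<^esub> (y \<oplus>\<^bsub>A\<^esub> z)"
      unfolding f(2) g(2) h(2) A_add[OF f(1) g(1)] A_add[OF g(1) h(1)] A_add[OF fg h(1)] A_add[OF f(1) gh]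
        plus(2)[OF f(1) g(1) h(1)] ..
    show "x \<oplus>\<^bsub>A\<^esub> y = y \<oplus>\<^bsub>A\<^esub> x"
      unfolding f(2) g(2) A_add[OF f(1) g(1)] A_add[OF g(1) f(1)] plus(3)[OF f(1) g(1)] ..
    show "\<zero>\<^bsub>A\<^esub> \<oplus>\<^bsub>A\<^esub> x = x"
      unfolding f(2) A_zero A_add[OF zero_in_free_algebra f(1)] plus(4)[OF f(1)] ..
    have n: "\<ominus>\<^bsub>F\<^esub> f \<in> carrier F" using f(1) by (rule Fr.a_inv_closed)
    have "cls (\<ominus>\<^bsub>F\<^esub> f) \<oplus>\<^bsub>A\<^esub> x = \<zero>\<^bsub>A\<^esub>"
      unfolding f(2) A_add[OF n f(1)] plus(5)[OF f(1)] A_zero ..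
    then show "\<exists>y\<in>carrier A. y \<oplus>\<^bsub>A\<^esub> x = \<zero>\<^bsub>A\<^esub>" using A_closed[OF n] by blast
  next
    show "\<zero>\<^bsub>A\<^esub> \<in> carrier A" unfolding A_zero using zero_in_free_algebra by (rule A_closed)
  qed
qed

lemma A_ring: "ring A"
proof -
  interpret Fr: ring F by (rule free_algebra_ring)
  have one: "mono [] \<in> carrier F" by (simp add: mono_in_free_algebra)
  note times = Fr.m_assoc Fr.l_one Fr.r_one Fr.l_distr Fr.r_distr
  note times = times[unfolded free_algebra_simps]
  show ?thesis
  proof (rule ringI)
    show "Group.monoid A"
    proof (rule monoidI)
      fix x y z assume "x \<in> carrier A" "y \<in> carrier A" "z \<in> carrier A"
      then obtain f g h where f: "f \<in> carrier F" "x = cls f" and g: "g \<in> carrier F" "y = cls g"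
        and h: "h \<in> carrier F" "z = cls h" by (auto elim!: A_cases)
      note fg = conv_in_free_algebra[OF f(1) g(1)] and gh = conv_in_free_algebra[OF g(1) h(1)]
      show "x \<otimes>\<^bsub>A\<^esub> y \<in> carrier A" unfolding f(2) g(2) A_mult[OF f(1) g(1)] using fg by (rule A_closed)
      show "x \<otimes>\<^bsub>A\<^esub> y \<otimes>\<^bsub>A\<^esub> z = x \<otimes>\<^bsub>A\<^esub> (y \<otimes>\<^bsub>A\<^esub> z)"
        unfolding f(2) g(2) h(2) A_mult[OF f(1) g(1)] A_mult[OF g(1) h(1)] A_mult[OF fg h(1)]
          A_mult[OF f(1) gh] times(1)[OF f(1) g(1) h(1)] ..
      show "\<one>\<^bsub>A\<^esub> \<otimes>\<^bsub>A\<^esub> x = x" "x \<otimes>\<^bsub>A\<^esub> \<one>\<^bsub>A\<^esub> = x"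
        unfolding f(2) A_one A_mult[OF one f(1)] A_mult[OF f(1) one] times(2,3)[OF f(1)] by (rule HOL.refl)+
    next
      show "\<one>\<^bsub>A\<^esub> \<in> carrier A" unfolding A_one using one by (rule A_closed)
    qed
  next
    fix x y z assume "x \<in> carrier A" "y \<in> carrier A" "z \<in> carrier A"
    then obtain f g h where f: "f \<in> carrier F" "x = cls f" and g: "g \<in> carrier F" "y = cls g"
      and h: "h \<in> carrier F" "z = cls h" by (auto elim!: A_cases)
    show "(x \<oplus>\<^bsub>A\<^esub> y) \<otimes>\<^bsub>A\<^esub> z = x \<otimes>\<^bsub>A\<^esub> z \<oplus>\<^bsub>A\<^esub> y \<otimes>\<^bsub>A\<^esub> z"
      unfolding f(2) g(2) h(2) A_add[OF f(1) g(1)] A_mult[OF f(1) h(1)] A_mult[OF g(1) h(1)]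
        A_mult[OF add_in_free_algebra[OF f(1) g(1)] h(1)]
        A_add[OF conv_in_free_algebra[OF f(1) h(1)] conv_in_free_algebra[OF g(1) h(1)]]
        times(4)[OF f(1) g(1) h(1)] ..
    show "z \<otimes>\<^bsub>A\<^esub> (x \<oplus>\<^bsub>A\<^esub> y) = z \<otimes>\<^bsub>A\<^esub> x \<oplus>\<^bsub>A\<^esub> z \<otimes>\<^bsub>A\<^esub> y"
      unfolding f(2) g(2) h(2) A_add[OF f(1) g(1)] A_mult[OF h(1) f(1)] A_mult[OF h(1) g(1)]
        A_mult[OF h(1) add_in_free_algebra[OF f(1) g(1)]]
        A_add[OF conv_in_free_algebra[OF h(1) f(1)] conv_in_free_algebra[OF h(1) g(1)]]
        times(5)[OF f(1) g(1) h(1)] ..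
  qed (rule A_abelian_group)
qed

lemma A_module: "module R A"
proof (rule moduleI)
  fix a b x y assume a: "a \<in> carrier R" and b: "b \<in> carrier R" and "x \<in> carrier A" "y \<in> carrier A"
  then obtain f g where f: "f \<in> carrier F" "x = cls f" and g: "g \<in> carrier F" "y = cls g"
    by (auto elim!: A_cases)
  note af = smult_in_free_algebra[OF a f(1)] and ag = smult_in_free_algebra[OF a g(1)]
    and bf = smult_in_free_algebra[OF b f(1)]
  note cf = coeff_closed[OF f(1)] coeff_closed[OF g(1)]
  show "a \<odot>\<^bsub>A\<^esub> x \<in> carrier A" unfolding f(2) A_smult[OF a f(1)] using af by (rule A_closed)
  have "(\<lambda>u. (a \<oplus> b) \<otimes> f u) = (\<lambda>u. a \<otimes> f u \<oplus> b \<otimes> f u)" using a b cf by (simp add: l_distr)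
  then show "(a \<oplus> b) \<odot>\<^bsub>A\<^esub> x = a \<odot>\<^bsub>A\<^esub> x \<oplus>\<^bsub>A\<^esub> b \<odot>\<^bsub>A\<^esub> x"
    unfolding f(2) A_smult[OF a f(1)] A_smult[OF b f(1)] A_smult[OF a_closed[OF a b] f(1)] A_add[OF af bf]
    by simp
  have "(\<lambda>u. a \<otimes> (f u \<oplus> g u)) = (\<lambda>u. a \<otimes> f u \<oplus> a \<otimes> g u)" using a b cf by (simp add: r_distr)
  then show "a \<odot>\<^bsub>A\<^esub> (x \<oplus>\<^bsub>A\<^esub> y) = a \<odot>\<^bsub>A\<^esub> x \<oplus>\<^bsub>A\<^esub> a \<odot>\<^bsub>A\<^esub> y"
    unfolding f(2) g(2) A_smult[OF a f(1)] A_smult[OF a g(1)] A_add[OF f(1) g(1)]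
      A_smult[OF a add_in_free_algebra[OF f(1) g(1)]] A_add[OF af ag] by simp
  have "(\<lambda>u. (a \<otimes> b) \<otimes> f u) = (\<lambda>u. a \<otimes> (b \<otimes> f u))" using a b cf by (simp add: m_assoc)
  then show "(a \<otimes> b) \<odot>\<^bsub>A\<^esub> x = a \<odot>\<^bsub>A\<^esub> (b \<odot>\<^bsub>A\<^esub> x)"
    unfolding f(2) A_smult[OF b f(1)] A_smult[OF m_closed[OF a b] f(1)] A_smult[OF a bf] by simp
next
  fix x assume "x \<in> carrier A"
  then obtain f where f: "f \<in> carrier F" "x = cls f" by (rule A_cases)
  have "(\<lambda>u. \<one> \<otimes> f u) = f" using coeff_closed[OF f(1)] by simp
  then show "\<one> \<odot>\<^bsub>A\<^esub> x = x" unfolding f(2) A_smult[OF one_closed f(1)] by simp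
qed (rule is_cring, rule A_abelian_group)

lemma A_vectorspace: "vectorspace R A"
  using A_module field_axioms by (rule vectorspace.intro)

sublocale A: vectorspace R A
  by (rule A_vectorspace)

lemma cls_mono_carrier: "set u \<subseteq> V \<Longrightarrow> cls (mono u) \<in> carrier A"
  by (simp add: A_carrier mono_in_free_algebra)

lemma cls_mono_eqI:
  assumes "set u \<subseteq> V" "set v \<subseteq> V" "N u = N v"
  shows "cls (mono u) = cls (mono v)"
proof -
  have "h u = h v" if "h \<in> class_functions V N" for h
    using assms that unfolding class_functions_def by blast
  then have "pairing h (mono u) = pairing h (mono v)" if "h \<in> class_functions V N" for h
    using pairing_mono[OF assms(1) class_functions_closed[OF that]]
      pairing_mono[OF assms(2) class_functions_closed[OF that]] that by simp
  then show ?thesis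
    using cls_eq_iff[OF mono_in_free_algebra[OF assms(1)] mono_in_free_algebra[OF assms(2)]] by simp
qed

lemma cls_mono_zero:
  assumes "set u \<subseteq> V" "N u = None"
  shows "cls (mono u) = \<zero>\<^bsub>A\<^esub>"
proof -
  have "h u = \<zero>" if "h \<in> class_functions V N" for h
    using assms that unfolding class_functions_def by blast
  then have "pairing h (mono u) = pairing h (\<lambda>u. \<zero>)" if "h \<in> class_functions V N" for h
    unfolding pairing_zero pairing_mono[OF assms(1) class_functions_closed[OF that]] using that by blast
  then show ?thesis
    using cls_eq_iff[OF mono_in_free_algebra[OF assms(1)] zero_in_free_algebra] by (simp add: A_zero)
qed

lemma cls_mono_mult:
  "set u \<subseteq> V \<Longrightarrow> set v \<subseteq> V \<Longrightarrow> cls (mono u) \<otimes>\<^bsub>A\<^esub> cls (mono v) = cls (mono (u @ v))"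
  by (simp add: A_mult mono_in_free_algebra conv_mono_mono)

lemma word_val_A: "set u \<subseteq> V \<Longrightarrow> word_val A (\<lambda>x. cls (free_gen R x)) u = cls (mono u)"
proof (induction u)
  case (Cons x u)
  then show ?case using cls_mono_mult[of "[x]" u] by (simp add: word_val_def free_gen_eq_mono)
qed (simp add: word_val_def A_one)

section \<open>Functionals on the quotient, and bases consisting of words\<close>

definition functional :: "('x list \<Rightarrow> 'a) \<Rightarrow> ('x list \<Rightarrow> 'a) set \<Rightarrow> 'a" where
  "functional h U = pairing h (SOME f. f \<in> carrier F \<and> cls f = U)"

text \<open>The representative chosen in \<open>functional\<close> is immaterial, since pairing with
  a class function is constant on cosets.\<close>

lemma functional_cls:
  assumes "h \<in> class_functions V N" "f \<in> carrier F"
  shows "functional h (cls f) = pairing h f"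
proof -
  let ?g = "SOME g. g \<in> carrier F \<and> cls g = cls f"
  have "?g \<in> carrier F \<and> cls ?g = cls f" by (rule someI[of _ f]) (use assms in simp)
  then show ?thesis unfolding functional_def using cls_eq_iff[of ?g f] assms by blast
qed

lemma functional_lincomb:
  assumes h: "h \<in> class_functions V N" and "finite S" "S \<subseteq> carrier A" "a \<in> S \<rightarrow> carrier R"
  shows "functional h (A.lincomb a S) = (\<Oplus>U\<in>S. a U \<otimes> functional h U)"
  using assms(2-4)
proof (induction S)
  case empty
  then show ?case using functional_cls[OF h zero_in_free_algebra] by (simp add: A.lincomb_def A_zero)
next
  case (insert U S)
  have fc: "functional h W \<in> carrier R" if "W \<in> carrier A" for W
    using that functional_cls[OF h] class_functions_closed[OF h] by (auto simp: A_carrier)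
  obtain f where f: "U = cls f" "f \<in> carrier F" using insert.prems by (auto simp: A_carrier)
  have a: "a U \<in> carrier R" "a \<in> S \<rightarrow> carrier R" using insert.prems by auto
  have "A.lincomb a S \<in> carrier A" using insert.prems a by (intro A.lincomb_closed) auto
  then obtain g where g: "A.lincomb a S = cls g" "g \<in> carrier F" by (auto simp: A_carrier)
  have "A.lincomb a (insert U S) = a U \<odot>\<^bsub>A\<^esub> U \<oplus>\<^bsub>A\<^esub> A.lincomb a S"
    using A.lincomb_insert[OF insert.hyps(1), of a U] insert by simp
  also have "\<dots> = cls (\<lambda>u. a U \<otimes> f u \<oplus> g u)"
    using a f g by (simp add: A_smult A_add smult_in_free_algebra)
  finally have "functional h (A.lincomb a (insert U S)) = a U \<otimes> pairing h f \<oplus> pairing h g"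
    using a f g functional_cls[OF h] class_functions_closed[OF h]
    by (simp add: smult_in_free_algebra add_in_free_algebra pairing_add[where V = V] pairing_smult[where V = V])
  also have "pairing h f = functional h U" using functional_cls[OF h f(2)] f(1) by simp
  also have "pairing h g = (\<Oplus>U\<in>S. a U \<otimes> functional h U)"
    using functional_cls[OF h g(2)] g(1) insert a by simp
  also have "a U \<otimes> functional h U \<oplus> \<dots> = (\<Oplus>U\<in>insert U S. a U \<otimes> functional h U)"
    using insert.hyps insert.prems fc by (subst finsum_insert) (auto simp: Pi_iff)
  finally show ?case .
qed

lemma span_words:
  assumes "\<And>u. u \<in> B \<Longrightarrow> set u \<subseteq> V"
    and "\<And>u. set u \<subseteq> V \<Longrightarrow> N u \<noteq> None \<Longrightarrow> \<exists>b\<in>B. N b = N u"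
  shows "A.span ((\<lambda>u. cls (mono u)) ` B) = carrier A"
proof
  let ?S = "(\<lambda>u. cls (mono u)) ` B"
  have S: "?S \<subseteq> carrier A" using assms(1) cls_mono_carrier by auto
  show "A.span ?S \<subseteq> carrier A" using A.span_is_subset2[OF S] .
  have sm: "submodule R (A.span ?S) A" by (rule A.span_is_submodule[OF S])
  have mono: "cls (mono u) \<in> A.span ?S" if u: "set u \<subseteq> V" for u
  proof (cases "N u = None")
    case True
    then show ?thesis using cls_mono_zero[OF u] submodule.zero_closed[OF sm] by simp
  next
    case False
    then obtain b where b: "b \<in> B" "N b = N u" using assms(2)[OF u] by blast
    then have "cls (mono u) = cls (mono b)" using cls_mono_eqI[OF u assms(1)] by simp
    then show ?thesis using A.in_own_span[OF S] b(1) by auto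
  qed
  have "cls f \<in> A.span ?S" if "f \<in> carrier F" for f
    using that
  proof (induction rule: free_algebra_induct)
    case zero
    then show ?case using submodule.zero_closed[OF sm] by (simp add: A_zero)
  next
    case (add f c u)
    have "cls f \<oplus>\<^bsub>A\<^esub> c \<odot>\<^bsub>A\<^esub> cls (mono u) \<in> A.span ?S"
      using submodule.m_closed[OF sm add(4) submodule.smult_closed[OF sm add(2) mono[OF add(3)]]] .
    then show ?case using add
      by (simp add: A_smult A_add mono_in_free_algebra smult_in_free_algebra)
  qed
  then show "carrier A \<subseteq> A.span ?S" by (auto simp: A_carrier)
qed

lemma indicator_class_function:
  "set b \<subseteq> V \<Longrightarrow> N b \<noteq> None \<Longrightarrow> (\<lambda>u. if N u = N b then \<one> else \<zero>) \<in> class_functions V N"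
  by (auto simp: class_functions_def)

lemma functional_indicator:
  assumes "set b \<subseteq> V" "N b \<noteq> None" "set u \<subseteq> V"
  shows "functional (\<lambda>u. if N u = N b then \<one> else \<zero>) (cls (mono u)) = (if N u = N b then \<one> else \<zero>)"
  using functional_cls[OF indicator_class_function[OF assms(1,2)] mono_in_free_algebra[OF assms(3)]]
    pairing_mono[OF assms(3), of "\<lambda>u. if N u = N b then \<one> else \<zero>"] by simp

text \<open>A set with exactly one word for each nonzero class suffices. Words of zero classes
  vanish and equivalent words coincide, which gives spanning; the indicator of a class takes the
  value one on its own word and zero on the others, which gives independence.\<close>

lemma basis_words:
  assumes B: "\<And>u. u \<in> B \<Longrightarrow> set u \<subseteq> V" "\<And>u. u \<in> B \<Longrightarrow> N u \<noteq> None" and inj: "inj_on N B"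
    and span: "\<And>u. set u \<subseteq> V \<Longrightarrow> N u \<noteq> None \<Longrightarrow> \<exists>b\<in>B. N b = N u"
  shows "inj_on (\<lambda>u. cls (mono u)) B" and "A.basis ((\<lambda>u. cls (mono u)) ` B)"
proof -
  let ?S = "(\<lambda>u. cls (mono u)) ` B"
  have eq: "N b = N u" if "b \<in> B" "u \<in> B" "cls (mono u) = cls (mono b)" for b u
    using functional_indicator[OF B(1,2)[OF that(1)] B(1)[OF that(2)]]
      functional_indicator[OF B(1,2)[OF that(1)] B(1)[OF that(1)]] that(3) by (auto split: if_splits)
  show "inj_on (\<lambda>u. cls (mono u)) B"
    by (rule inj_onI, rule inj_onD[OF inj], rule eq) simp_all
  have S: "?S \<subseteq> carrier A" using B(1) cls_mono_carrier by auto
  have "\<not> A.lin_dep ?S"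
  proof
    assume "A.lin_dep ?S"
    then obtain T a U where T: "finite T" "T \<subseteq> ?S" "a \<in> T \<rightarrow> carrier R" "A.lincomb a T = \<zero>\<^bsub>A\<^esub>"
      and U: "U \<in> T" "a U \<noteq> \<zero>" unfolding A.lin_dep_def by blast
    obtain b where b: "b \<in> B" "U = cls (mono b)" using U T by blast
    let ?h = "\<lambda>u. if N u = N b then \<one> else \<zero>"
    have h: "?h \<in> class_functions V N" using indicator_class_function B b(1) by blast
    \<comment> \<open>The functional of the class of \<open>b\<close> picks out the coefficient of
      \<open>U\<close> in any linear combination over \<open>T\<close>.\<close>
    have v: "functional ?h W = (if U = W then \<one> else \<zero>)" if W: "W \<in> T" for W
    proof -
      obtain u where u: "u \<in> B" "W = cls (mono u)" using W T by blast
      have "U = W \<longleftrightarrow> N u = N b"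
      proof
        assume "U = W"
        then show "N u = N b" using eq[OF b(1) u(1)] b(2) u(2) by simp
      next
        assume "N u = N b"
        then have "u = b" by (rule inj_onD[OF inj _ u(1) b(1)])
        then show "U = W" using b(2) u(2) by simp
      qed
      then show ?thesis using functional_indicator[OF B(1,2)[OF b(1)] B(1)[OF u(1)]] u(2) by simp
    qed
    have "\<zero> = functional ?h (A.lincomb a T)"
      using functional_cls[OF h zero_in_free_algebra] T(4) by (simp add: A_zero)
    also have "\<dots> = (\<Oplus>W\<in>T. a W \<otimes> functional ?h W)"
      using T S by (intro functional_lincomb[OF h]) auto
    also have "\<dots> = (\<Oplus>W\<in>T. if U = W then a W else \<zero>)"
      using T(3) v by (intro finsum_cong') (auto simp: Pi_iff)
    also have "\<dots> = a U" using U T by (intro finsum_singleton) auto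
    finally show False using U by simp
  qed
  moreover have "A.span ?S = carrier A" using B(1) span by (rule span_words)
  ultimately show "A.basis ?S" unfolding A.basis_def using S by blast
qed

end

section \<open>Subalgebras generated by some of the letters\<close>

context word_algebra
begin

lemma free_algebra_subset: "V' \<subseteq> V \<Longrightarrow> carrier (free_algebra R V') \<subseteq> carrier F"
  by (intro subsetI) (simp add: free_algebra_carrier, meson order_trans)

lemma cls_generated:
  assumes "unital_subalgebra R A H" "(\<lambda>x. cls (free_gen R x)) ` V' \<subseteq> H" "V' \<subseteq> V"
    and "f \<in> carrier (free_algebra R V')"
  shows "cls f \<in> H"
proof -
  have sr: "subring H A" and sm: "\<And>c x. c \<in> carrier R \<Longrightarrow> x \<in> H \<Longrightarrow> c \<odot>\<^bsub>A\<^esub> x \<in> H"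
    using assms(1) by (auto simp: unital_subalgebra_def)
  have mono: "cls (mono u) \<in> H" if "set u \<subseteq> V'" for u
    using that
  proof (induction u)
    case Nil
    then show ?case using subringE(3)[OF sr] unfolding A_one by simp
  next
    case (Cons x u)
    have "cls (mono [x]) \<otimes>\<^bsub>A\<^esub> cls (mono u) \<in> H"
      using Cons assms(2) by (intro subringE(6)[OF sr]) (auto simp: free_gen_eq_mono)
    moreover have "set [x] \<subseteq> V" "set u \<subseteq> V" using Cons.prems assms(3) by auto
    ultimately show ?case using cls_mono_mult[of "[x]" u] by simp
  qed
  show ?thesis
    using assms(4)
  proof (induction rule: free_algebra_induct)
    case zero
    then show ?case using subringE(2)[OF sr] unfolding A_zero .
  next
    case (add f c u)
    have fF: "f \<in> carrier F" and uV: "set u \<subseteq> V"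
      using add(1,3) free_algebra_subset[OF assms(3)] assms(3) by auto
    have "cls f \<oplus>\<^bsub>A\<^esub> c \<odot>\<^bsub>A\<^esub> cls (mono u) \<in> H"
      by (rule subringE(7)[OF sr add(4) sm[OF add(2) mono[OF add(3)]]])
    then show ?case
      unfolding A_smult[OF add(2) mono_in_free_algebra[OF uV]]
        A_add[OF fF smult_in_free_algebra[OF add(2) mono_in_free_algebra[OF uV]]] .
  qed
qed

lemma cls_image_unital_subalgebra:
  assumes "V' \<subseteq> V"
  shows "unital_subalgebra R A (cls ` carrier (free_algebra R V'))"
proof -
  let ?F' = "free_algebra R V'"
  interpret Fr: ring ?F' by (rule free_algebra_ring)
  note sub = subsetD[OF free_algebra_subset[OF assms]]
  interpret Ar: ring A by (rule A_ring)
  have "subring (cls ` carrier ?F') A"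
  proof (rule Ar.subringI)
    show "cls ` carrier ?F' \<subseteq> carrier A" using sub by (auto simp: A_carrier)
    show "\<one>\<^bsub>A\<^esub> \<in> cls ` carrier ?F'" unfolding A_one using mono_in_free_algebra[of "[]" V'] by simp
  next
    fix x assume "x \<in> cls ` carrier ?F'"
    then obtain f where f: "x = cls f" "f \<in> carrier ?F'" by auto
    have n: "\<ominus>\<^bsub>?F'\<^esub> f \<in> carrier ?F'" using f(2) by (rule Fr.a_inv_closed)
    have "cls (\<ominus>\<^bsub>?F'\<^esub> f) \<oplus>\<^bsub>A\<^esub> x = \<zero>\<^bsub>A\<^esub>"
      unfolding f(1) A_add[OF sub[OF n] sub[OF f(2)]] A_zero
      using Fr.l_neg[OF f(2)] unfolding free_algebra_simps by simp
    then have "\<ominus>\<^bsub>A\<^esub> x = cls (\<ominus>\<^bsub>?F'\<^esub> f)"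
      using A_closed[OF sub[OF n]] A_closed[OF sub[OF f(2)]] f(1)
      by (intro abelian_group.minus_equality[OF A_abelian_group]) simp_all
    then show "\<ominus>\<^bsub>A\<^esub> x \<in> cls ` carrier ?F'" using n by simp
  next
    fix x y assume "x \<in> cls ` carrier ?F'" "y \<in> cls ` carrier ?F'"
    then obtain f g where f: "x = cls f" "f \<in> carrier ?F'" and g: "y = cls g" "g \<in> carrier ?F'" by auto
    show "x \<otimes>\<^bsub>A\<^esub> y \<in> cls ` carrier ?F'"
      unfolding f(1) g(1) A_mult[OF sub[OF f(2)] sub[OF g(2)]] using conv_in_free_algebra[OF f(2) g(2)] by simp
    show "x \<oplus>\<^bsub>A\<^esub> y \<in> cls ` carrier ?F'"
      unfolding f(1) g(1) A_add[OF sub[OF f(2)] sub[OF g(2)]] using add_in_free_algebra[OF f(2) g(2)] by simp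
  qed
  moreover have "c \<odot>\<^bsub>A\<^esub> x \<in> cls ` carrier ?F'" if c: "c \<in> carrier R" and "x \<in> cls ` carrier ?F'" for c x
  proof -
    obtain f where f: "x = cls f" "f \<in> carrier ?F'" using \<open>x \<in> _\<close> by auto
    show ?thesis unfolding f(1) A_smult[OF c sub[OF f(2)]] using smult_in_free_algebra[OF c f(2)] by simp
  qed
  ultimately show ?thesis unfolding unital_subalgebra_def by blast
qed

text \<open>The image of the smaller free algebra is itself a unital subalgebra containing these
  generators, and sums and products of generators exhaust it.\<close>

lemma generated_subalgebra_eq:
  assumes "V' \<subseteq> V"
  shows "generated_subalgebra R A ((\<lambda>x. cls (free_gen R x)) ` V') =
    A\<lparr>carrier := cls ` carrier (free_algebra R V')\<rparr>"
proof -
  let ?S = "(\<lambda>x. cls (free_gen R x)) ` V'"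
  have "?S \<subseteq> cls ` carrier (free_algebra R V')"
    by (auto simp: free_gen_eq_mono mono_in_free_algebra)
  then have "\<Inter>{H. unital_subalgebra R A H \<and> ?S \<subseteq> H} \<subseteq> cls ` carrier (free_algebra R V')"
    using cls_image_unital_subalgebra[OF assms] by blast
  moreover have "cls ` carrier (free_algebra R V') \<subseteq> \<Inter>{H. unital_subalgebra R A H \<and> ?S \<subseteq> H}"
    using cls_generated[OF _ _ assms] by blast
  ultimately show ?thesis unfolding generated_subalgebra_def by (simp add: subset_antisym)
qed

lemma pairing_cong:
  assumes "f \<in> carrier (free_algebra R V')" "\<And>u. h' u \<in> carrier R" "\<And>u. set u \<subseteq> V' \<Longrightarrow> h u = h' u"
  shows "pairing h f = pairing h' f"
  unfolding pairing_def using assms by (intro finsum_cong') (auto simp: free_algebra_carrier)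

text \<open>Since the two partitions agree on words over \<open>V'\<close>, class functions over
  \<open>V\<close> restrict to class functions over \<open>V'\<close>, and conversely those over
  \<open>V'\<close> extend. An element supported on words over \<open>V'\<close> does not see the
  difference.\<close>

lemma class_ideal_restrict:
  assumes "V' \<subseteq> V"
    and iff: "\<And>u v. set u \<subseteq> V' \<Longrightarrow> set v \<subseteq> V' \<Longrightarrow> N u = N v \<longleftrightarrow> N' u = N' v"
    and none: "\<And>u. set u \<subseteq> V' \<Longrightarrow> N u = None \<longleftrightarrow> N' u = None"
    and f: "f \<in> carrier (free_algebra R V')"
  shows "f \<in> class_ideal V' N' \<longleftrightarrow> f \<in> class_ideal V N"
proof
  assume "f \<in> class_ideal V' N'"
  moreover have "h \<in> class_functions V' N'" if "h \<in> class_functions V N" for h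
    unfolding class_functions_def
  proof (intro CollectI conjI allI impI)
    show "h u \<in> carrier R" for u using that by (rule class_functions_closed)
    show "h u = h v" if uv: "set u \<subseteq> V' \<and> set v \<subseteq> V' \<and> N' u = N' v" for u v
    proof -
      have "set u \<subseteq> V" "set v \<subseteq> V" "N u = N v" using uv assms(1) iff[of u v] by auto
      then show ?thesis using \<open>h \<in> class_functions V N\<close> unfolding class_functions_def by blast
    qed
    show "h u = \<zero>" if u: "set u \<subseteq> V' \<and> N' u = None" for u
    proof -
      have "set u \<subseteq> V" "N u = None" using u assms(1) none[of u] by auto
      then show ?thesis using \<open>h \<in> class_functions V N\<close> unfolding class_functions_def by blast
    qed
  qed
  ultimately show "f \<in> class_ideal V N"
    using f free_algebra_subset[OF assms(1)] by (auto simp: class_ideal_def)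
next
  assume fI: "f \<in> class_ideal V N"
  have "pairing h' f = \<zero>" if h': "h' \<in> class_functions V' N'" for h'
  proof -
    define P where "P u v \<longleftrightarrow> set v \<subseteq> V' \<and> N v = N u" for u v
    \<comment> \<open>The extension takes the value of \<open>h'\<close> at any equivalent word over
      \<open>V'\<close>, and zero on classes that contain no such word. The choice is immaterial
      because \<open>N\<close> and \<open>N'\<close> induce the same classes over
      \<open>V'\<close>.\<close>
    define h where "h u = (if \<exists>v. P u v then h' (SOME v. P u v) else \<zero>)" for u
    have P: "P u (SOME v. P u v)" if "P u v" for u v using that by (rule someI)
    have val: "h u = h' v" if "P u v" for u v
    proof -
      let ?w = "SOME v. P u v"
      have "set v \<subseteq> V'" "set ?w \<subseteq> V'" "N ?w = N v" using P[OF that] that by (auto simp: P_def)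
      then have "N' ?w = N' v" using iff by blast
      then have "h' ?w = h' v"
        using h' \<open>set v \<subseteq> V'\<close> \<open>set ?w \<subseteq> V'\<close> unfolding class_functions_def by blast
      moreover have "h u = h' ?w" unfolding h_def using that by (intro if_P) blast
      ultimately show ?thesis by simp
    qed
    have "h \<in> class_functions V N"
      unfolding class_functions_def
    proof (intro CollectI conjI allI impI)
      show "h u \<in> carrier R" for u using class_functions_closed[OF h'] by (simp add: h_def)
      show "h u = h v" if "set u \<subseteq> V \<and> set v \<subseteq> V \<and> N u = N v" for u v
      proof -
        have "P u = P v" using that by (simp add: P_def fun_eq_iff)
        then show ?thesis unfolding h_def by (simp only:)
      qed
      show "h u = \<zero>" if u: "set u \<subseteq> V \<and> N u = None" for u
      proof (cases "\<exists>v. P u v")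
        case True
        then obtain v where v: "P u v" by blast
        then have "set v \<subseteq> V'" "N v = None" using u by (auto simp: P_def)
        then have "h' v = \<zero>" using h' none unfolding class_functions_def by blast
        then show ?thesis using val[OF v] by simp
      qed (simp add: h_def)
    qed
    then have "pairing h f = \<zero>" using fI unfolding class_ideal_def by blast
    moreover have "pairing h f = pairing h' f"
      using val by (intro pairing_cong[OF f class_functions_closed[OF h']]) (simp add: P_def)
    ultimately show ?thesis by simp
  qed
  then show "f \<in> class_ideal V' N'" using f unfolding class_ideal_def by blast
qed

lemma subalgebra_iso:
  fixes N' :: "'x list \<Rightarrow> 'c option"
  assumes "V' \<subseteq> V" "word_congruence V' N'"
    and iff: "\<And>u v. set u \<subseteq> V' \<Longrightarrow> set v \<subseteq> V' \<Longrightarrow> N u = N v \<longleftrightarrow> N' u = N' v"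
    and none: "\<And>u. set u \<subseteq> V' \<Longrightarrow> N u = None \<longleftrightarrow> N' u = None"
  shows "algebra_isos R (generated_subalgebra R A ((\<lambda>x. cls (free_gen R x)) ` V'))
    (quot_algebra (free_algebra R V') (class_ideal V' N')) \<noteq> {}"
proof -
  interpret W: word_algebra R V' N' by unfold_locales (rule assms(2))
  \<comment> \<open>A coset of the large ideal that has a representative in the smaller free algebra
    meets it in exactly one coset of the small ideal. Intersecting therefore gives the isomorphism
    without choosing representatives.\<close>
  let ?\<psi> = "\<lambda>U. U \<inter> carrier W.F"
  note sub = subsetD[OF free_algebra_subset[OF assms(1)]]
  have restrict: "f \<in> class_ideal V' N' \<longleftrightarrow> f \<in> class_ideal V N" if "f \<in> carrier W.F" for f
    by (rule class_ideal_restrict[OF assms(1)]) (fact iff, fact none, fact that)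
  have eq: "cls f = cls g \<longleftrightarrow> W.cls f = W.cls g" if "f \<in> carrier W.F" "g \<in> carrier W.F" for f g
    unfolding cls_eq_iff_ideal[OF sub[OF that(1)] sub[OF that(2)]] W.cls_eq_iff_ideal[OF that]
    using restrict[OF W.minus_in_free_algebra[OF that]] by simp
  have psi: "?\<psi> (cls f) = W.cls f" if "f \<in> carrier W.F" for f
  proof (rule Set.set_eqI)
    fix g
    show "g \<in> cls f \<inter> carrier W.F \<longleftrightarrow> g \<in> W.cls f"
    proof (cases "g \<in> carrier W.F")
      case True
      then show ?thesis
        unfolding Int_iff mem_cls_iff[OF sub[OF that]] W.mem_cls_iff[OF that] eq[OF True that]
        using sub[OF True] by simp
    next
      case False
      then show ?thesis using W.mem_cls_iff[OF that] by simp
    qed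
  qed
  let ?B = "A\<lparr>carrier := cls ` carrier W.F\<rparr>"
  have iso: "?\<psi> \<in> ring_iso ?B W.A"
  proof (rule ring_iso_memI)
    fix x y assume "x \<in> carrier ?B" "y \<in> carrier ?B"
    then obtain f g where f: "x = cls f" "f \<in> carrier W.F" and g: "y = cls g" "g \<in> carrier W.F" by auto
    show "?\<psi> x \<in> carrier W.A" unfolding f(1) psi[OF f(2)] using f(2) by (rule W.A_closed)
    have "?\<psi> (cls f \<otimes>\<^bsub>A\<^esub> cls g) = W.cls f \<otimes>\<^bsub>W.A\<^esub> W.cls g"
      unfolding A_mult[OF sub[OF f(2)] sub[OF g(2)]] W.A_mult[OF f(2) g(2)]
        psi[OF conv_in_free_algebra[OF f(2) g(2)]] ..
    then show "?\<psi> (x \<otimes>\<^bsub>?B\<^esub> y) = ?\<psi> x \<otimes>\<^bsub>W.A\<^esub> ?\<psi> y"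
      unfolding f(1) g(1) psi[OF f(2)] psi[OF g(2)] by simp
    have "?\<psi> (cls f \<oplus>\<^bsub>A\<^esub> cls g) = W.cls f \<oplus>\<^bsub>W.A\<^esub> W.cls g"
      unfolding A_add[OF sub[OF f(2)] sub[OF g(2)]] W.A_add[OF f(2) g(2)]
        psi[OF add_in_free_algebra[OF f(2) g(2)]] ..
    then show "?\<psi> (x \<oplus>\<^bsub>?B\<^esub> y) = ?\<psi> x \<oplus>\<^bsub>W.A\<^esub> ?\<psi> y"
      unfolding f(1) g(1) psi[OF f(2)] psi[OF g(2)] by simp
  next
    have "mono [] \<in> carrier W.F" by (simp add: mono_in_free_algebra)
    from psi[OF this] show "?\<psi> \<one>\<^bsub>?B\<^esub> = \<one>\<^bsub>W.A\<^esub>" by (simp add: A_one W.A_one)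
  next
    have "inj_on ?\<psi> (cls ` carrier W.F)"
    proof (rule inj_onI)
      fix x y assume "x \<in> cls ` carrier W.F" "y \<in> cls ` carrier W.F" and e: "?\<psi> x = ?\<psi> y"
      then obtain f g where f: "x = cls f" "f \<in> carrier W.F" and g: "y = cls g" "g \<in> carrier W.F" by auto
      show "x = y" using e eq[OF f(2) g(2)] unfolding f(1) g(1) psi[OF f(2)] psi[OF g(2)] by simp
    qed
    moreover have "?\<psi> ` cls ` carrier W.F = carrier W.A"
      unfolding W.A_carrier image_image using psi by (intro image_cong) simp_all
    ultimately show "bij_betw ?\<psi> (carrier ?B) (carrier W.A)" by (simp add: bij_betw_def)
  qed
  moreover have "?\<psi> \<in> module_hom R ?B W.A"
  proof -
    have "?\<psi> (c \<odot>\<^bsub>A\<^esub> x) = c \<odot>\<^bsub>W.A\<^esub> ?\<psi> x" if c: "c \<in> carrier R" and x: "x \<in> cls ` carrier W.F" for c x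
    proof -
      obtain f where f: "x = cls f" "f \<in> carrier W.F" using x by auto
      show ?thesis unfolding f(1) psi[OF f(2)] A_smult[OF c sub[OF f(2)]] W.A_smult[OF c f(2)]
          psi[OF smult_in_free_algebra[OF c f(2)]] ..
    qed
    then show ?thesis using ring_iso_memE(1,3)[OF iso] by (auto simp: module_hom_def)
  qed
  ultimately show ?thesis unfolding generated_subalgebra_eq[OF assms(1)] algebra_isos_def by blast
qed

end

section \<open>The algebra \<open>NC\<^sub>A(n,d)\<close>\<close>

lemma run_eq_braid_eq:
  assumes "d \<ge> 2" "set u \<subseteq> {1..n}" "set v \<subseteq> {1..n}" "run n d u start = Some s" "run n d v start = Some s"
  shows "braid_eq n u v"
proof -
  have "braid_eq n u (nf n s)" using run_nf_cases[OF assms(1,2)] assms(4) by simp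
  moreover have "braid_eq n v (nf n s)" using run_nf_cases[OF assms(1,3)] assms(5) by simp
  ultimately show ?thesis by (rule braid_eq.chain[OF _ braid_eq.flip])
qed

text \<open>Compatibility with letters on the left is immediate, since they act after the word. On
  the right, equality of states reached from \<open>start\<close> has to be transported to other
  states: words with a common state are braid equivalent, and words that give zero are
  \<open>nil_word\<close>, and both properties determine the action on every state.\<close>

lemma run_congruence:
  assumes "n \<ge> 1" "d \<ge> 2"
  shows "word_congruence {1..n} (\<lambda>u. run n d u start)"
proof -
  have st: "t \<in> states n d" if "set x \<subseteq> {1..n}" "run n d x start = Some t" for x t
    by (rule run_states[OF assms(2) start_state[OF assms(2)] that])
  have nil: "run n d (u @ x) start = None" if "set x \<subseteq> {1..n}" "set u \<subseteq> {1..n}" "run n d u start = None" for x u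
  proof (cases "run n d x start")
    case (Some t)
    have "nil_word n d u" using run_nf_cases[OF assms(2) that(2)] that(3) by simp
    then have "run n d u t = None" by (rule run_nil_word[OF assms st[OF that(1) Some] _ that(2)])
    then show ?thesis by (simp add: run_append Some)
  qed (simp add: run_append)
  have cong: "run n d (u @ x) start = run n d (v @ x) start"
    if x: "set x \<subseteq> {1..n}" and u: "set u \<subseteq> {1..n}" and v: "set v \<subseteq> {1..n}"
      and e: "run n d u start = run n d v start" for x u v
  proof (cases "run n d u start")
    case None
    then show ?thesis using nil[OF x u] nil[OF x v] e by simp
  next
    case (Some s)
    then have "braid_eq n u v" using run_eq_braid_eq[OF assms(2) u v] e by simp
    then have "run n d u t = run n d v t" if "run n d x start = Some t" for t
      using run_braid_eq[OF assms(2) st[OF x that] _ u] by blast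
    then show ?thesis by (cases "run n d x start") (simp_all add: run_append)
  qed
  show ?thesis
    unfolding word_congruence_def
  proof (intro conjI allI impI; elim conjE)
    fix x u v assume x: "set x \<subseteq> {1..n}" and u: "set u \<subseteq> {1..n}" and v: "set v \<subseteq> {1..n}"
      and e: "run n d u start = run n d v start"
    show "run n d (x @ u) start = run n d (x @ v) start" unfolding run_append e ..
    show "run n d (u @ x) start = run n d (v @ x) start" by (rule cong[OF x u v e])
  next
    fix x u assume x: "set x \<subseteq> {1..n}" and u: "set u \<subseteq> {1..n}" and e: "run n d u start = None"
    show "run n d (x @ u) start = None" unfolding run_append e by simp
    show "run n d (u @ x) start = None" by (rule nil[OF x u e])
  qed
qed

context word_algebra
begin

lemma mono_minus_in_class_ideal:
  assumes "set u \<subseteq> V" "set v \<subseteq> V" "N u = N v"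
  shows "(\<lambda>w. mono u w \<ominus> mono v w) \<in> class_ideal V N"
  using cls_mono_eqI[OF assms]
  unfolding cls_eq_iff_ideal[OF mono_in_free_algebra[OF assms(1)] mono_in_free_algebra[OF assms(2)]] .

lemma mono_in_class_ideal:
  assumes "set u \<subseteq> V" "N u = None"
  shows "mono u \<in> class_ideal V N"
proof -
  have "(\<lambda>w. mono u w \<ominus> \<zero>) \<in> class_ideal V N"
    using cls_mono_zero[OF assms]
    unfolding A_zero cls_eq_iff_ideal[OF mono_in_free_algebra[OF assms(1)] zero_in_free_algebra] .
  then show ?thesis by (simp add: a_minus_def)
qed

end

section \<open>The ideal generated by the relators\<close>

context cring
begin

lemma free_gen_pow: "free_gen R x [^]\<^bsub>free_algebra R V\<^esub> (k::nat) = mono (replicate k x)"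
  by (induction k) (simp_all add: free_gen_eq_mono conv_mono_mono replicate_append_same)

text \<open>This brings the reduction to normal forms into the algebra: two words with the same
  state differ by braid and commutation moves, a word that gives zero contains a vanishing factor up
  to such moves, and \<open>I\<close> contains what each of these needs.\<close>

lemma class_ideal_least_braid:
  assumes d: "d \<ge> 2" and I: "ideal I (free_algebra R {1..n})"
    and braid: "\<And>i. 0 < i \<Longrightarrow> i < n \<Longrightarrow> (\<lambda>w. mono [i, Suc i, i] w \<ominus> mono [Suc i, i, Suc i] w) \<in> I"
    and comm: "\<And>i j. i \<in> {1..n} \<Longrightarrow> j \<in> {1..n} \<Longrightarrow> Suc i < j \<Longrightarrow> (\<lambda>w. mono [i, j] w \<ominus> mono [j, i] w) \<in> I"
    and square: "\<And>i. 0 < i \<Longrightarrow> i < n \<Longrightarrow> mono [i, i] \<in> I"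
    and power: "mono (replicate d n) \<in> I"
  shows "class_ideal {1..n} (\<lambda>u. run n d u start) \<subseteq> I"
proof -
  let ?V = "{1..n}"
  let ?F = "free_algebra R ?V"
  \<comment> \<open>Passing to cosets turns congruence modulo \<open>I\<close> into equality. As
    \<open>q\<close> is multiplicative, a single relation can then be applied inside any
    word.\<close>
  define q where "q u = I +>\<^bsub>?F\<^esub> mono u" for u
  have sg: "abelian_subgroup I ?F"
    using I by (simp add: abelian_subgroupI3 ideal.axioms(1) free_algebra_ring ring.is_abelian_group)
  have mF: "mono u \<in> carrier ?F" if "set u \<subseteq> ?V" for u using that by (rule mono_in_free_algebra)
  have qI: "(\<lambda>w. mono u w \<ominus> mono v w) \<in> I \<longleftrightarrow> q u = q v" if "set u \<subseteq> ?V" "set v \<subseteq> ?V" for u v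
    using ring.quotient_eq_iff_same_a_r_cos[OF free_algebra_ring I mF[OF that(1)] mF[OF that(2)]]
    unfolding free_algebra_minus[OF mF[OF that(1)] mF[OF that(2)]] q_def .
  have q_append: "q (u @ v) = rcoset_mult ?F I (q u) (q v)" if "set u \<subseteq> ?V" "set v \<subseteq> ?V" for u v
    using ideal.rcoset_mult_add[OF I mF[OF that(1)] mF[OF that(2)]]
    unfolding q_def free_algebra_simps conv_mono_mono by (rule HOL.sym)
  have q_context: "q (x @ z @ y) = q (x @ z' @ y)"
    if "set (x @ z @ y) \<subseteq> ?V" "set z' \<subseteq> ?V" "q z = q z'" for x y z z'
  proof -
    have s: "set x \<subseteq> ?V" "set y \<subseteq> ?V" "set z \<subseteq> ?V" "set (z @ y) \<subseteq> ?V" "set (z' @ y) \<subseteq> ?V" using that by auto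
    show ?thesis
      unfolding q_append[OF s(1,4)] q_append[OF s(1,5)] q_append[OF s(3,2)] q_append[OF that(2) s(2)] that(3) ..
  qed
  have eq: "q u = q v" if "braid_eq n u v" "set u \<subseteq> ?V" for u v
    using that
  proof (induction rule: braid_eq.induct)
    case (flip u v)
    then show ?case using braid_eq_set[OF flip.hyps] by metis
  next
    case (chain u v w)
    then show ?case using braid_eq_set[OF chain.hyps(1)] by metis
  next
    case (braid i x y)
    have "set [i, Suc i, i] \<subseteq> ?V" "set [Suc i, i, Suc i] \<subseteq> ?V" using braid.hyps by auto
    then show ?case using q_context[OF braid.prems] qI assms(3)[OF braid.hyps] by blast
  next
    case (commute i j x y)
    have "set [i, j] \<subseteq> ?V" "set [j, i] \<subseteq> ?V" using commute.hyps by auto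
    then show ?case using q_context[OF commute.prems] qI assms(4)[OF commute.hyps] by blast
  qed (rule HOL.refl)
  have q_mem: "mono u \<in> I \<longleftrightarrow> q u = I" if "set u \<subseteq> ?V" for u
  proof
    assume "mono u \<in> I"
    then show "q u = I" unfolding q_def by (rule abelian_subgroup.a_rcos_const[OF sg])
  next
    assume "q u = I"
    then show "mono u \<in> I" using abelian_subgroup.a_rcos_self[OF sg mF[OF that]] by (simp add: q_def)
  qed
  have nil: "mono u \<in> I" if nw: "nil_word n d u" and u: "set u \<subseteq> ?V" for u
  proof -
    obtain x z y where e: "braid_eq n u (x @ z @ y)"
      and z: "z = replicate d n \<or> (\<exists>i\<in>{1..<n}. z = [i, i])"
      using nw unfolding nil_word_def by blast
    have s: "set (x @ z @ y) \<subseteq> ?V" using braid_eq_set[OF e] u by simp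
    then have sx: "set x \<subseteq> ?V" "set y \<subseteq> ?V" by auto
    have "mono z \<in> I" using z square power by auto
    then have "conv (mono z) (mono y) \<in> I"
      using ideal.I_r_closed[OF I _ mF[OF sx(2)], of "mono z"] by simp
    then have "conv (mono x) (conv (mono z) (mono y)) \<in> I"
      using ideal.I_l_closed[OF I _ mF[OF sx(1)]] by simp
    then have "mono (x @ z @ y) \<in> I" by (simp add: conv_mono_mono)
    then show ?thesis using q_mem[OF u] q_mem[OF s] eq[OF e u] by simp
  qed
  show ?thesis
  proof (rule class_ideal_least[OF I])
    fix u assume u: "set u \<subseteq> ?V"
    show none: "mono u \<in> I" if "run n d u start = None"
      using nil[OF _ u] run_nf_cases[OF d u] that by simp
  next
    fix u v assume u: "set u \<subseteq> ?V" and v: "set v \<subseteq> ?V" and e: "run n d u start = run n d v start"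
    have "q u = q v"
    proof (cases "run n d u start")
      case None
      then have "mono u \<in> I" "mono v \<in> I"
        using nil[OF _ u] run_nf_cases[OF d u] nil[OF _ v] run_nf_cases[OF d v] e by simp_all
      then show ?thesis using q_mem[OF u] q_mem[OF v] by simp
    next
      case (Some s)
      show ?thesis by (rule eq[OF run_eq_braid_eq[OF d u v Some] u]) (use Some e in simp)
    qed
    then show "(\<lambda>w. mono u w \<ominus> mono v w) \<in> I" unfolding qI[OF u v] .
  qed
qed

lemma NC_A_relators_eq:
  assumes "n \<ge> 1"
  shows "NC_A_relators R n d =
    {(\<lambda>w. mono [i, Suc i, i] w \<ominus> mono [Suc i, i, Suc i] w) | i. 0 < i \<and> i < n} \<union>
    {(\<lambda>w. mono [i, j] w \<ominus> mono [j, i] w) | i j. i \<in> {1..n} \<and> j \<in> {1..n} \<and> \<bar>int i - int j\<bar> > 1} \<union>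
    {mono [i, i] | i. 1 \<le> i \<and> i < n} \<union> {mono (replicate d n)}"
proof -
  let ?F = "free_algebra R {1..n}"
  let ?t = "free_gen R"
  have braid: "(?t i \<otimes>\<^bsub>?F\<^esub> ?t (i+1) \<otimes>\<^bsub>?F\<^esub> ?t i) \<ominus>\<^bsub>?F\<^esub> (?t (i+1) \<otimes>\<^bsub>?F\<^esub> ?t i \<otimes>\<^bsub>?F\<^esub> ?t (i+1)) =
      (\<lambda>w. mono [i, Suc i, i] w \<ominus> mono [Suc i, i, Suc i] w)" if "0 < i \<and> i < n" for i
    using that by (simp add: free_gen_eq_mono conv_mono_mono)
      (intro free_algebra_minus mono_in_free_algebra; simp)
  have comm: "(?t i \<otimes>\<^bsub>?F\<^esub> ?t j) \<ominus>\<^bsub>?F\<^esub> (?t j \<otimes>\<^bsub>?F\<^esub> ?t i) = (\<lambda>w. mono [i, j] w \<ominus> mono [j, i] w)"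
    if "i \<in> {1..n} \<and> j \<in> {1..n} \<and> \<bar>int i - int j\<bar> > 1" for i j
    using that by (simp add: free_gen_eq_mono conv_mono_mono)
      (intro free_algebra_minus mono_in_free_algebra; simp)
  have square: "?t i [^]\<^bsub>?F\<^esub> (2::nat) = mono [i, i]" for i
    unfolding free_gen_pow by (simp add: numeral_2_eq_2)
  have 1: "{(?t i \<otimes>\<^bsub>?F\<^esub> ?t (i+1) \<otimes>\<^bsub>?F\<^esub> ?t i) \<ominus>\<^bsub>?F\<^esub> (?t (i+1) \<otimes>\<^bsub>?F\<^esub> ?t i \<otimes>\<^bsub>?F\<^esub> ?t (i+1)) | i. 0 < i \<and> i < n} =
      {(\<lambda>w. mono [i, Suc i, i] w \<ominus> mono [Suc i, i, Suc i] w) | i. 0 < i \<and> i < n}"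
    using braid by (metis (no_types, lifting))
  have 2: "{(?t i \<otimes>\<^bsub>?F\<^esub> ?t j) \<ominus>\<^bsub>?F\<^esub> (?t j \<otimes>\<^bsub>?F\<^esub> ?t i) | i j.
        i \<in> {1..n} \<and> j \<in> {1..n} \<and> \<bar>int i - int j\<bar> > 1} =
      {(\<lambda>w. mono [i, j] w \<ominus> mono [j, i] w) | i j. i \<in> {1..n} \<and> j \<in> {1..n} \<and> \<bar>int i - int j\<bar> > 1}"
    using comm by (metis (no_types, lifting))
  show ?thesis
    unfolding NC_A_relators_def braid_relators_def Let_def 1 2 square unfolding free_gen_pow ..
qed

end

context field
begin

text \<open>The relations satisfied by the action put the relators into the class ideal; the
  reduction of words to normal forms gives the other inclusion through
  \<open>class_ideal_least_braid\<close>.\<close>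

lemma genideal_NC_A_relators:
  assumes n: "n \<ge> 1" and d: "d \<ge> 2"
  shows "Idl\<^bsub>free_algebra R {1..n}\<^esub> (NC_A_relators R n d) = class_ideal {1..n} (\<lambda>u. run n d u start)"
proof -
  interpret W: word_algebra R "{1..n}" "\<lambda>u. run n d u start"
    by unfold_locales (rule run_congruence[OF n d])
  let ?F = "free_algebra R {1..n}"
  have sub: "NC_A_relators R n d \<subseteq> class_ideal {1..n} (\<lambda>u. run n d u start)"
  proof -
    have "(\<lambda>w. mono [i, Suc i, i] w \<ominus> mono [Suc i, i, Suc i] w) \<in> class_ideal {1..n} (\<lambda>u. run n d u start)"
      if "0 < i \<and> i < n" for i
      using that run_braid[OF start_state[OF d], of i n] by (intro W.mono_minus_in_class_ideal) auto
    moreover have "(\<lambda>w. mono [i, j] w \<ominus> mono [j, i] w) \<in> class_ideal {1..n} (\<lambda>u. run n d u start)"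
      if "i \<in> {1..n} \<and> j \<in> {1..n} \<and> \<bar>int i - int j\<bar> > 1" for i j
    proof -
      have "Suc i < j \<or> Suc j < i" using that by linarith
      then have "run n d [i, j] start = run n d [j, i] start"
        using run_comm[of i j n d start] run_comm[of j i n d start] that by auto
      then show ?thesis using that by (intro W.mono_minus_in_class_ideal) auto
    qed
    moreover have "mono [i, i] \<in> class_ideal {1..n} (\<lambda>u. run n d u start)" if "1 \<le> i \<and> i < n" for i
      using that run_square[of i n d start] by (intro W.mono_in_class_ideal) auto
    moreover have "mono (replicate d n) \<in> class_ideal {1..n} (\<lambda>u. run n d u start)"
      using n run_power[OF n d start_state[OF d]] by (intro W.mono_in_class_ideal) auto
    ultimately show ?thesis unfolding NC_A_relators_eq[OF n] by blast
  qed
  have subF: "NC_A_relators R n d \<subseteq> carrier ?F"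
    using sub by (auto simp: class_ideal_def)
  have I: "ideal (Idl\<^bsub>?F\<^esub> (NC_A_relators R n d)) ?F"
    by (rule ring.genideal_ideal[OF free_algebra_ring subF])
  have mem: "r \<in> Idl\<^bsub>?F\<^esub> (NC_A_relators R n d)" if "r \<in> NC_A_relators R n d" for r
    using ring.genideal_self[OF free_algebra_ring subF] that by blast
  show ?thesis
  proof
    show "Idl\<^bsub>?F\<^esub> (NC_A_relators R n d) \<subseteq> class_ideal {1..n} (\<lambda>u. run n d u start)"
      by (rule ring.genideal_minimal[OF free_algebra_ring W.is_ideal sub])
    show "class_ideal {1..n} (\<lambda>u. run n d u start) \<subseteq> Idl\<^bsub>?F\<^esub> (NC_A_relators R n d)"
    proof (rule class_ideal_least_braid[OF d I])
      fix i j assume "i \<in> {1..n}" "j \<in> {1..n}" "Suc i < j"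
      then have "i \<in> {1..n} \<and> j \<in> {1..n} \<and> \<bar>int i - int j\<bar> > 1" by simp
      then show "(\<lambda>w. mono [i, j] w \<ominus> mono [j, i] w) \<in> Idl\<^bsub>?F\<^esub> (NC_A_relators R n d)"
        by (intro mem) (unfold NC_A_relators_eq[OF n], blast)
    next
      fix i assume "0 < i" "i < n"
      then have i: "0 < i \<and> i < n" "1 \<le> i \<and> i < n" by simp_all
      then show "(\<lambda>w. mono [i, Suc i, i] w \<ominus> mono [Suc i, i, Suc i] w) \<in> Idl\<^bsub>?F\<^esub> (NC_A_relators R n d)"
        by (intro mem) (unfold NC_A_relators_eq[OF n], blast)
      show "mono [i, i] \<in> Idl\<^bsub>?F\<^esub> (NC_A_relators R n d)"
        using i by (intro mem) (unfold NC_A_relators_eq[OF n], blast)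
    next
      show "mono (replicate d n) \<in> Idl\<^bsub>?F\<^esub> (NC_A_relators R n d)"
        by (intro mem) (unfold NC_A_relators_eq[OF n], blast)
    qed
  qed
qed

end

text \<open>For \<open>d = 2\<close> the last generator is no longer special, so everything proved
  for \<open>NC_A\<close> applies to the nil-Coxeter algebra.\<close>

lemma nil_Coxeter_A_eq_NC_A:
  assumes "l \<ge> 1"
  shows "nil_Coxeter_A K l = NC_A K l 2"
proof -
  let ?p = "\<lambda>i. free_gen K i [^]\<^bsub>free_algebra K {1..l}\<^esub> (2::nat)"
  have "{?p i | i. 1 \<le> i \<and> i \<le> l} = {?p i | i. 1 \<le> i \<and> i < l} \<union> {?p l}"
    using assms by (auto simp: le_less)
  then show ?thesis
    unfolding nil_Coxeter_A_def NC_A_def NC_A_relators_def Let_def by (simp add: Un_assoc)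
qed

lemma unflat_flat:
  assumes "q permutes {1..Suc n}"
  shows "unflat n (q (Suc n)) (flat n q) = q"
proof
  fix x
  consider "x \<in> {1..n}" | "x = Suc n" | "x \<notin> {1..Suc n}" by fastforce
  then show "unflat n (q (Suc n)) (flat n q) x = q x"
  proof cases
    case 1
    then have "q x \<noteq> q (Suc n)" using permutes_interval_neq[OF assms] by auto
    then show ?thesis using 1 by (auto simp: unflat_def flat_def)
  next
    case 2
    then show ?thesis by (simp add: unflat_def)
  next
    case 3
    then show ?thesis using permutes_not_in[OF assms] by (auto simp: unflat_def)
  qed
qed

lemma word_val_sym_group: "word_val (sym_group n) simple_reflection u = word_perm u"
  by (induction u) (simp_all add: word_val_def simple_reflection_def sym_group_def)

text \<open>If a reduced word gave zero, \<open>not_reduced\<close> would provide a shorter word of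
  the same permutation. The state reached carries the inverse of \<open>w\<close>, so it is the same
  for all reduced words of \<open>w\<close>; this yields the independence of \<open>T_w\<close> from
  the choice.\<close>

lemma reduced_expression_run:
  assumes "n \<ge> 1" "d \<ge> 2" "w permutes {1..n}" "reduced_expression n w u"
  shows "set u \<subseteq> {1..n}" "run n d u start = Some (inv_into UNIV w, 0)"
proof -
  have u: "set u \<subseteq> {1..<n}" and w: "word_perm u = w"
    and min: "\<And>v. set v \<subseteq> {1..<n} \<Longrightarrow> word_perm v = w \<Longrightarrow> length u \<le> length v"
    using assms(4) by (auto simp: reduced_expression_def word_val_sym_group)
  show "set u \<subseteq> {1..n}" using u by fastforce
  have "run n d u start \<noteq> None"
  proof
    assume "run n d u start = None"
    from not_reduced[OF assms(2,1) u this] show False using min w by fastforce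
  qed
  then obtain q k where r: "run n d u start = Some (q, k)" by auto
  then have "k = 0" and qw: "q \<circ> w = id" using run_word_perm[OF u r] w by auto
  have "q = inv_into UNIV w"
  proof
    fix x
    have "q (w (inv_into UNIV w x)) = inv_into UNIV w x" using fun_cong[OF qw] by simp
    then show "q x = inv_into UNIV w x" using permutes_inverses(1)[OF assms(3)] by simp
  qed
  then show "run n d u start = Some (inv_into UNIV w, 0)" using r \<open>k = 0\<close> by simp
qed

text \<open>The normal form of the inverse of \<open>w\<close> is some word of \<open>w\<close> in
  the letters below \<open>n\<close>, and among all such words one has minimal length.\<close>

lemma reduced_expression_exists:
  assumes "n \<ge> 1" "w permutes {1..n}"
  shows "\<exists>u. reduced_expression n w u"
proof -
  let ?q = "inv_into UNIV w"
  have q: "?q permutes {1..n}" by (rule permutes_inv[OF assms(2)])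
  let ?P = "\<lambda>v. set v \<subseteq> {1..<n} \<and> word_perm v = w"
  let ?u = "nf n (?q, 0)"
  have s: "set ?u \<subseteq> {1..<n}" unfolding nf_zero[OF q] by (rule perm_word_set[OF q])
  have "(?q, 0) \<in> states n 2" using q by (simp add: state_zero_iff)
  then have "run n 2 ?u start = Some (?q, 0)" using run_nf assms(1) by simp
  then have qu: "?q \<circ> word_perm ?u = id" using run_word_perm[OF s] by blast
  have "word_perm ?u x = w x" for x
  proof -
    have "?q (word_perm ?u x) = x" using fun_cong[OF qu, of x] by (simp only: comp_apply id_apply)
    then show ?thesis using permutes_inverses(1)[OF assms(2), of "word_perm ?u x"] by (simp only:)
  qed
  then have "?P ?u" using s by auto
  then have "\<exists>u. ?P u \<and> (\<forall>v. ?P v \<longrightarrow> length u \<le> length v)"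
    using ex_has_least_nat[of ?P ?u length] by blast
  then show ?thesis by (auto simp: reduced_expression_def word_val_sym_group)
qed

theorem theorem1p3:
  fixes K :: "('k, 'm) ring_scheme" and n d :: nat
  assumes "field K" and "n \<ge> 1" and "d \<ge> 2"
  shows
   "let A = NC_A K n d;
        T = NC_A_gen K n d;
        S = carrier (sym_group n);
        Tw = T_perm A T n;
        Twkm = (\<lambda>(w, k :: nat, m).
          Tw w \<otimes>\<^bsub>A\<^esub> T n [^]\<^bsub>A\<^esub> k \<otimes>\<^bsub>A\<^esub> word_val A T (rev [m..<n]));
        J = S \<times> {1..d - 1} \<times> {1..n}
    in vectorspace K A
     \<and> (\<forall>w\<in>S. \<forall>u. reduced_expression n w u \<longrightarrow> word_val A T u = Tw w)
     \<and> vectorspace.basis K A (Tw ` S \<union> Twkm ` J)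
     \<and> inj_on Tw S \<and> inj_on Twkm J \<and> Tw ` S \<inter> Twkm ` J = {}
     \<and> card (Tw ` S \<union> Twkm ` J) = fact n * (1 + n * (d - 1))
     \<and> (\<forall>l. 0 < l \<and> l < n \<longrightarrow>
          algebra_isos K (generated_subalgebra K A (T ` {1..l})) (nil_Coxeter_A K l) \<noteq> {})"
proof -
  note n = assms(2) and d = assms(3)
  let ?N = "\<lambda>u. run n d u start"
  interpret W: word_algebra K "{1..n}" ?N
    using assms(1) by (intro word_algebra.intro word_algebra_axioms.intro run_congruence[OF n d])
  have ideal: "Idl\<^bsub>free_algebra K {1..n}\<^esub> (NC_A_relators K n d) = W.class_ideal {1..n} ?N"
    by (rule W.genideal_NC_A_relators[OF n d])
  have A: "NC_A K n d = W.A" unfolding NC_A_def presented_algebra_def ideal ..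
  have T: "NC_A_gen K n d = (\<lambda>x. W.cls (free_gen K x))"
    by (rule ext) (unfold NC_A_gen_def presented_gen_def ideal W.cls_def, rule HOL.refl)
  define val where "val u = W.cls (W.mono u)" for u
  define S where "S = {w. w permutes {1..n}}"
  define J where "J = S \<times> {1..d - 1} \<times> {1..n}"
  define red where "red w = (SOME u. reduced_expression n w u)" for w
  define word where "word = (\<lambda>(w, k, m). red w @ replicate k n @ rev [m..<n])"
  have red: "reduced_expression n w (red w)" if "w \<in> S" for w
    unfolding red_def by (rule someI_ex[OF reduced_expression_exists[OF n]]) (use that in \<open>simp add: S_def\<close>)
  have red_set: "set (red w) \<subseteq> {1..n}" and red_run: "?N (red w) = Some (inv_into UNIV w, 0)" if "w \<in> S" for w
    using reduced_expression_run[OF n d _ red[OF that]] that by (simp_all add: S_def)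
  have word_set: "set (word j) \<subseteq> {1..n}" if "j \<in> J" for j
    using that red_set n by (auto simp: J_def word_def)
  have word_run: "?N (word (w, k, m)) = Some (unflat n m (inv_into UNIV w), k)" if "(w, k, m) \<in> J" for w k m
    using that run_nf_product[OF d n red_set red_run] d by (auto simp: J_def word_def)
  \<comment> \<open>By the facts that follow, these words reach each state exactly once, which is
    what \<open>basis_words\<close> asks for.\<close>
  define B where "B = red ` S \<union> word ` J"
  have B_set: "set u \<subseteq> {1..n}" if "u \<in> B" for u
    using that unfolding B_def by (elim UnE imageE) (simp_all only: red_set word_set)
  have B_run: "?N u \<noteq> None" if "u \<in> B" for u
    using that unfolding B_def
  proof (elim UnE imageE)
    fix w assume "w \<in> S" "u = red w"
    then show ?thesis using red_run by simp
  next
    fix j assume "j \<in> J" "u = word j"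
    then show ?thesis using word_run by (cases j) simp
  qed
  have inv_inj: "w = w'" if "w \<in> S" "w' \<in> S" "inv_into UNIV w = inv_into UNIV w'" for w w'
  proof -
    have "inv_into UNIV (inv_into UNIV w) = w" "inv_into UNIV (inv_into UNIV w') = w'"
      using that(1,2) permutes_inv_inv by (simp_all add: S_def)
    then show ?thesis unfolding that(3) by (simp only:)
  qed
  have inj_red: "inj_on (\<lambda>w. ?N (red w)) S"
  proof (rule inj_onI)
    fix w w' assume w: "w \<in> S" "w' \<in> S" and "?N (red w) = ?N (red w')"
    then have "inv_into UNIV w = inv_into UNIV w'" by (simp add: red_run)
    then show "w = w'" by (rule inv_inj[OF w])
  qed
  have inj_word: "inj_on (\<lambda>j. ?N (word j)) J"
  proof (rule inj_onI)
    fix i j assume i: "i \<in> J" and j: "j \<in> J" and e: "?N (word i) = ?N (word j)"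
    obtain w k m w' k' m' where ij: "i = (w, k, m)" "j = (w', k', m')" by (metis prod_cases3)
    have w: "inv_into UNIV w permutes {1..n}" "inv_into UNIV w' permutes {1..n}" "w \<in> S" "w' \<in> S"
      and m: "m \<in> {1..n}" "m' \<in> {1..n}"
      using i j by (auto simp: ij J_def S_def permutes_inv)
    have u: "unflat n m (inv_into UNIV w) = unflat n m' (inv_into UNIV w')" and "k = k'"
      using e word_run[OF i[unfolded ij]] word_run[OF j[unfolded ij]] by (simp_all add: ij)
    have "m = m'" using fun_cong[OF u, of "Suc n"] by (simp add: unflat_def)
    moreover have "inv_into UNIV w = inv_into UNIV w'"
      using flat_unflat[OF w(1) m(1)] flat_unflat[OF w(2) m(2)] u by simp
    then have "w = w'" by (rule inv_inj[OF w(3,4)])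
    ultimately show "i = j" using \<open>k = k'\<close> by (simp add: ij)
  qed
  \<comment> \<open>The exponent separates the two families: it is 0 for reduced words and at least
    1 for the others.\<close>
  have disj: "?N (red w) \<noteq> ?N (word j)" if "w \<in> S" "j \<in> J" for w j
    using that red_run word_run by (cases j) (auto simp: J_def)
  have inj_B: "inj_on ?N B"
    unfolding B_def
  proof (rule inj_onI)
    fix u v assume u: "u \<in> red ` S \<union> word ` J" and v: "v \<in> red ` S \<union> word ` J" and e: "?N u = ?N v"
    show "u = v"
      using u
    proof
      assume "u \<in> red ` S"
      then obtain w where w: "w \<in> S" "u = red w" by auto
      have "v \<notin> word ` J" using disj[OF w(1)] e w(2) by auto
      then obtain w' where w': "w' \<in> S" "v = red w'" using v by blast
      show ?thesis using inj_onD[OF inj_red _ w(1) w'(1)] e w w' by simp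
    next
      assume "u \<in> word ` J"
      then obtain j where j: "j \<in> J" "u = word j" by auto
      have "v \<notin> red ` S" using disj[OF _ j(1)] e j(2) by auto
      then obtain j' where j': "j' \<in> J" "v = word j'" using v by blast
      show ?thesis using inj_onD[OF inj_word _ j(1) j'(1)] e j j' by simp
    qed
  qed
  have span: "\<exists>b\<in>B. ?N b = ?N u" if u: "set u \<subseteq> {1..n}" and nz: "?N u \<noteq> None" for u
  proof -
    obtain q k where r: "?N u = Some (q, k)" using nz by auto
    have st: "(q, k) \<in> states n d" by (rule run_states[OF d start_state[OF d] u r])
    show ?thesis
    proof (cases "k = 0")
      case True
      then have q: "q permutes {1..n}" using st state_zero_iff[OF d] by simp
      \<comment> \<open>A reduced word of a permutation reaches the state of its inverse, so the
        permutation to take is the inverse of \<open>q\<close>.\<close>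
      let ?w = "inv_into UNIV q"
      have w: "?w \<in> S" using permutes_inv[OF q] by (simp add: S_def)
      have "?N (red ?w) = ?N u" using red_run[OF w] permutes_inv_inv[OF q] r True by simp
      then show ?thesis using w by (auto simp: B_def)
    next
      case False
      have q: "q permutes {1..Suc n}" and k: "k < d" "q (Suc n) \<noteq> Suc n"
        using st False by (auto simp: states_def)
      \<comment> \<open>Removing the last value \<open>m = q (Suc n)\<close> leaves
        \<open>flat n q\<close>. The triple consisting of its inverse, \<open>k\<close> and
        \<open>m\<close> leads back to \<open>(q, k)\<close> because \<open>unflat\<close> reverses
        \<open>flat\<close>.\<close>
      let ?w = "inv_into UNIV (flat n q)"
      have w: "?w \<in> S" using permutes_inv[OF flat_permutes[OF q]] by (simp add: S_def)
      have "0 < q (Suc n) \<and> q (Suc n) \<le> Suc n" by (rule permutes_interval_bounds[OF q]) simp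
      then have j: "(?w, k, q (Suc n)) \<in> J" using w k False by (auto simp: J_def)
      have "?N (word (?w, k, q (Suc n))) = ?N u"
        using word_run[OF j] permutes_inv_inv[OF flat_permutes[OF q]] unflat_flat[OF q] r by simp
      then show ?thesis using j by (auto simp: B_def)
    qed
  qed
  have inj_val: "inj_on val B"
    unfolding val_def using W.basis_words(1)[OF B_set B_run inj_B span] by simp
  have basis: "W.A.basis (val ` B)"
    unfolding val_def using W.basis_words(2)[OF B_set B_run inj_B span] by simp
  have wv: "word_val W.A (\<lambda>x. W.cls (free_gen K x)) u = val u" if "set u \<subseteq> {1..n}" for u
    unfolding val_def by (rule W.word_val_A[OF that])
  define Tw where "Tw = T_perm W.A (\<lambda>x. W.cls (free_gen K x)) n"
  have Tw: "Tw w = val (red w)" if "w \<in> S" for w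
    unfolding Tw_def T_perm_def using wv[OF red_set[OF that]] by (simp add: red_def)
  have pow: "W.cls (free_gen K n) [^]\<^bsub>W.A\<^esub> k = val (replicate k n)" for k :: nat
  proof (induction k)
    case 0
    then show ?case by (simp add: val_def W.A_one del: One_nat_def)
  next
    case (Suc k)
    have "set (replicate k n) \<subseteq> {1..n}" "set [n] \<subseteq> {1..n}" using n by auto
    from W.cls_mono_mult[OF this] Suc show ?case
      by (simp add: val_def W.free_gen_eq_mono replicate_append_same del: One_nat_def)
  qed
  define Twkm where "Twkm = (\<lambda>(w, k :: nat, m).
    Tw w \<otimes>\<^bsub>W.A\<^esub> W.cls (free_gen K n) [^]\<^bsub>W.A\<^esub> k \<otimes>\<^bsub>W.A\<^esub>
      word_val W.A (\<lambda>x. W.cls (free_gen K x)) (rev [m..<n]))"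
  have Twkm: "Twkm j = val (word j)" if "j \<in> J" for j
  proof -
    obtain w k m where j: "j = (w, k, m)" by (metis prod_cases3)
    have w: "w \<in> S" and m: "m \<in> {1..n}" using that by (auto simp: j J_def)
    have s: "set (red w) \<subseteq> {1..n}" "set (replicate k n) \<subseteq> {1..n}" "set (rev [m..<n]) \<subseteq> {1..n}"
      "set (red w @ replicate k n) \<subseteq> {1..n}"
      using red_set[OF w] n m by auto
    show ?thesis
      unfolding Twkm_def j word_def prod.case Tw[OF w] pow wv[OF s(3)]
      unfolding val_def W.cls_mono_mult[OF s(1,2)] W.cls_mono_mult[OF s(4,3)] append_assoc ..
  qed
  have TwS: "Tw ` S = val ` red ` S" unfolding image_image using Tw by (intro image_cong) simp_all
  have TwkmJ: "Twkm ` J = val ` word ` J" unfolding image_image using Twkm by (intro image_cong) simp_all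
  have inj_Tw: "inj_on Tw S"
  proof (rule inj_onI)
    fix w w' assume w: "w \<in> S" "w' \<in> S" and e: "Tw w = Tw w'"
    have "red w = red w'"
      using inj_onD[OF inj_val] e w unfolding Tw[OF w(1)] Tw[OF w(2)] B_def by blast
    then show "w = w'" using inj_onD[OF inj_red _ w] by simp
  qed
  have inj_Twkm: "inj_on Twkm J"
  proof (rule inj_onI)
    fix i j assume ij: "i \<in> J" "j \<in> J" and e: "Twkm i = Twkm j"
    have "word i = word j"
      using inj_onD[OF inj_val] e ij unfolding Twkm[OF ij(1)] Twkm[OF ij(2)] B_def by blast
    then show "i = j" using inj_onD[OF inj_word _ ij] by simp
  qed
  have "red ` S \<inter> word ` J = {}"
  proof (rule ccontr)
    assume "red ` S \<inter> word ` J \<noteq> {}"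
    then obtain w j where "w \<in> S" "j \<in> J" "red w = word j" by auto
    then show False using disj[of w j] by simp
  qed
  then have disjoint: "Tw ` S \<inter> Twkm ` J = {}"
    unfolding TwS TwkmJ using inj_on_image_Int[OF inj_val, of "red ` S" "word ` J"] by (simp add: B_def)
  have S_fin: "finite S" "card S = fact n"
    unfolding S_def using finite_permutations[of "{1..n}"] card_permutations[of "{1..n}" n] by simp_all
  have J_fin: "finite J" "card J = fact n * ((d - 1) * n)"
    using S_fin by (simp_all add: J_def card_cartesian_product)
  have card: "card (Tw ` S \<union> Twkm ` J) = fact n * (1 + n * (d - 1))"
    using card_Un_disjoint[OF _ _ disjoint] S_fin J_fin card_image[OF inj_Tw] card_image[OF inj_Twkm]
    by (simp add: algebra_simps)
  have reduced: "word_val W.A (\<lambda>x. W.cls (free_gen K x)) u = Tw w"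
    if w: "w \<in> S" and u: "reduced_expression n w u" for w u
  proof -
    have wp: "w permutes {1..n}" using w by (simp add: S_def)
    note ru = reduced_expression_run[OF n d wp u]
    have "val u = val (red w)"
      unfolding val_def using ru red_run[OF w] by (intro W.cls_mono_eqI[OF ru(1) red_set[OF w]]) simp
    then show ?thesis using wv[OF ru(1)] Tw[OF w] by simp
  qed
  have iso: "algebra_isos K (generated_subalgebra K W.A ((\<lambda>x. W.cls (free_gen K x)) ` {1..l}))
      (nil_Coxeter_A K l) \<noteq> {}" if l: "0 < l \<and> l < n" for l
  proof -
    have l1: "l \<ge> 1" using l by simp
    have "nil_Coxeter_A K l =
        quot_algebra (free_algebra K {1..l}) (W.class_ideal {1..l} (\<lambda>u. run l 2 u start))"
      unfolding nil_Coxeter_A_eq_NC_A[OF l1] NC_A_def presented_algebra_def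
        W.genideal_NC_A_relators[OF l1 order_refl] ..
    moreover have "algebra_isos K (generated_subalgebra K W.A ((\<lambda>x. W.cls (free_gen K x)) ` {1..l}))
        (quot_algebra (free_algebra K {1..l}) (W.class_ideal {1..l} (\<lambda>u. run l 2 u start))) \<noteq> {}"
    \<comment> \<open>On words in the first \<open>l\<close> letters the classes for
      \<open>(n, d)\<close> and for \<open>(l, 2)\<close> coincide.\<close>
    proof (rule W.subalgebra_iso)
      show "{1..l} \<subseteq> {1..n}" using l by auto
      show "word_congruence {1..l} (\<lambda>u. run l 2 u start)" by (rule run_congruence[OF l1 order_refl])
    next
      fix u v assume "set u \<subseteq> {1..l}" "set v \<subseteq> {1..l}"
      then show "run n d u start = run n d v start \<longleftrightarrow> run l 2 u start = run l 2 v start"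
        using run_restrict_eq_iff(1) l by blast
    next
      fix u assume u: "set u \<subseteq> {1..l}"
      then show "run n d u start = None \<longleftrightarrow> run l 2 u start = None"
        using run_restrict_eq_iff(2)[OF u u] l by blast
    qed
    ultimately show ?thesis by simp
  qed
  have "W.A.basis (Tw ` S \<union> Twkm ` J)" using basis unfolding TwS TwkmJ B_def image_Un .
  moreover have "carrier (sym_group n) = S" by (auto simp: sym_group_def S_def)
  ultimately show ?thesis
    unfolding Let_def A T \<open>carrier (sym_group n) = S\<close> Tw_def[symmetric] Twkm_def[symmetric] J_def[symmetric]
    using W.A_vectorspace reduced inj_Tw inj_Twkm disjoint card iso by blast
qed

end
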